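(* Let $n\ge 2$ and $b\ge 1$ be integers, and let $p_1,\dots,p_{n+3}\in\mathbb{P}^n$ be points in general position. The linear system $$\mathcal{L}(b):=\mathcal{L}_{n,b(n+2)}\big((bn)^{n+3}\big)$$ has exactly one element if $n$ is even, and is empty if $n$ is odd. In particular $\mathcal{L}=\mathcal{L}(b)$ satisfies the following: if $\mathcal L$ is non-empty, then it is special only if its base locus contains either linear cycles $L_I$ or cones $\mathrm{J}(L_I,\sigma_t)$ over the secant varieties $\sigma_t$ of the rational normal curve $C$ through the $n+3$ points, and $\dim(\mathcal L)=\sigma\mathrm{ldim}(\mathcal L)$.
   Context: $\mathbb{P}^n$ is projective space over $\mathbb{C}$. $\mathcal{L}=\mathcal{L}_{n,d}(m_1,\dots,m_{n+3})$, with $d,m_i\ge0$ integers, is the linear system of degree-$d$ hypersurfaces of $\mathbb{P}^n$ with multiplicity at least $m_i$ at $p_i$, where $p_1,\dots,p_{n+3}$ are in general position. $\mathcal{L}_{n,d}(m^{s})$ means that $s$ points have multiplicity $m$. $\dim(\mathcal L)$ is the affine dimension, i.e. the dimension of the vector space of degree-$d$ forms defining it. The virtual dimension is $\mathrm{vdim}(\mathcal{L})=\binom{n+d}{n}-\sum_i\binom{n+m_i-1}{n}$, the expected dimension is $\max(\mathrm{vdim}(\mathcal L),0)$, and $\mathcal{L}$ is special if $\dim(\mathcal L)$ is strictly greater than the expected dimension. $C$ is the rational normal curve of degree $n$ through the $n+3$ points. $\sigma_t$ ($t\ge1$) is the closure of the union of the $\mathbb{P}^{t-1}$'s spanned by $t$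 points of $C$, and $\sigma_0=\emptyset$. $L_I$ is the linear span of $\{p_i:i\in I\}$. $\mathrm{J}(L_I,\sigma_t)$ is the join of $L_I$ and $\sigma_t$, with $\mathrm J(L_I,\emptyset)=L_I$ and $\mathrm J(\emptyset,\sigma_t)=\sigma_t$. Set $k_C=\sum_{i=1}^{n+3}m_i-nd$, $k_{I,\sigma_t}=\sum_{i\in I}m_i+t\,k_C-(|I|+t-1)d$ and $r_{I,\sigma_t}=|I|+2t-1$. Secant linear expected dimension: write $n=2l+\epsilon$, $\epsilon\in\{0,1\}$. The (affine) secant linear virtual dimension of $\mathcal L$ is $$\sum_{I,t}(-1)^{|I|}\binom{n+k_{I,\sigma_t}-r_{I,\sigma_t}-1}{n},$$ summed over all $I\subset\{1,\dots,n+3\}$ and $t$ with $0\le t\le l+\epsilon$ and $0\le|I|\le n-2t$, where $\binom{a}{n}=0$ if $a<n$. If $\mathcal L$ is contained in a linear system with negative secant linear virtual dimension, then $\sigma\mathrm{ldim}(\mathcal L)=0$. Otherwise $\sigma\mathrm{ldim}(\mathcal L)$ is the maximum of the secant linear virtual dimension of $\mathcal L$ and $0$. *)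

theory Defs
  imports Complex_Main "HOL-Library.Poly_Mapping"
begin

text \<open>
  Conventions. A point of projective \<open>n\<close>-space over the complex numbers is given by any vector of
  homogeneous coordinates \<open>x\<^sub>0, \<dots>, x\<^sub>n\<close>, encoded as a nonzero \<open>x :: nat \<Rightarrow>\<^sub>0 complex\<close> with
  \<open>keys x \<subseteq> {..n}\<close>. A subset of projective space is the set of all representatives of its points,
  so it is invariant under multiplication by nonzero scalars.
  A polynomial in the variables \<open>x\<^sub>0, x\<^sub>1, \<dots>\<close> is an element of \<open>(nat \<Rightarrow>\<^sub>0 nat) \<Rightarrow>\<^sub>0 complex\<close>
  (coefficients indexed by exponent vectors).
\<close>

definition cscale :: "complex \<Rightarrow> ('a \<Rightarrow>\<^sub>0 complex) \<Rightarrow> ('a \<Rightarrow>\<^sub>0 complex)" where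
  "cscale c f = Poly_Mapping.map ((*) c) f"

lemma lookup_cscale [simp]: "Poly_Mapping.lookup (cscale c f) k = c * Poly_Mapping.lookup f k"
  by (simp add: cscale_def Poly_Mapping.map.rep_eq when_def)

interpretation cvs: vector_space "cscale :: complex \<Rightarrow> ('a \<Rightarrow>\<^sub>0 complex) \<Rightarrow> ('a \<Rightarrow>\<^sub>0 complex)"
  by unfold_locales (auto intro!: poly_mapping_eqI simp: lookup_add algebra_simps)


section \<open>Forms and multiplicities\<close>

type_synonym cpoly = "(nat \<Rightarrow>\<^sub>0 nat) \<Rightarrow>\<^sub>0 complex"

definition is_form :: "nat \<Rightarrow> nat \<Rightarrow> cpoly \<Rightarrow> bool" where
  "is_form n d f \<longleftrightarrow>
     (\<forall>a\<in>Poly_Mapping.keys f.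
        Poly_Mapping.keys a \<subseteq> {..n} \<and>
        (\<Sum>i\<in>Poly_Mapping.keys a. Poly_Mapping.lookup a i) = d)"

definition peval :: "cpoly \<Rightarrow> (nat \<Rightarrow>\<^sub>0 complex) \<Rightarrow> complex" where
  "peval f x =
     (\<Sum>a\<in>Poly_Mapping.keys f. Poly_Mapping.lookup f a *
        (\<Prod>i\<in>Poly_Mapping.keys a. Poly_Mapping.lookup x i ^ Poly_Mapping.lookup a i))"

text \<open>Partial derivative with respect to the variable \<open>x\<^sub>i\<close>.\<close>

definition pdiff :: "nat \<Rightarrow> cpoly \<Rightarrow> cpoly" where
  "pdiff i f =
     (\<Sum>a\<in>Poly_Mapping.keys f.
        Poly_Mapping.single (a - Poly_Mapping.single i 1)
          (of_nat (Poly_Mapping.lookup a i) * Poly_Mapping.lookup f a))"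

text \<open>The hypersurface of the form \<open>f\<close> has multiplicity at least \<open>m\<close> at \<open>x\<close>: all partial
  derivatives of order less than \<open>m\<close> in the homogeneous coordinates vanish at \<open>x\<close>.\<close>

definition mult_ge :: "nat \<Rightarrow> cpoly \<Rightarrow> (nat \<Rightarrow>\<^sub>0 complex) \<Rightarrow> nat \<Rightarrow> bool" where
  "mult_ge n f x m \<longleftrightarrow>
     (\<forall>is. set is \<subseteq> {..n} \<and> length is < m \<longrightarrow> peval (foldr pdiff is f) x = 0)"


section \<open>Subsets of projective space\<close>

definition proj_points :: "nat \<Rightarrow> (nat \<Rightarrow>\<^sub>0 complex) set" where
  "proj_points n = {x. x \<noteq> 0 \<and> Poly_Mapping.keys x \<subseteq> {..n}}"

definition zariski_closure :: "nat \<Rightarrow> (nat \<Rightarrow>\<^sub>0 complex) set \<Rightarrow> (nat \<Rightarrow>\<^sub>0 complex) set" where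
  "zariski_closure n S =
     {x \<in> proj_points n. \<forall>d f. is_form n d f \<and> (\<forall>y\<in>S. peval f y = 0) \<longrightarrow> peval f x = 0}"

definition proj_span :: "(nat \<Rightarrow>\<^sub>0 complex) set \<Rightarrow> (nat \<Rightarrow>\<^sub>0 complex) set" where
  "proj_span S = cvs.span S - {0}"

text \<open>Linearly general position: any \<open>n + 1\<close> of the \<open>n + 3\<close> points span the whole space.\<close>

definition general_position :: "nat \<Rightarrow> (nat \<Rightarrow> nat \<Rightarrow>\<^sub>0 complex) \<Rightarrow> bool" where
  "general_position n p \<longleftrightarrow>
     (\<forall>i\<in>{1..n+3}. p i \<in> proj_points n) \<and>
     (\<forall>J. J \<subseteq> {1..n+3} \<and> card J = n + 1 \<longrightarrow> inj_on p J \<and> cvs.independent (p ` J))"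

text \<open>The image of the projective line under \<open>(s : t) \<mapsto> (s\<^sup>n : s\<^sup>n\<^sup>-\<^sup>1t : \<dots> : t\<^sup>n)\<close>, taken with respect
  to an arbitrary basis \<open>v\<close> of the coordinate space. Rescaling \<open>(s, t)\<close> by \<open>n\<close>-th roots
  produces all representatives of each point (for \<open>n \<ge> 1\<close>).\<close>

definition rational_normal_curve :: "nat \<Rightarrow> (nat \<Rightarrow>\<^sub>0 complex) set \<Rightarrow> bool" where
  "rational_normal_curve n C \<longleftrightarrow>
     (\<exists>v :: nat \<Rightarrow> nat \<Rightarrow>\<^sub>0 complex.
        (\<forall>j\<le>n. Poly_Mapping.keys (v j) \<subseteq> {..n}) \<and> inj_on v {..n} \<and> cvs.independent (v ` {..n}) \<and>
        C = {(\<Sum>j\<le>n. cscale (s ^ (n - j) * t ^ j) (v j)) | s t. (s, t) \<noteq> (0, 0)})"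

text \<open>For \<open>t = 0\<close> this is the empty set, because the closure of the empty set is empty.\<close>

definition secant_variety ::
    "nat \<Rightarrow> nat \<Rightarrow> (nat \<Rightarrow>\<^sub>0 complex) set \<Rightarrow> (nat \<Rightarrow>\<^sub>0 complex) set" where
  "secant_variety n t C =
     zariski_closure n
       (\<Union>{proj_span S | S. S \<subseteq> C \<and> finite S \<and> card S = t \<and> cvs.independent S})"

definition proj_join ::
    "nat \<Rightarrow> (nat \<Rightarrow>\<^sub>0 complex) set \<Rightarrow> (nat \<Rightarrow>\<^sub>0 complex) set \<Rightarrow> (nat \<Rightarrow>\<^sub>0 complex) set" where
  "proj_join n X Y =
     (if X = {} then Y else if Y = {} then X
      else zariski_closure n (\<Union>x\<in>X. \<Union>y\<in>Y. proj_span {x, y}))"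


section \<open>Linear systems with \<open>n + 3\<close> multiple points\<close>

text \<open>The vector space of forms defining the linear system; the linear system itself consists of
  hypersurfaces, that is, of nonzero forms up to nonzero scalars.\<close>

definition system_forms ::
    "nat \<Rightarrow> nat \<Rightarrow> (nat \<Rightarrow> nat \<Rightarrow>\<^sub>0 complex) \<Rightarrow> (nat \<Rightarrow> nat) \<Rightarrow> cpoly set" where
  "system_forms n d p m = {f. is_form n d f \<and> (\<forall>i\<in>{1..n+3}. mult_ge n f (p i) (m i))}"

definition hypersurface :: "cpoly \<Rightarrow> cpoly set" where
  "hypersurface f = {cscale c f | c. c \<noteq> 0}"

definition linear_system ::
    "nat \<Rightarrow> nat \<Rightarrow> (nat \<Rightarrow> nat \<Rightarrow>\<^sub>0 complex) \<Rightarrow> (nat \<Rightarrow> nat) \<Rightarrow> cpoly set set" where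
  "linear_system n d p m = hypersurface ` (system_forms n d p m - {0})"

definition system_dim ::
    "nat \<Rightarrow> nat \<Rightarrow> (nat \<Rightarrow> nat \<Rightarrow>\<^sub>0 complex) \<Rightarrow> (nat \<Rightarrow> nat) \<Rightarrow> int" where
  "system_dim n d p m = int (cvs.dim (system_forms n d p m))"

definition base_locus ::
    "nat \<Rightarrow> nat \<Rightarrow> (nat \<Rightarrow> nat \<Rightarrow>\<^sub>0 complex) \<Rightarrow> (nat \<Rightarrow> nat) \<Rightarrow> (nat \<Rightarrow>\<^sub>0 complex) set" where
  "base_locus n d p m = {x \<in> proj_points n. \<forall>f\<in>system_forms n d p m. peval f x = 0}"

definition vdim :: "nat \<Rightarrow> nat \<Rightarrow> (nat \<Rightarrow> nat) \<Rightarrow> int" where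
  "vdim n d m = int ((n + d) choose n) - (\<Sum>i\<in>{1..n+3}. int ((n + m i - 1) choose n))"

definition special ::
    "nat \<Rightarrow> nat \<Rightarrow> (nat \<Rightarrow> nat \<Rightarrow>\<^sub>0 complex) \<Rightarrow> (nat \<Rightarrow> nat) \<Rightarrow> bool" where
  "special n d p m \<longleftrightarrow> system_dim n d p m > max (vdim n d m) 0"


section \<open>Secant linear dimension\<close>

definition zbinom :: "int \<Rightarrow> nat \<Rightarrow> int" where
  "zbinom a n = (if a < int n then 0 else int (nat a choose n))"

definition k_C :: "nat \<Rightarrow> nat \<Rightarrow> (nat \<Rightarrow> nat) \<Rightarrow> int" where
  "k_C n d m = (\<Sum>i\<in>{1..n+3}. int (m i)) - int n * int d"

definition k_sec :: "nat \<Rightarrow> nat \<Rightarrow> (nat \<Rightarrow> nat) \<Rightarrow> nat set \<Rightarrow> nat \<Rightarrow> int" where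
  "k_sec n d m I t =
     (\<Sum>i\<in>I. int (m i)) + int t * k_C n d m - (int (card I) + int t - 1) * int d"

definition r_sec :: "nat set \<Rightarrow> nat \<Rightarrow> int" where
  "r_sec I t = int (card I) + 2 * int t - 1"

text \<open>The condition \<open>|I| \<le> n - 2t\<close>, with integer subtraction, is written as \<open>card I + 2 * t \<le> n\<close>.\<close>

definition sec_indices :: "nat \<Rightarrow> (nat set \<times> nat) set" where
  "sec_indices n =
     {(I, t). I \<subseteq> {1..n+3} \<and> t \<le> n div 2 + n mod 2 \<and> card I + 2 * t \<le> n}"

definition sec_vdim :: "nat \<Rightarrow> nat \<Rightarrow> (nat \<Rightarrow> nat) \<Rightarrow> int" where
  "sec_vdim n d m =
     (\<Sum>(I, t)\<in>sec_indices n.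
        (- 1) ^ card I * zbinom (int n + k_sec n d m I t - r_sec I t - 1) n)"

text \<open>The containing systems range over all multiplicities at the same points, in the same degree.\<close>

definition sec_ldim ::
    "nat \<Rightarrow> nat \<Rightarrow> (nat \<Rightarrow> nat \<Rightarrow>\<^sub>0 complex) \<Rightarrow> (nat \<Rightarrow> nat) \<Rightarrow> int" where
  "sec_ldim n d p m =
     (if \<exists>m'. linear_system n d p m \<subseteq> linear_system n d p m' \<and> sec_vdim n d m' < 0
      then 0 else max (sec_vdim n d m) 0)"

end

theory Submission
  imports Defs "HOL-Computational_Algebra.Polynomial" "HOL-Library.FuncSet"
begin

text \<open>
  Why the theorem is true. A form of degree \<open>d\<close> has multiplicity at least \<open>m\<close> at a point \<open>p\<close> exactly
  if its restriction to every affine line with direction \<open>p\<close> has degree at most \<open>d - m\<close>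
  (\<open>mult_ge_iff_deg_along\<close>). For \<open>d = b (n + 2)\<close> and \<open>m = b n\<close> this bound is \<open>2 b\<close>, whatever \<open>n\<close> is.

  Take the first \<open>n + 1\<close> points as the coordinate points. A form \<open>F\<close> of the system then has degree at
  most \<open>2 b\<close> in each variable and along two more vectors \<open>u\<close>, \<open>v\<close> without zero coordinates. The standard
  Cremona substitution \<open>G x = (\<Prod>i. x\<^sub>i ^ (2 b)) * F (1 / x)\<close> gives a form of degree \<open>b n\<close>, of degree at
  most \<open>2 b\<close> in each variable, that has multiplicity at least \<open>b n\<close> at the inverses of \<open>u\<close> and \<open>v\<close>. So
  \<open>G\<close> is a cone with these two vertices: it is invariant under translation by \<open>1 / u\<close> and \<open>1 / v\<close>. It lives
  on the quotient by their span, where it has degree at most \<open>2 b\<close> along the images of the \<open>n + 1\<close>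
  coordinate vectors, which are again in general position. This is the original problem with
  \<open>n - 2\<close> in place of \<open>n\<close>, and every step can be reversed (\<open>balanced_descent\<close>). The descent ends for even
  \<open>n\<close> with the powers of one variable (\<open>balanced_form_even_unique\<close>), and for odd \<open>n\<close> with a constant
  that is homogeneous of degree \<open>b > 0\<close>, hence zero (\<open>balanced_form_odd_zero\<close>).

  The forms of the system vanish on the rational normal curve \<open>C\<close>, because on \<open>C\<close> they have degree \<open>n d\<close>
  and \<open>n + 3\<close> zeros of order \<open>b n\<close>, and \<open>(n + 3) b n > n b (n + 2)\<close>.

  For the secant linear dimension with \<open>n\<close> even, a system with multiplicities \<open>m'\<close> that contains the given
  one satisfies \<open>m'\<^sub>i \<le> b n\<close>, since the only form of the given system has multiplicity exactly \<open>b n\<close>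
  at every point. Put \<open>e\<^sub>i = d - m'\<^sub>i\<close> and \<open>T = (\<Sum>i. e\<^sub>i) - 2 d + 2\<close>. The secant linear virtual dimension
  is the coefficient of \<open>z\<^sup>d\<close> in \<open>(\<Prod>i. 1 - z ^ (e\<^sub>i + 1)) / ((1 - z ^ T) (1 - z) ^ (n + 1))\<close>. This is the
  multiplicity of the representation with highest weight \<open>T - 2\<close> in the fusion product, at level \<open>T - 2\<close>, of
  the \<open>sl\<^sub>2\<close>-representations with highest weights \<open>e\<^sub>i\<close>. So it is never negative (\<open>sec_vdim_nonneg\<close>), and it
  is \<open>1\<close> if all \<open>e\<^sub>i\<close> are \<open>2 b = T - 2\<close>, because fusion with the highest weight \<open>T - 2\<close> only reflects
  weights and the number of factors is odd (\<open>sec_vdim_balanced\<close>). For odd \<open>n\<close> the coefficient for the given system is \<open>0\<close> and the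
  secant linear virtual dimension is at most this number, so the secant linear dimension is \<open>0\<close> too.
\<close>

abbreviation lookup where "lookup \<equiv> Poly_Mapping.lookup"
abbreviation keys where "keys \<equiv> Poly_Mapping.keys"
abbreviation single where "single \<equiv> Poly_Mapping.single"

type_synonym vec = "nat \<Rightarrow> complex"

section \<open>Degree along a direction\<close>

text \<open>
  The Lagrange basis for the nodes \<open>0, \<dots>, k\<close>. Interpolation turns "polynomial of degree at most \<open>k\<close>" into
  a linear identity between values (\<open>deg_along_iff\<close>), which is visibly preserved by linear combinations and
  by differentiation.
\<close>

definition lagrange :: "nat \<Rightarrow> nat \<Rightarrow> complex poly" where
  "lagrange k j = (\<Prod>i\<in>{..k} - {j}. smult (1 / (of_nat j - of_nat i)) [:- of_nat i, 1:])"

lemma degree_lagrange: "j \<le> k \<Longrightarrow> degree (lagrange k j) \<le> k"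
proof -
  assume "j \<le> k"
  have "degree (lagrange k j) \<le> (\<Sum>i\<in>{..k} - {j}. 1)"
    unfolding lagrange_def
    by (rule order.trans[OF degree_prod_sum_le]) (auto intro!: sum_mono order.trans[OF degree_smult_le])
  also have "\<dots> = k" using \<open>j \<le> k\<close> by simp
  finally show ?thesis .
qed

lemma poly_lagrange:
  assumes "i \<le> k"
  shows "poly (lagrange k j) (of_nat i) = (if i = j then 1 else 0)"
proof (cases "i = j")
  case True
  have "poly (smult (1 / (of_nat j - of_nat l)) [:- of_nat l, 1:]) (of_nat j) = (1 :: complex)"
    if "l \<noteq> j" for l
    using that by (simp add: divide_simps)
  then have "poly (lagrange k j) (of_nat j) = 1"
    unfolding lagrange_def poly_prod by (intro prod.neutral) auto
  then show ?thesis using True by simp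
next
  case False
  then have "poly (lagrange k j) (of_nat i) = 0"
    unfolding lagrange_def poly_prod by (intro prod_zero) (use assms in auto)
  then show ?thesis using False by simp
qed

lemma interpolation:
  fixes q :: "complex poly"
  assumes "degree q \<le> k"
  shows "poly q s = (\<Sum>j\<le>k. poly (lagrange k j) s * poly q (of_nat j))"
proof -
  let ?r = "\<Sum>j\<le>k. smult (poly q (of_nat j)) (lagrange k j)"
  have "q = ?r"
  proof (rule poly_eqI_degree[where A = "of_nat ` {..k}"])
    show "poly q x = poly ?r x" if "x \<in> of_nat ` {..k}" for x :: complex
      using that by (auto simp: poly_sum poly_lagrange if_distrib cong: if_cong)
    show "degree q < card (of_nat ` {..k} :: complex set)"
      using assms by (simp add: card_image inj_on_def)
    have "degree ?r \<le> k"
      by (intro degree_sum_le order.trans[OF degree_smult_le] degree_lagrange) auto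
    then show "degree ?r < card (of_nat ` {..k} :: complex set)"
      by (simp add: card_image inj_on_def)
  qed
  then have "poly q s = poly ?r s" by simp
  then show ?thesis by (simp add: poly_sum mult.commute)
qed

text \<open>
  For a form of degree \<open>d\<close>, degree at most \<open>d - m\<close> along \<open>p\<close> means multiplicity at least \<open>m\<close> at \<open>p\<close>. In this
  shape the condition does not refer to derivatives or coordinates, so it can be carried through the
  changes of variables below.
\<close>

definition deg_along :: "nat \<Rightarrow> (vec \<Rightarrow> complex) \<Rightarrow> vec \<Rightarrow> bool" where
  "deg_along k F p \<longleftrightarrow>
     (\<forall>x. \<exists>q. degree q \<le> k \<and> (\<forall>s. F (\<lambda>i. x i + s * p i) = poly q s))"

lemma deg_along_iff:
  "deg_along k F p \<longleftrightarrow>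
     (\<forall>x s. F (\<lambda>i. x i + s * p i) = (\<Sum>j\<le>k. poly (lagrange k j) s * F (\<lambda>i. x i + of_nat j * p i)))"
proof
  assume L: "deg_along k F p"
  show "\<forall>x s. F (\<lambda>i. x i + s * p i) = (\<Sum>j\<le>k. poly (lagrange k j) s * F (\<lambda>i. x i + of_nat j * p i))"
  proof (intro allI)
    fix x s
    obtain q where q: "degree q \<le> k" "\<And>s. F (\<lambda>i. x i + s * p i) = poly q s"
      using L unfolding deg_along_def by blast
    show "F (\<lambda>i. x i + s * p i) = (\<Sum>j\<le>k. poly (lagrange k j) s * F (\<lambda>i. x i + of_nat j * p i))"
      unfolding q(2) by (rule interpolation[OF q(1)])
  qed
next
  assume R: "\<forall>x s. F (\<lambda>i. x i + s * p i) = (\<Sum>j\<le>k. poly (lagrange k j) s * F (\<lambda>i. x i + of_nat j * p i))"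
  show "deg_along k F p"
    unfolding deg_along_def
  proof
    fix x
    let ?q = "\<Sum>j\<le>k. smult (F (\<lambda>i. x i + of_nat j * p i)) (lagrange k j)"
    have "degree ?q \<le> k"
      by (intro degree_sum_le order.trans[OF degree_smult_le] degree_lagrange) auto
    moreover have "\<forall>s. F (\<lambda>i. x i + s * p i) = poly ?q s"
    proof
      fix s
      have "poly ?q s = (\<Sum>j\<le>k. poly (lagrange k j) s * F (\<lambda>i. x i + of_nat j * p i))"
        by (simp add: poly_sum mult.commute)
      then show "F (\<lambda>i. x i + s * p i) = poly ?q s" using R by metis
    qed
    ultimately show "\<exists>q. degree q \<le> k \<and> (\<forall>s. F (\<lambda>i. x i + s * p i) = poly q s)" by blast
  qed
qed

lemma deg_along_scale:
  assumes "deg_along k F p"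
  shows "deg_along k F (\<lambda>i. c * p i)"
  unfolding deg_along_def
proof
  fix x
  obtain q where q: "degree q \<le> k" "\<And>s. F (\<lambda>i. x i + s * p i) = poly q s"
    using assms unfolding deg_along_def by blast
  have "degree (pcompose q [:0, c:]) \<le> k"
  proof -
    have "degree q * degree [:0, c:] \<le> degree q * 1" by (intro mult_left_mono) auto
    then show ?thesis using q(1) order.trans[OF degree_pcompose_le] by fastforce
  qed
  moreover have "F (\<lambda>i. x i + s * (c * p i)) = poly (pcompose q [:0, c:]) s" for s
    using q(2)[of "s * c"] by (simp add: poly_pcompose mult.assoc)
  ultimately show "\<exists>q. degree q \<le> k \<and> (\<forall>s. F (\<lambda>i. x i + s * (c * p i)) = poly q s)" by blast
qed

lemma deg_along_diff_scaled:
  assumes "deg_along k F p" "deg_along k G p"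
  shows "deg_along k (\<lambda>x. F x - c * G x) p"
  unfolding deg_along_iff
proof (intro allI)
  fix x s
  let ?P = "\<lambda>F. (\<Sum>j\<le>k. poly (lagrange k j) s * F (\<lambda>i. x i + of_nat j * p i))"
  have F: "F (\<lambda>i. x i + s * p i) = ?P F" and G: "G (\<lambda>i. x i + s * p i) = ?P G"
    using assms unfolding deg_along_iff by blast+
  show "F (\<lambda>i. x i + s * p i) - c * G (\<lambda>i. x i + s * p i) = ?P (\<lambda>x. F x - c * G x)"
    unfolding F G by (simp add: algebra_simps sum_subtractf sum_distrib_left)
qed

definition unit :: "nat \<Rightarrow> nat \<Rightarrow> complex" where
  "unit i = (\<lambda>j. if j = i then 1 else 0)"

lemma add_unit: "(\<lambda>j. x j + s * unit i j) = x(i := x i + s)"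
  by (auto simp: unit_def)

lemma deg_along_unitD:
  assumes "deg_along k F (unit i)"
  obtains q where "degree q \<le> k" "\<And>s. F (x(i := s)) = poly q s"
proof -
  obtain q where q: "degree q \<le> k" "\<And>s. F (\<lambda>j. (x(i := 0)) j + s * unit i j) = poly q s"
    using assms unfolding deg_along_def by blast
  have "F (x(i := s)) = poly q s" for s
  proof -
    have "(\<lambda>j. (x(i := 0)) j + s * unit i j) = x(i := s)" by (auto simp: unit_def)
    then show ?thesis using q(2)[of s] by metis
  qed
  then show thesis using that q(1) by blast
qed

lemma deg_along_unitI:
  assumes "\<And>x. \<exists>q. degree q \<le> k \<and> (\<forall>s. F (x(i := s)) = poly q s)"
  shows "deg_along k F (unit i)"
  unfolding deg_along_def add_unit
proof
  fix x
  obtain q where q: "degree q \<le> k" "\<And>s. F (x(i := s)) = poly q s" using assms by blast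
  have "degree (pcompose q [:x i, 1:]) \<le> k"
    using q(1) by (simp add: degree_pcompose)
  moreover have "F (x(i := x i + s)) = poly (pcompose q [:x i, 1:]) s" for s
    by (simp add: poly_pcompose q(2))
  ultimately show "\<exists>q. degree q \<le> k \<and> (\<forall>s. F (x(i := x i + s)) = poly q s)" by blast
qed

lemma deg_along_unit_interp:
  assumes "deg_along k F (unit i)"
  shows "F x = (\<Sum>j\<le>k. poly (lagrange k j) (x i) * F (x(i := of_nat j)))"
proof -
  obtain q where q: "degree q \<le> k" "\<And>s. F (x(i := s)) = poly q s"
    using deg_along_unitD[OF assms, of x] by blast
  have "F x = poly q (x i)" using q(2)[of "x i"] by simp
  also have "\<dots> = (\<Sum>j\<le>k. poly (lagrange k j) (x i) * poly q (of_nat j))"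
    by (rule interpolation[OF q(1)])
  finally show ?thesis by (simp add: q(2))
qed

section \<open>Functions of bounded degree in each coordinate\<close>

lemma poly_eqI_nonzero:
  fixes p q :: "complex poly"
  assumes "\<And>s. s \<noteq> 0 \<Longrightarrow> poly p s = poly q s"
  shows "p = q"
proof (rule ccontr)
  assume "p \<noteq> q"
  then have "finite {s. poly (p - q) s = 0}" by (intro poly_roots_finite) simp
  moreover have "UNIV - {0} \<subseteq> {s. poly (p - q) s = 0}" using assms by auto
  ultimately have "finite (UNIV - {0 :: complex})" by (rule finite_subset[rotated])
  then show False by (simp add: infinite_UNIV_char_0)
qed

text \<open>
  Coordinates that vanish are restored one at a time: as a polynomial in such a coordinate, \<open>F\<close> is zero
  away from \<open>0\<close>.
\<close>

lemma torus_zero: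
  assumes "finite I" and "\<And>i. i \<in> I \<Longrightarrow> deg_along k F (unit i)"
    and "\<And>x. (\<forall>i\<in>I. x i \<noteq> 0) \<Longrightarrow> F x = 0"
  shows "F x = 0"
  using assms(1)[THEN finite_subset[OF Collect_restrict[of I "\<lambda>i. x i = 0"]]]
proof (induction "card {i \<in> I. x i = 0}" arbitrary: x)
  case 0
  then have "{i \<in> I. x i = 0} = {}" by simp
  then show ?case by (intro assms(3)) auto
next
  case (Suc m)
  then obtain i where i: "i \<in> I" "x i = 0" by (metis (mono_tags, lifting) Collect_empty_eq card.empty nat.distinct(1))
  obtain q where q: "degree q \<le> k" "\<And>s. F (x(i := s)) = poly q s"
    using deg_along_unitD[OF assms(2)[OF i(1)], of x] by blast
  have nz: "poly q s = 0" if "s \<noteq> 0" for s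
  proof -
    have "{j \<in> I. (x(i := s)) j = 0} = {j \<in> I. x j = 0} - {i}" using that by auto
    moreover have "card ({j \<in> I. x j = 0} - {i}) = m"
      using Suc(2,3) i by (subst card_Diff_singleton) auto
    ultimately have "F (x(i := s)) = 0" using Suc(3) by (intro Suc(1)) auto
    then show ?thesis by (simp add: q(2))
  qed
  have "q = 0" by (rule poly_eqI_nonzero) (simp add: nz)
  then show ?case using q(2)[of "x i"] by simp
qed

text \<open>
  Polynomials in \<open>x\<^sub>0, \<dots>, x\<^sub>n\<close> of degree at most \<open>k\<close> in each variable, described by their values only:
  no coefficients have to be tracked under substitutions, and \<open>multipoly_interp\<close> recovers the polynomial.
\<close>

definition multipoly :: "nat \<Rightarrow> nat \<Rightarrow> (vec \<Rightarrow> complex) \<Rightarrow> bool" where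
  "multipoly n k F \<longleftrightarrow> (\<forall>x y. (\<forall>i\<le>n. x i = y i) \<longrightarrow> F x = F y) \<and> (\<forall>i\<le>n. deg_along k F (unit i))"

lemma multipoly_cong: "multipoly n k F \<Longrightarrow> (\<And>i. i \<le> n \<Longrightarrow> x i = y i) \<Longrightarrow> F x = F y"
  unfolding multipoly_def by blast

lemma multipoly_unit: "multipoly n k F \<Longrightarrow> i \<le> n \<Longrightarrow> deg_along k F (unit i)"
  unfolding multipoly_def by blast

text \<open>
  Lagrange interpolation in one coordinate after the other writes \<open>F\<close> as a combination of products of
  univariate polynomials. Boundedness, restriction to curves and the Cremona transformation are read off
  from these products.
\<close>

lemma tensor_interp:
  assumes "finite I" and "\<And>i. i \<in> I \<Longrightarrow> deg_along k F (unit i)"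
  shows "F x = (\<Sum>a\<in>PiE I (\<lambda>_. {..k}). (\<Prod>i\<in>I. poly (lagrange k (a i)) (x i)) *
                    F (\<lambda>i. if i \<in> I then of_nat (a i) else x i))"
  using assms
proof (induction I arbitrary: x rule: finite_induct)
  case (insert l I)
  let ?A = "PiE I (\<lambda>_. {..k})"
  let ?c = "\<lambda>a. (\<Prod>i\<in>I. poly (lagrange k (a i)) (x i))"
  have "F x = (\<Sum>j\<le>k. poly (lagrange k j) (x l) * F (x(l := of_nat j)))"
    by (rule deg_along_unit_interp) (simp add: insert.prems)
  also have "\<dots> = (\<Sum>j\<le>k. \<Sum>a\<in>?A. poly (lagrange k j) (x l) * (\<Prod>i\<in>I. poly (lagrange k (a i)) ((x(l := of_nat j)) i)) *
                F (\<lambda>i. if i \<in> I then of_nat (a i) else (x(l := of_nat j)) i))"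
    by (subst insert.IH) (use insert.prems in \<open>auto simp: sum_distrib_left mult.assoc\<close>)
  also have "\<dots> = (\<Sum>(j, a)\<in>{..k} \<times> ?A. poly (lagrange k j) (x l) * ?c a *
                F (\<lambda>i. if i \<in> I then of_nat (a i) else (x(l := of_nat j)) i))"
    unfolding sum.cartesian_product
  proof (rule sum.cong[OF refl], clarify)
    fix j a
    have "(\<Prod>i\<in>I. poly (lagrange k (a i)) ((x(l := of_nat j)) i)) = ?c a"
      by (rule prod.cong) (use insert.hyps in auto)
    then show "poly (lagrange k j) (x l) * (\<Prod>i\<in>I. poly (lagrange k (a i)) ((x(l := of_nat j)) i)) *
         F (\<lambda>i. if i \<in> I then of_nat (a i) else (x(l := of_nat j)) i) =
       poly (lagrange k j) (x l) * ?c a * F (\<lambda>i. if i \<in> I then of_nat (a i) else (x(l := of_nat j)) i)"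
      by simp
  qed
  also have "\<dots> = (\<Sum>a\<in>PiE (insert l I) (\<lambda>_. {..k}). (\<Prod>i\<in>insert l I. poly (lagrange k (a i)) (x i)) *
                    F (\<lambda>i. if i \<in> insert l I then of_nat (a i) else x i))"
    unfolding PiE_insert_eq
  proof (subst sum.reindex[OF inj_combinator[OF insert.hyps(2)]], rule sum.cong[OF refl], clarify)
    fix j a assume "a \<in> ?A"
    have e1: "(\<lambda>i. if i \<in> I then of_nat (a i) else (x(l := of_nat j)) i)
        = (\<lambda>i. if i \<in> insert l I then of_nat ((a(l := j)) i) else x i)"
      using insert.hyps by auto
    have e2: "(\<Prod>i\<in>I. poly (lagrange k ((a(l := j)) i)) (x i)) = ?c a"
      by (rule prod.cong) (use insert.hyps in auto)
    show "poly (lagrange k j) (x l) * ?c a * F (\<lambda>i. if i \<in> I then of_nat (a i) else (x(l := of_nat j)) i)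
       = ((\<lambda>a. (\<Prod>i\<in>insert l I. poly (lagrange k (a i)) (x i)) *
                    F (\<lambda>i. if i \<in> insert l I then of_nat (a i) else x i)) \<circ> (\<lambda>(y, g). g(l := y))) (j, a)"
      unfolding o_def prod.case e1 prod.insert[OF insert.hyps] e2 by simp
  qed
  finally show ?case .
next
  case empty
  show ?case by simp
qed

lemma multipoly_interp:
  assumes "multipoly n k F"
  obtains c where "\<And>x. F x = (\<Sum>a\<in>PiE {..n} (\<lambda>_. {..k}). c a * (\<Prod>i\<le>n. poly (lagrange k (a i)) (x i)))"
proof
  fix x
  have "F x = (\<Sum>a\<in>PiE {..n} (\<lambda>_. {..k}). (\<Prod>i\<le>n. poly (lagrange k (a i)) (x i)) *
                    F (\<lambda>i. if i \<in> {..n} then of_nat (a i) else x i))"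
    by (rule tensor_interp) (use assms in \<open>auto simp: multipoly_def\<close>)
  also have "\<dots> = (\<Sum>a\<in>PiE {..n} (\<lambda>_. {..k}). F (\<lambda>i. of_nat (a i)) * (\<Prod>i\<le>n. poly (lagrange k (a i)) (x i)))"
  proof (rule sum.cong[OF refl])
    fix a
    have "F (\<lambda>i. if i \<in> {..n} then of_nat (a i) else x i) = F (\<lambda>i. of_nat (a i))"
      by (rule multipoly_cong[OF assms]) simp
    then show "(\<Prod>i\<le>n. poly (lagrange k (a i)) (x i)) * F (\<lambda>i. if i \<in> {..n} then of_nat (a i) else x i)
      = F (\<lambda>i. of_nat (a i)) * (\<Prod>i\<le>n. poly (lagrange k (a i)) (x i))" by simp
  qed
  finally show "F x = (\<Sum>a\<in>PiE {..n} (\<lambda>_. {..k}). F (\<lambda>i. of_nat (a i)) * (\<Prod>i\<le>n. poly (lagrange k (a i)) (x i)))" .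
qed

lemma multipolyI_prods:
  assumes F: "\<And>x. F x = (\<Sum>a\<in>A. c a * (\<Prod>i\<le>n. poly (r a i) (x i)))"
    and deg: "\<And>a i. a \<in> A \<Longrightarrow> i \<le> n \<Longrightarrow> degree (r a i) \<le> k"
  shows "multipoly n k F"
  unfolding multipoly_def
proof (intro conjI allI impI)
  fix i assume i: "i \<le> n"
  show "deg_along k F (unit i)"
  proof (rule deg_along_unitI)
    fix x
    let ?q = "\<Sum>a\<in>A. smult (c a * (\<Prod>l\<in>{..n} - {i}. poly (r a l) (x l))) (r a i)"
    have "degree ?q \<le> k"
    proof (cases "finite A")
      case True
      then show ?thesis
        by (intro degree_sum_le order.trans[OF degree_smult_le]) (use deg i in auto)
    qed simp
    moreover have "F (x(i := s)) = poly ?q s" for s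
    proof -
      have "(\<Prod>l\<le>n. poly (r a l) ((x(i := s)) l)) = poly (r a i) s * (\<Prod>l\<in>{..n} - {i}. poly (r a l) (x l))" for a
        using i by (subst prod.remove[of _ i]) auto
      then show ?thesis by (simp add: F poly_sum algebra_simps)
    qed
    ultimately show "\<exists>q. degree q \<le> k \<and> (\<forall>s. F (x(i := s)) = poly q s)" by blast
  qed
qed (simp add: F)

lemma multipoly_curve:
  assumes "multipoly n k F"
  obtains Q where "\<And>s. F (\<lambda>i. poly (c i) s) = poly Q s"
proof -
  obtain C where C: "\<And>x. F x = (\<Sum>a\<in>PiE {..n} (\<lambda>_. {..k}). C a * (\<Prod>i\<le>n. poly (lagrange k (a i)) (x i)))"
    using multipoly_interp[OF assms] by blast
  show thesis
    by (rule that[of "\<Sum>a\<in>PiE {..n} (\<lambda>_. {..k}). smult (C a) (\<Prod>i\<le>n. pcompose (lagrange k (a i)) (c i))"])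
      (simp add: C poly_sum poly_prod poly_pcompose)
qed

lemma poly_bounded_on_disc:
  fixes q :: "complex poly"
  shows "\<exists>C\<ge>0. \<forall>s. norm s \<le> B \<longrightarrow> norm (poly q s) \<le> C"
proof (induction q)
  case (pCons a q)
  then obtain C where C: "C \<ge> 0" "\<And>s. norm s \<le> B \<Longrightarrow> norm (poly q s) \<le> C" by blast
  have "norm (poly (pCons a q) s) \<le> norm a + \<bar>B\<bar> * C" if "norm s \<le> B" for s
  proof -
    have "norm (poly (pCons a q) s) \<le> norm a + norm s * norm (poly q s)"
      using norm_triangle_ineq[of a "s * poly q s"] by (simp add: norm_mult)
    also have "norm s * norm (poly q s) \<le> \<bar>B\<bar> * C"
      using that C by (intro mult_mono) auto
    finally show ?thesis by simp
  qed
  moreover have "norm a + \<bar>B\<bar> * C \<ge> 0" using C by simp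
  ultimately show ?case by blast
qed auto

lemma multipoly_bounded:
  assumes "multipoly n k F"
  shows "\<exists>C\<ge>0. \<forall>x. (\<forall>i\<le>n. norm (x i) \<le> B) \<longrightarrow> norm (F x) \<le> C"
proof -
  obtain c where c: "\<And>x. F x = (\<Sum>a\<in>PiE {..n} (\<lambda>_. {..k}). c a * (\<Prod>i\<le>n. poly (lagrange k (a i)) (x i)))"
    using multipoly_interp[OF assms] by blast
  obtain D :: "complex poly \<Rightarrow> real" where D: "\<And>q. D q \<ge> 0" "\<And>q s. norm s \<le> B \<Longrightarrow> norm (poly q s) \<le> D q"
    using poly_bounded_on_disc[of B] by metis
  let ?C = "\<Sum>a\<in>PiE {..n} (\<lambda>_. {..k}). norm (c a) * (\<Prod>i\<le>n. D (lagrange k (a i)))"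
  have "norm (F x) \<le> ?C" if "\<forall>i\<le>n. norm (x i) \<le> B" for x
    unfolding c
    by (intro sum_norm_le, unfold norm_mult prod_norm[symmetric], intro mult_left_mono prod_mono)
      (use that D in auto)
  moreover have "?C \<ge> 0" by (intro sum_nonneg mult_nonneg_nonneg prod_nonneg) (use D in auto)
  ultimately show ?thesis by blast
qed

lemma exists_reversed_poly:
  fixes q :: "complex poly"
  assumes "degree q \<le> k"
  shows "\<exists>r. degree r \<le> k \<and> (\<forall>s. s \<noteq> 0 \<longrightarrow> poly r s = s ^ k * poly q (1 / s))"
proof (intro exI conjI allI impI)
  let ?r = "monom 1 (k - degree q) * reflect_poly q"
  have "degree ?r \<le> degree (monom 1 (k - degree q) :: complex poly) + degree (reflect_poly q)"
    by (rule degree_mult_le)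
  also have "\<dots> \<le> (k - degree q) + degree q"
    by (intro add_mono degree_monom_le degree_reflect_poly_le)
  finally show "degree ?r \<le> k" using assms by simp
  fix s :: complex assume "s \<noteq> 0"
  then show "poly ?r s = s ^ k * poly q (1 / s)"
    using assms by (simp add: poly_monom poly_reflect_poly_nz inverse_eq_divide flip: power_add mult.assoc)
qed

lemma multipoly_reflect:
  assumes "multipoly n k F"
  shows "\<exists>G. multipoly n k G \<and>
    (\<forall>x. (\<forall>i\<le>n. x i \<noteq> 0) \<longrightarrow> G x = (\<Prod>i\<le>n. x i ^ k) * F (\<lambda>i. 1 / x i))"
proof -
  obtain c where c: "\<And>x. F x = (\<Sum>a\<in>PiE {..n} (\<lambda>_. {..k}). c a * (\<Prod>i\<le>n. poly (lagrange k (a i)) (x i)))"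
    using multipoly_interp[OF assms] by blast
  have "\<forall>j. \<exists>r. j \<le> k \<longrightarrow> degree r \<le> k \<and> (\<forall>s. s \<noteq> 0 \<longrightarrow> poly r s = s ^ k * poly (lagrange k j) (1 / s))"
    using exists_reversed_poly[OF degree_lagrange] by blast
  then obtain R where R: "\<And>j. j \<le> k \<Longrightarrow> degree (R j) \<le> k"
    "\<And>j s. j \<le> k \<Longrightarrow> s \<noteq> 0 \<Longrightarrow> poly (R j) s = s ^ k * poly (lagrange k j) (1 / s)"
    by metis
  let ?G = "\<lambda>x. \<Sum>a\<in>PiE {..n} (\<lambda>_. {..k}). c a * (\<Prod>i\<le>n. poly (R (a i)) (x i))"
  have "multipoly n k ?G"
    by (rule multipolyI_prods[OF refl]) (use R(1) in \<open>auto simp: PiE_iff\<close>)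
  moreover have "?G x = (\<Prod>i\<le>n. x i ^ k) * F (\<lambda>i. 1 / x i)" if x: "\<forall>i\<le>n. x i \<noteq> 0" for x
  proof -
    have "(\<Prod>i\<le>n. poly (R (a i)) (x i)) = (\<Prod>i\<le>n. x i ^ k) * (\<Prod>i\<le>n. poly (lagrange k (a i)) (1 / x i))"
      if "a \<in> PiE {..n} (\<lambda>_. {..k})" for a
      unfolding prod.distrib[symmetric]
      by (rule prod.cong[OF refl]) (use that x R(2) in \<open>auto simp: PiE_iff\<close>)
    then show ?thesis by (simp add: c sum_distrib_left algebra_simps)
  qed
  ultimately show ?thesis by blast
qed

section \<open>Growth and order of vanishing\<close>

text \<open>
  The factor \<open>c = 0\<close> is excluded, so that the property can be tested where all coordinates are nonzero.
\<close>

definition homogeneous :: "nat \<Rightarrow> (vec \<Rightarrow> complex) \<Rightarrow> bool" where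
  "homogeneous d F \<longleftrightarrow> (\<forall>c x. c \<noteq> 0 \<longrightarrow> F (\<lambda>i. c * x i) = c ^ d * F x)"

lemma homogeneousD: "homogeneous d F \<Longrightarrow> c \<noteq> 0 \<Longrightarrow> F (\<lambda>i. c * x i) = c ^ d * F x"
  unfolding homogeneous_def by blast

lemma poly_growth:
  fixes q :: "complex poly"
  assumes "degree q \<le> k"
  shows "\<exists>C\<ge>0. \<forall>s. norm s \<ge> 1 \<longrightarrow> norm (poly q s) \<le> C * norm s ^ k"
proof (intro exI conjI allI impI)
  let ?C = "\<Sum>i\<le>degree q. norm (coeff q i)"
  show "?C \<ge> 0" by (intro sum_nonneg) auto
  fix s :: complex assume s: "norm s \<ge> 1"
  have "norm (poly q s) \<le> (\<Sum>i\<le>degree q. norm (coeff q i) * norm s ^ k)"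
    unfolding poly_altdef
  proof (rule sum_norm_le)
    fix i assume "i \<in> {..degree q}"
    then have "norm s ^ i \<le> norm s ^ k" using s assms by (intro power_increasing) auto
    then show "norm (coeff q i * s ^ i) \<le> norm (coeff q i) * norm s ^ k"
      by (simp add: norm_mult norm_power mult_left_mono)
  qed
  then show "norm (poly q s) \<le> ?C * norm s ^ k" by (simp add: sum_distrib_right)
qed

text \<open>
  The zero polynomial is a separate alternative because its degree is \<open>0\<close> by convention, while the bound
  may exclude even nonzero constants (\<open>a > b\<close>).
\<close>

lemma degree_le_of_growth:
  fixes q :: "complex poly"
  assumes bound: "\<And>s. norm s \<ge> R \<Longrightarrow> norm (poly q s) * norm s ^ a \<le> C * norm s ^ b"
  shows "q = 0 \<or> degree q + a \<le> b"
proof (rule ccontr)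
  assume "\<not> ?thesis"
  then have q: "q \<noteq> 0" and b: "Suc b \<le> degree q + a" by auto
  let ?f = "\<lambda>s. poly q s / s ^ degree q"
  have lim: "(?f \<longlongrightarrow> lead_coeff q) at_infinity"
    by (rule poly_divide_tendsto_aux)
  have "(?f \<longlongrightarrow> 0) at_infinity"
  proof (rule tendsto_0_le[OF tendsto_inverse_0])
    have "norm (?f s) \<le> norm C * norm (inverse s)" if s: "norm s \<ge> max R 1" for s
    proof -
      have s1: "norm s \<ge> 1" and s0: "norm s > 0" using s by auto
      have "norm (poly q s) * norm s ^ a \<le> norm C * norm s ^ b"
        using bound[of s] s by (smt (verit) max.bounded_iff mult_right_mono norm_ge_zero real_norm_def zero_le_power)
      then have "norm (poly q s) * norm s ^ a * norm s \<le> norm C * norm s ^ Suc b"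
        using s0 by simp
      also have "\<dots> \<le> norm C * norm s ^ (degree q + a)"
        using s1 b by (intro mult_left_mono power_increasing) auto
      finally have "(norm (poly q s) * norm s) * norm s ^ a \<le> (norm C * norm s ^ degree q) * norm s ^ a"
        by (simp add: power_add mult_ac)
      then have "norm (poly q s) * norm s \<le> norm C * norm s ^ degree q"
        using s0 by (simp add: mult_le_cancel_right)
      then show ?thesis using s0 by (simp add: norm_divide norm_power norm_inverse field_simps)
    qed
    then have "norm (?f s) \<le> norm (inverse s) * norm C" if "norm s \<ge> max R 1" for s
      using that by (metis mult.commute)
    then show "eventually (\<lambda>s. norm (?f s) \<le> norm (inverse s) * norm C) at_infinity"
      unfolding eventually_at_infinity by blast
  qed
  moreover have "(at_infinity :: complex filter) \<noteq> bot"
  proof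
    assume "(at_infinity :: complex filter) = bot"
    then have "eventually (\<lambda>_ :: complex. False) at_infinity" by simp
    then obtain B where "\<And>x :: complex. \<not> B \<le> norm x"
      unfolding eventually_at_infinity by blast
    from this[of "of_real \<bar>B\<bar>"] show False by simp
  qed
  ultimately have "lead_coeff q = 0" using lim tendsto_unique by blast
  then show False using q by simp
qed

lemma growth_along:
  assumes F: "multipoly n k F" and u: "deg_along j F u"
  shows "\<exists>C\<ge>0. \<forall>y s. (\<forall>i\<le>n. norm (y i) \<le> B) \<and> norm s \<ge> 1 \<longrightarrow>
    norm (F (\<lambda>i. y i + s * u i)) \<le> C * norm s ^ j"
proof -
  define B' where "B' = B + real j * (\<Sum>i\<le>n. norm (u i))"
  obtain D where D: "D \<ge> 0" "\<And>x. (\<forall>i\<le>n. norm (x i) \<le> B') \<Longrightarrow> norm (F x) \<le> D"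
    using multipoly_bounded[OF F, of B'] by blast
  have "\<forall>i. \<exists>C. i \<le> j \<longrightarrow> C \<ge> 0 \<and> (\<forall>s. norm s \<ge> 1 \<longrightarrow> norm (poly (lagrange j i) s) \<le> C * norm s ^ j)"
    using poly_growth[OF degree_lagrange] by blast
  then obtain C where C: "\<And>i. i \<le> j \<Longrightarrow> C i \<ge> 0"
    "\<And>i s. i \<le> j \<Longrightarrow> norm s \<ge> 1 \<Longrightarrow> norm (poly (lagrange j i) s) \<le> C i * norm s ^ j" by metis
  have "norm (F (\<lambda>i. y i + s * u i)) \<le> (\<Sum>i\<le>j. C i * D) * norm s ^ j"
    if y: "\<forall>i\<le>n. norm (y i) \<le> B" and s: "norm s \<ge> 1" for y s
  proof -
    have FB: "norm (F (\<lambda>l. y l + of_nat i * u l)) \<le> D" if i: "i \<le> j" for i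
    proof (rule D(2), intro allI impI)
      fix l assume l: "l \<le> n"
      have "norm (u l) \<le> (\<Sum>i\<le>n. norm (u i))" using l by (intro member_le_sum) auto
      then have "real i * norm (u l) \<le> real j * (\<Sum>i\<le>n. norm (u i))"
        using i by (intro mult_mono) auto
      moreover have "norm (y l + of_nat i * u l) \<le> norm (y l) + real i * norm (u l)"
        using norm_triangle_ineq[of "y l" "of_nat i * u l"] by (simp add: norm_mult)
      ultimately show "norm (y l + of_nat i * u l) \<le> B'" using y l by (fastforce simp: B'_def)
    qed
    have "F (\<lambda>i. y i + s * u i) = (\<Sum>i\<le>j. poly (lagrange j i) s * F (\<lambda>l. y l + of_nat i * u l))"
      using u unfolding deg_along_iff by blast
    also have "norm \<dots> \<le> (\<Sum>i\<le>j. C i * norm s ^ j * D)"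
    proof (rule sum_norm_le)
      fix i assume i: "i \<in> {..j}"
      then have "norm (poly (lagrange j i) s) \<le> C i * norm s ^ j" "C i \<ge> 0" using C s by auto
      then show "norm (poly (lagrange j i) s * F (\<lambda>l. y l + of_nat i * u l)) \<le> C i * norm s ^ j * D"
        unfolding norm_mult using FB i D(1) by (intro mult_mono) auto
    qed
    also have "\<dots> = (\<Sum>i\<le>j. C i * D) * norm s ^ j" by (simp add: sum_distrib_left mult_ac)
    finally show ?thesis .
  qed
  moreover have "(\<Sum>i\<le>j. C i * D) \<ge> 0" using C D by (intro sum_nonneg mult_nonneg_nonneg) auto
  ultimately show ?thesis by blast
qed

text \<open>
  Homogeneity exchanges the behaviour of \<open>F\<close> near \<open>u\<close> with its growth in the direction \<open>u\<close>:
  \<open>F (u + s y) = s\<^sup>d F (y + u / s)\<close>. The bound is uniform in \<open>y\<close>, so \<open>y\<close> may itself depend on \<open>s\<close>;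
  this is how the multiplicity is followed along curves through \<open>u\<close> and through the Cremona
  transformation.
\<close>

lemma vanishing_order:
  assumes F: "multipoly n k F" and hom: "homogeneous d F" and u: "deg_along j F u" and j: "j \<le> d"
  shows "\<exists>C\<ge>0. \<forall>y s. (\<forall>i\<le>n. norm (y i) \<le> B) \<and> s \<noteq> 0 \<and> norm s \<le> 1 \<longrightarrow>
    norm (F (\<lambda>i. u i + s * y i)) \<le> C * norm s ^ (d - j)"
proof -
  obtain C where C: "C \<ge> 0" "\<And>y s. (\<forall>i\<le>n. norm (y i) \<le> B) \<Longrightarrow> norm s \<ge> 1 \<Longrightarrow>
    norm (F (\<lambda>i. y i + s * u i)) \<le> C * norm s ^ j"
    using growth_along[OF F u, of B] by blast
  have "norm (F (\<lambda>i. u i + s * y i)) \<le> C * norm s ^ (d - j)"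
    if y: "\<forall>i\<le>n. norm (y i) \<le> B" and s: "s \<noteq> 0" "norm s \<le> 1" for y s
  proof -
    have "(\<lambda>i. u i + s * y i) = (\<lambda>i. s * (y i + (1 / s) * u i))"
      using s by (auto simp: field_simps)
    then have "norm (F (\<lambda>i. u i + s * y i)) = norm s ^ d * norm (F (\<lambda>i. y i + (1 / s) * u i))"
      using homogeneousD[OF hom s(1)] by (simp add: norm_mult norm_power)
    also have "\<dots> \<le> norm s ^ d * (C * norm (1 / s) ^ j)"
      using y s by (intro mult_left_mono C(2)) (auto simp: norm_divide field_simps)
    also have "norm s ^ d = norm s ^ (d - j) * norm s ^ j"
      using j by (simp flip: power_add)
    also have "norm s ^ (d - j) * norm s ^ j * (C * norm (1 / s) ^ j) = C * norm s ^ (d - j)"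
      using s by (simp add: norm_divide field_simps)
    finally show ?thesis .
  qed
  then show ?thesis using C(1) by blast
qed

section \<open>The Cremona transformation\<close>

text \<open>
  The standard Cremona transformation inverts all coordinates, and \<open>(\<Prod>i. x\<^sub>i ^ k)\<close> clears the
  denominators. On the points with nonzero coordinates \<open>G\<close> is determined by \<open>F\<close>, hence everywhere by
  \<open>torus_zero\<close>.
\<close>

definition cremona :: "nat \<Rightarrow> nat \<Rightarrow> (vec \<Rightarrow> complex) \<Rightarrow> (vec \<Rightarrow> complex) \<Rightarrow> bool" where
  "cremona n k F G \<longleftrightarrow> multipoly n k F \<and> multipoly n k G \<and>
     (\<forall>x. (\<forall>i\<le>n. x i \<noteq> 0) \<longrightarrow> G x = (\<Prod>i\<le>n. x i ^ k) * F (\<lambda>i. 1 / x i))"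

lemma cremona_exists: "multipoly n k F \<Longrightarrow> \<exists>G. cremona n k F G"
  using multipoly_reflect unfolding cremona_def by blast

lemma cremonaD:
  "cremona n k F G \<Longrightarrow> (\<And>i. i \<le> n \<Longrightarrow> x i \<noteq> 0) \<Longrightarrow> G x = (\<Prod>i\<le>n. x i ^ k) * F (\<lambda>i. 1 / x i)"
  unfolding cremona_def by blast

lemma cremona_sym:
  assumes "cremona n k F G"
  shows "cremona n k G F"
  unfolding cremona_def
proof (intro conjI allI impI)
  fix x :: vec assume x: "\<forall>i\<le>n. x i \<noteq> 0"
  have "G (\<lambda>i. 1 / x i) = (\<Prod>i\<le>n. (1 / x i) ^ k) * F (\<lambda>i. 1 / (1 / x i))"
    by (rule cremonaD[OF assms]) (use x in auto)
  then have "(\<Prod>i\<le>n. x i ^ k) * G (\<lambda>i. 1 / x i) = (\<Prod>i\<le>n. x i ^ k * (1 / x i) ^ k) * F x"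
    by (simp add: prod.distrib)
  also have "(\<Prod>i\<le>n. x i ^ k * (1 / x i) ^ k) = 1"
    using x by (intro prod.neutral) (auto simp: power_divide)
  finally show "F x = (\<Prod>i\<le>n. x i ^ k) * G (\<lambda>i. 1 / x i)" by simp
qed (use assms in \<open>auto simp: cremona_def\<close>)

lemma multipoly_eqI:
  assumes F: "multipoly n k F" and G: "multipoly n k G"
    and eq: "\<And>x. (\<And>i. i \<le> n \<Longrightarrow> x i \<noteq> 0) \<Longrightarrow> F x = c * G x"
  shows "F x = c * G x"
proof -
  have "(\<lambda>x. F x - c * G x) x = 0"
    by (rule torus_zero[where I = "{..n}" and k = k])
      (use multipoly_unit[OF F] multipoly_unit[OF G] eq in \<open>auto intro!: deg_along_diff_scaled\<close>)
  then show ?thesis by simp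
qed

lemma cremona_proportional:
  assumes "cremona n k F G" "cremona n k F' G'" "\<And>x. G x = c * G' x"
  shows "F x = c * F' x"
proof (rule multipoly_eqI[where F = F and G = F' and k = k and n = n and c = c])
  show "multipoly n k F" "multipoly n k F'" using assms(1,2) by (auto simp: cremona_def)
  show "F x = c * F' x" if "\<And>i. i \<le> n \<Longrightarrow> x i \<noteq> 0" for x
    using cremonaD[OF cremona_sym[OF assms(1)], of x] cremonaD[OF cremona_sym[OF assms(2)], of x] that assms(3)
    by simp
qed

lemma cremona_homogeneous:
  assumes "cremona n k F G" "homogeneous d F" "d + d' = k * (n + 1)"
  shows "homogeneous d' G"
  unfolding homogeneous_def
proof (intro allI impI)
  fix c :: complex and x assume c: "c \<noteq> 0"
  have G: "multipoly n k G" using assms(1) by (simp add: cremona_def)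
  have "multipoly n k (\<lambda>x. G (\<lambda>i. c * x i))"
    unfolding multipoly_def
  proof (intro conjI allI impI)
    show "G (\<lambda>i. c * x i) = G (\<lambda>i. c * y i)" if "\<forall>i\<le>n. x i = y i" for x y
      by (rule multipoly_cong[OF G]) (use that in simp)
    show "deg_along k (\<lambda>x. G (\<lambda>i. c * x i)) (unit i)" if "i \<le> n" for i
      unfolding deg_along_def
    proof
      fix x
      have "deg_along k G (\<lambda>j. c * unit i j)" by (rule deg_along_scale[OF multipoly_unit[OF G that]])
      then obtain q where "degree q \<le> k" "\<And>s. G (\<lambda>j. c * x j + s * (c * unit i j)) = poly q s"
        unfolding deg_along_def by (metis (no_types))
      then show "\<exists>q. degree q \<le> k \<and> (\<forall>s. G (\<lambda>j. c * (x j + s * unit i j)) = poly q s)"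
        by (auto simp: algebra_simps)
    qed
  qed
  then show "G (\<lambda>i. c * x i) = c ^ d' * G x"
  proof (rule multipoly_eqI[OF _ G])
    fix x :: vec assume x: "\<And>i. i \<le> n \<Longrightarrow> x i \<noteq> 0"
    have eq: "(\<lambda>i. 1 / (c * x i)) = (\<lambda>i. (1 / c) * (1 / x i))" by auto
    have F: "F (\<lambda>i. 1 / (c * x i)) = (1 / c) ^ d * F (\<lambda>i. 1 / x i)"
      unfolding eq by (rule homogeneousD[OF assms(2)]) (use c in simp)
    have "G (\<lambda>i. c * x i) = (\<Prod>i\<le>n. (c * x i) ^ k) * F (\<lambda>i. 1 / (c * x i))"
      by (rule cremonaD[OF assms(1)]) (use x c in auto)
    also have "(\<Prod>i\<le>n. (c * x i) ^ k) = c ^ (d + d') * (\<Prod>i\<le>n. x i ^ k)"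
      by (simp add: assms(3) power_mult_distrib prod.distrib power_mult power_add)
    finally show "G (\<lambda>i. c * x i) = c ^ d' * G x"
      using c by (simp add: F power_add power_divide cremonaD[OF assms(1) x])
  qed
qed

text \<open>
  Inversion is a local isomorphism near \<open>u\<close>, so \<open>G\<close> vanishes at \<open>1 / u\<close> to the order \<open>d - j\<close> to which \<open>F\<close>
  vanishes at \<open>u\<close>. Since \<open>G\<close> has degree \<open>k (n + 1) - d\<close>, its degree along \<open>1 / u\<close> is at most
  \<open>k (n + 1) - d - (d - j)\<close>; if this number is negative, then \<open>G\<close> is zero. The proof compares the growth
  of both sides on the line \<open>x + s / u\<close> as \<open>s\<close> tends to infinity.
\<close>

lemma cremona_degree_along:
  assumes FG: "cremona n k F G" and hom: "homogeneous d F" and u: "deg_along j F u"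
    and j: "j \<le> d" and nz: "\<And>i. i \<le> n \<Longrightarrow> u i \<noteq> 0"
  obtains Q where "\<And>s. G (\<lambda>i. x i + s * (1 / u i)) = poly Q s"
    and "Q = 0 \<or> degree Q + (d + (d - j)) \<le> k * (n + 1)"
proof -
  have F: "multipoly n k F" and G: "multipoly n k G" using FG by (auto simp: cremona_def)
  obtain Q where Q: "\<And>s. G (\<lambda>i. poly [:x i, 1 / u i:] s) = poly Q s"
    using multipoly_curve[OF G, of "\<lambda>i. [:x i, 1 / u i:]"] by blast
  define B where "B = (\<Sum>i\<le>n. 2 * norm (u i ^ 2 * x i))"
  define R where "R = 1 + (\<Sum>i\<le>n. 2 * norm (x i * u i))"
  define M where "M = (\<Sum>i\<le>n. norm (x i) + norm (1 / u i))"
  obtain C where C: "C \<ge> 0" "\<And>y s. (\<forall>i\<le>n. norm (y i) \<le> B) \<Longrightarrow> s \<noteq> 0 \<Longrightarrow> norm s \<le> 1 \<Longrightarrow>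
    norm (F (\<lambda>i. u i + s * y i)) \<le> C * norm s ^ (d - j)"
    using vanishing_order[OF F hom u j, of B] by blast
  have R1: "R \<ge> 1" unfolding R_def by (simp add: sum_nonneg)
  have M0: "M \<ge> 0" unfolding M_def by (intro sum_nonneg) auto
  have "norm (poly Q s) * norm s ^ (d + (d - j)) \<le> (M ^ (k * (n + 1)) * C) * norm s ^ (k * (n + 1))"
    if s: "norm s \<ge> R" for s
  proof -
    have s1: "norm s \<ge> 1" "s \<noteq> 0" using s R1 by auto
    \<comment> \<open>The inverse of x + s / u is t (u + t Y) with t = 1 / s. R is large enough for the denominators D
      of Y to stay away from 0, so that Y is bounded by B.\<close>
    let ?t = "1 / s"
    let ?D = "\<lambda>i. 1 + ?t * x i * u i"
    let ?Y = "\<lambda>i. - (u i ^ 2 * x i) / ?D i"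
    have D: "norm (?D i) \<ge> 1 / 2" if i: "i \<le> n" for i
    proof -
      have "2 * norm (x i * u i) \<le> (\<Sum>i\<le>n. 2 * norm (x i * u i))"
        using i by (intro member_le_sum) auto
      then have "2 * norm (x i * u i) \<le> norm s" using s unfolding R_def by linarith
      then have "norm (?t * x i * u i) \<le> 1 / 2" using s1 by (simp add: norm_mult norm_divide field_simps)
      then show ?thesis using norm_triangle_ineq4[of "?D i" "?t * x i * u i"] by simp
    qed
    then have D0: "?D i \<noteq> 0" if "i \<le> n" for i using that by fastforce
    have Y: "norm (?Y i) \<le> B" if i: "i \<le> n" for i
    proof -
      have "norm (?Y i) \<le> norm (u i ^ 2 * x i) / (1 / 2)"
        unfolding norm_divide norm_minus_cancel using D[OF i] by (intro divide_left_mono) auto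
      also have "\<dots> = 2 * norm (u i ^ 2 * x i)" by simp
      also have "\<dots> \<le> B" unfolding B_def using i by (intro member_le_sum) auto
      finally show ?thesis .
    qed
    have fac: "x i + s * (1 / u i) = (s / u i) * ?D i" if "i \<le> n" for i
      using s1 nz[OF that] by (simp add: field_simps)
    have inv: "1 / (x i + s * (1 / u i)) = ?t * (u i + ?t * ?Y i)" if i: "i \<le> n" for i
    proof -
      have "(u i + ?t * ?Y i) * ?D i = u i * ?D i - ?t * (u i ^ 2 * x i)"
      proof -
        have "(a + t * (- b / D)) * D = a * D - t * b" if "D \<noteq> 0" for a b t D :: complex
          using that by (simp add: left_diff_distrib)
        then show ?thesis using D0[OF i] by blast
      qed
      also have "\<dots> = u i" by (simp add: algebra_simps power2_eq_square)
      finally have "u i + ?t * ?Y i = u i / ?D i" using D0[OF i] by (simp add: eq_divide_eq)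
      then show ?thesis unfolding fac[OF i] by simp
    qed
    have nzs: "x i + s * (1 / u i) \<noteq> 0" if "i \<le> n" for i
      using fac[OF that] D0[OF that] s1 nz[OF that] by simp
    have "poly Q s = G (\<lambda>i. x i + s * (1 / u i))" using Q[of s] by (simp add: mult.commute)
    also have "\<dots> = (\<Prod>i\<le>n. (x i + s * (1 / u i)) ^ k) * F (\<lambda>i. 1 / (x i + s * (1 / u i)))"
      by (rule cremonaD[OF FG]) (rule nzs)
    also have "F (\<lambda>i. 1 / (x i + s * (1 / u i))) = F (\<lambda>i. ?t * (u i + ?t * ?Y i))"
      by (rule multipoly_cong[OF F]) (rule inv)
    also have "\<dots> = ?t ^ d * F (\<lambda>i. u i + ?t * ?Y i)"
      by (rule homogeneousD[OF hom]) (use s1 in simp)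
    finally have "norm (poly Q s) = (\<Prod>i\<le>n. norm (x i + s * (1 / u i)) ^ k) * (norm ?t ^ d * norm (F (\<lambda>i. u i + ?t * ?Y i)))"
      by (simp only: norm_mult norm_power prod_norm[symmetric])
    also have "\<dots> \<le> (\<Prod>i\<le>n. (M * norm s) ^ k) * (norm ?t ^ d * (C * norm ?t ^ (d - j)))"
    proof (intro mult_mono prod_mono conjI power_mono C(2))
      fix i assume i: "i \<in> {..n}"
      have "norm (x i + s * (1 / u i)) \<le> norm (x i) * 1 + norm (1 / u i) * norm s"
        using norm_triangle_ineq[of "x i" "s * (1 / u i)"] by (simp only: norm_mult mult_1_right mult.commute)
      also have "\<dots> \<le> norm (x i) * norm s + norm (1 / u i) * norm s"
        using s1 by (intro add_mono mult_left_mono) auto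
      also have "\<dots> = (norm (x i) + norm (1 / u i)) * norm s" by (simp add: distrib_right)
      also have "\<dots> \<le> M * norm s"
        unfolding M_def using i by (intro mult_right_mono member_le_sum) auto
      finally show "norm (x i + s * (1 / u i)) \<le> M * norm s" .
    qed (use s1 Y M0 in \<open>auto simp: norm_divide field_simps intro!: prod_nonneg\<close>)
    also have "(\<Prod>i\<le>n. (M * norm s) ^ k) = M ^ (k * (n + 1)) * norm s ^ (k * (n + 1))"
      by (simp add: power_mult_distrib power_add flip: power_mult)
    finally have "norm (poly Q s) * norm s ^ (d + (d - j)) \<le>
        M ^ (k * (n + 1)) * norm s ^ (k * (n + 1)) * (norm ?t ^ d * (C * norm ?t ^ (d - j))) * norm s ^ (d + (d - j))"
      by (intro mult_right_mono) auto
    also have "\<dots> = M ^ (k * (n + 1)) * norm s ^ (k * (n + 1)) * C"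
      using s1 by (simp add: norm_divide power_add power_divide)
    finally show ?thesis by (simp only: mult_ac)
  qed
  then have "Q = 0 \<or> degree Q + (d + (d - j)) \<le> k * (n + 1)" by (rule degree_le_of_growth)
  moreover have "G (\<lambda>i. x i + s * (1 / u i)) = poly Q s" for s
    using Q[of s] by (simp add: mult.commute)
  ultimately show thesis using that by blast
qed

section \<open>Descent by two dimensions\<close>

text \<open>
  Forms of the system in the coordinates in which the first \<open>n + 1\<close> points are the coordinate points; \<open>u\<close> and
  \<open>v\<close> represent the other two points. The bound \<open>2 b\<close> at the coordinate points is part of \<open>multipoly\<close>.
\<close>

definition balanced_form ::
    "nat \<Rightarrow> nat \<Rightarrow> vec \<Rightarrow> vec \<Rightarrow> (vec \<Rightarrow> complex) \<Rightarrow> bool" where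
  "balanced_form n b u v F \<longleftrightarrow> multipoly n (2 * b) F \<and> homogeneous (b * (n + 2)) F \<and>
     deg_along (2 * b) F u \<and> deg_along (2 * b) F v"

text \<open>
  The Cremona transforms of balanced forms: cones with vertices \<open>w\<close> and \<open>z\<close>.
\<close>

definition invariant_form ::
    "nat \<Rightarrow> nat \<Rightarrow> vec \<Rightarrow> vec \<Rightarrow> (vec \<Rightarrow> complex) \<Rightarrow> bool" where
  "invariant_form n b w z G \<longleftrightarrow> multipoly n (2 * b) G \<and> homogeneous (b * n) G \<and>
     (\<forall>x s. G (\<lambda>i. x i + s * w i) = G x) \<and> (\<forall>x s. G (\<lambda>i. x i + s * z i) = G x)"

text \<open>
  General position of the coordinate points together with \<open>u\<close> and \<open>v\<close>: the ratios \<open>u\<^sub>i : v\<^sub>i\<close> are distinct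
  points of the projective line, different from \<open>0\<close> and \<open>\<infinity>\<close>. They are, with these two, the parameters
  of the \<open>n + 3\<close> points on the rational normal curve.
\<close>

definition in_general_position :: "nat \<Rightarrow> vec \<Rightarrow> vec \<Rightarrow> bool" where
  "in_general_position n u v \<longleftrightarrow> (\<forall>i\<le>n. u i \<noteq> 0 \<and> v i \<noteq> 0) \<and>
     (\<forall>i\<le>n. \<forall>j\<le>n. i \<noteq> j \<longrightarrow> u i * v j \<noteq> u j * v i)"

text \<open>
  The multiplicity \<open>b n\<close> is the full degree of \<open>G\<close>, so that \<open>G\<close> is constant in the direction \<open>1 / u\<close>:
  \<open>2 b (n + 1) = b (n + 2) + (b (n + 2) - 2 b)\<close>.
\<close>

lemma cremona_translation_invariant:
  assumes FG: "cremona n (2 * b) F G" and hom: "homogeneous (b * (n + 2)) F"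
    and u: "deg_along (2 * b) F u" and nz: "\<And>i. i \<le> n \<Longrightarrow> u i \<noteq> 0"
  shows "G (\<lambda>i. x i + s * (1 / u i)) = G x"
proof -
  obtain Q where Q: "\<And>s. G (\<lambda>i. x i + s * (1 / u i)) = poly Q s"
    and deg: "Q = 0 \<or> degree Q + (b * (n + 2) + (b * (n + 2) - 2 * b)) \<le> 2 * b * (n + 1)"
    using cremona_degree_along[OF FG hom u _ nz, of x] by auto
  have "degree Q = 0" using deg by (auto simp: algebra_simps)
  then obtain c where "Q = [:c:]" by (rule degree_eq_zeroE)
  then show ?thesis using Q[of s] Q[of 0] by simp
qed

lemma invariant_of_balanced:
  assumes F: "balanced_form n b u v F" and FG: "cremona n (2 * b) F G"
    and gp: "in_general_position n u v"
  shows "invariant_form n b (\<lambda>i. 1 / u i) (\<lambda>i. 1 / v i) G"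
proof -
  have hom: "homogeneous (b * (n + 2)) F" using F by (simp add: balanced_form_def)
  have "homogeneous (b * n) G"
    by (rule cremona_homogeneous[OF FG hom]) (simp add: algebra_simps)
  then show ?thesis
    using F FG gp cremona_translation_invariant[OF FG hom]
    by (simp add: invariant_form_def balanced_form_def cremona_def in_general_position_def)
qed

lemma deg_along_of_invariant:
  assumes GF: "cremona n (2 * b) G F" and hom: "homogeneous (b * n) G"
    and inv: "\<And>x s. G (\<lambda>i. x i + s * (1 / u i)) = G x" and nz: "\<And>i. i \<le> n \<Longrightarrow> u i \<noteq> 0"
  shows "deg_along (2 * b) F u"
  unfolding deg_along_def
proof
  fix x
  have "deg_along 0 G (\<lambda>i. 1 / u i)"
    unfolding deg_along_def
  proof
    fix x show "\<exists>q. degree q \<le> 0 \<and> (\<forall>s. G (\<lambda>i. x i + s * (1 / u i)) = poly q s)"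
      by (rule exI[of _ "[:G x:]"]) (simp only: inv, simp)
  qed
  then obtain Q where Q: "\<And>s. F (\<lambda>i. x i + s * (1 / (1 / u i))) = poly Q s"
    and deg: "Q = 0 \<or> degree Q + (b * n + (b * n - 0)) \<le> 2 * b * (n + 1)"
    using cremona_degree_along[OF GF hom, of 0 "\<lambda>i. 1 / u i" x] nz by auto
  have "degree Q \<le> 2 * b" using deg by (auto simp: algebra_simps)
  then show "\<exists>q. degree q \<le> 2 * b \<and> (\<forall>s. F (\<lambda>i. x i + s * u i) = poly q s)"
    using Q by auto
qed

lemma balanced_of_invariant:
  assumes G: "invariant_form n b (\<lambda>i. 1 / u i) (\<lambda>i. 1 / v i) G" and GF: "cremona n (2 * b) G F"
    and gp: "in_general_position n u v"
  shows "balanced_form n b u v F"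
proof -
  have hom: "homogeneous (b * n) G" using G by (simp add: invariant_form_def)
  have "homogeneous (b * (n + 2)) F"
    by (rule cremona_homogeneous[OF GF hom]) (simp add: algebra_simps)
  then show ?thesis
    using G GF gp deg_along_of_invariant[OF GF hom, of u] deg_along_of_invariant[OF GF hom, of v]
    by (simp add: invariant_form_def balanced_form_def cremona_def in_general_position_def)
qed

text \<open>
  The quotient by the span of \<open>w\<close> and \<open>z\<close> is identified with the span of all but the last two coordinate
  vectors. Cramer's rule gives the images of the last two coordinate vectors,
  whose entries are \<open>2 \<times> 2\<close> minors of the matrix with rows \<open>w\<close> and \<open>z\<close>.
\<close>

definition minor :: "vec \<Rightarrow> vec \<Rightarrow> nat \<Rightarrow> nat \<Rightarrow> complex" where
  "minor w z i j = w i * z j - w j * z i"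

definition image_of_last :: "nat \<Rightarrow> vec \<Rightarrow> vec \<Rightarrow> nat \<Rightarrow> complex" where
  "image_of_last n w z i = - minor w z i (Suc (Suc n)) / minor w z (Suc n) (Suc (Suc n))"

definition image_of_last' :: "nat \<Rightarrow> vec \<Rightarrow> vec \<Rightarrow> nat \<Rightarrow> complex" where
  "image_of_last' n w z i = minor w z i (Suc n) / minor w z (Suc n) (Suc (Suc n))"

text \<open>
  The projection along \<open>w\<close> and \<open>z\<close> from \<open>n + 3\<close> to \<open>n + 1\<close> coordinates; \<open>pad\<close> is the inclusion in the
  other direction.
\<close>

definition project :: "nat \<Rightarrow> vec \<Rightarrow> vec \<Rightarrow> vec \<Rightarrow> nat \<Rightarrow> complex" where
  "project n w z x i = x i + x (Suc n) * image_of_last n w z i + x (Suc (Suc n)) * image_of_last' n w z i"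

definition pad :: "nat \<Rightarrow> vec \<Rightarrow> nat \<Rightarrow> complex" where
  "pad n y i = (if i \<le> n then y i else 0)"

lemma project_add: "project n w z (\<lambda>i. x i + s * y i) = (\<lambda>i. project n w z x i + s * project n w z y i)"
  by (auto simp: project_def algebra_simps)

context
  fixes n b :: nat and w z :: vec
  assumes minor_nz: "minor w z (Suc n) (Suc (Suc n)) \<noteq> 0"
begin

lemma image_of_last_eq:
  assumes "i \<le> Suc (Suc n)"
  shows "pad n (image_of_last n w z) i = unit (Suc n) i
    + - (z (Suc (Suc n)) / minor w z (Suc n) (Suc (Suc n))) * w i
    + w (Suc (Suc n)) / minor w z (Suc n) (Suc (Suc n)) * z i"
proof -
  consider "i \<le> n" | "i = Suc n" | "i = Suc (Suc n)" using assms by linarith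
  then show ?thesis
    by cases (use minor_nz in \<open>auto simp: pad_def image_of_last_def unit_def divide_simps\<close>,
        auto simp: minor_def algebra_simps)
qed

lemma image_of_last'_eq:
  assumes "i \<le> Suc (Suc n)"
  shows "pad n (image_of_last' n w z) i = unit (Suc (Suc n)) i
    + z (Suc n) / minor w z (Suc n) (Suc (Suc n)) * w i
    + - (w (Suc n) / minor w z (Suc n) (Suc (Suc n))) * z i"
proof -
  consider "i \<le> n" | "i = Suc n" | "i = Suc (Suc n)" using assms by linarith
  then show ?thesis
    by cases (use minor_nz in \<open>auto simp: pad_def image_of_last'_def unit_def divide_simps\<close>,
        auto simp: minor_def algebra_simps)
qed

lemma project_kernel:
  "project n w z w i = 0" "project n w z z i = 0"
  using minor_nz by (simp_all add: project_def image_of_last_def image_of_last'_def divide_simps)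
    (simp_all add: minor_def algebra_simps)

lemma invariant_eq_project:
  assumes G: "invariant_form (Suc (Suc n)) b w z G"
  shows "G x = G (pad n (project n w z x))"
proof -
  let ?m = "minor w z (Suc n) (Suc (Suc n))"
  let ?r = "x (Suc n)" and ?t = "x (Suc (Suc n))"
  let ?a = "- ?r * (z (Suc (Suc n)) / ?m) + ?t * (z (Suc n) / ?m)"
  let ?c = "?r * (w (Suc (Suc n)) / ?m) - ?t * (w (Suc n) / ?m)"
  have inv: "G (\<lambda>i. y i + s * w i) = G y" "G (\<lambda>i. y i + s * z i) = G y" for y s
    using G unfolding invariant_form_def by blast+
  have mp: "multipoly (Suc (Suc n)) (2 * b) G" using G by (simp add: invariant_form_def)
  have "G x = G (\<lambda>i. (x i + ?a * w i) + ?c * z i)"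
    by (simp only: inv)
  also have "\<dots> = G (pad n (project n w z x))"
  proof (rule multipoly_cong[OF mp])
    fix i assume i: "i \<le> Suc (Suc n)"
    have "pad n (project n w z x) i = (x i - ?r * unit (Suc n) i - ?t * unit (Suc (Suc n)) i)
      + ?r * pad n (image_of_last n w z) i + ?t * pad n (image_of_last' n w z) i"
      using i by (cases "i \<le> n") (auto simp: pad_def project_def unit_def le_Suc_eq)
    then show "(x i + ?a * w i) + ?c * z i = pad n (project n w z x) i"
      unfolding image_of_last_eq[OF i] image_of_last'_eq[OF i] by (simp add: algebra_simps)
  qed
  finally show ?thesis .
qed

text \<open>
  A vector of the quotient that is represented by a coordinate vector inherits the degree bound of
  that coordinate, because \<open>G\<close> does not see the difference in the span of \<open>w\<close> and \<open>z\<close>.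
\<close>

lemma deg_along_pad:
  assumes G: "invariant_form (Suc (Suc n)) b w z G" and l: "l \<le> Suc (Suc n)"
    and y: "\<And>i. i \<le> Suc (Suc n) \<Longrightarrow> pad n y i = unit l i + a * w i + c * z i"
  shows "deg_along (2 * b) (\<lambda>x. G (pad n x)) y"
  unfolding deg_along_def
proof
  fix x
  have inv: "G (\<lambda>i. y i + s * w i) = G y" "G (\<lambda>i. y i + s * z i) = G y" for y s
    using G unfolding invariant_form_def by blast+
  have mp: "multipoly (Suc (Suc n)) (2 * b) G" using G by (simp add: invariant_form_def)
  obtain q where q: "degree q \<le> 2 * b" "\<And>s. G (\<lambda>i. pad n x i + s * unit l i) = poly q s"
    using multipoly_unit[OF mp l] unfolding deg_along_def by metis
  have "G (pad n (\<lambda>i. x i + s * y i)) = poly q s" for s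
  proof -
    have "G (pad n (\<lambda>i. x i + s * y i)) = G (\<lambda>i. (pad n x i + s * unit l i + (s * a) * w i) + (s * c) * z i)"
    proof (rule multipoly_cong[OF mp])
      fix i assume i: "i \<le> Suc (Suc n)"
      have "pad n (\<lambda>i. x i + s * y i) i = pad n x i + s * pad n y i" by (simp add: pad_def)
      then show "pad n (\<lambda>i. x i + s * y i) i = (pad n x i + s * unit l i + (s * a) * w i) + (s * c) * z i"
        unfolding y[OF i] by (simp add: algebra_simps)
    qed
    then show ?thesis by (simp only: inv q(2))
  qed
  then show "\<exists>q. degree q \<le> 2 * b \<and> (\<forall>s. G (pad n (\<lambda>i. x i + s * y i)) = poly q s)"
    using q(1) by blast
qed

lemma balanced_of_invariant_restrict:
  assumes G: "invariant_form (Suc (Suc n)) b w z G"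
  shows "balanced_form n b (image_of_last n w z) (image_of_last' n w z) (\<lambda>y. G (pad n y))"
  unfolding balanced_form_def multipoly_def
proof (intro conjI allI impI)
  have mp: "multipoly (Suc (Suc n)) (2 * b) G" using G by (simp add: invariant_form_def)
  show "G (pad n x) = G (pad n y)" if "\<forall>i\<le>n. x i = y i" for x y
    by (rule multipoly_cong[OF mp]) (use that in \<open>auto simp: pad_def\<close>)
  show "deg_along (2 * b) (\<lambda>y. G (pad n y)) (unit l)" if "l \<le> n" for l
    by (rule deg_along_pad[OF G, of l _ 0 0]) (use that in \<open>auto simp: pad_def unit_def\<close>)
  show "homogeneous (b * (n + 2)) (\<lambda>y. G (pad n y))"
    unfolding homogeneous_def
  proof (intro allI impI)
    fix c :: complex and x assume c: "c \<noteq> 0"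
    have "pad n (\<lambda>i. c * x i) = (\<lambda>i. c * pad n x i)" by (auto simp: pad_def)
    moreover have "homogeneous (b * (n + 2)) G" using G by (simp add: invariant_form_def)
    ultimately show "G (pad n (\<lambda>i. c * x i)) = c ^ (b * (n + 2)) * G (pad n x)"
      using homogeneousD c by metis
  qed
  show "deg_along (2 * b) (\<lambda>y. G (pad n y)) (image_of_last n w z)"
    by (rule deg_along_pad[OF G _ image_of_last_eq]) auto
  show "deg_along (2 * b) (\<lambda>y. G (pad n y)) (image_of_last' n w z)"
    by (rule deg_along_pad[OF G _ image_of_last'_eq]) auto
qed

lemma invariant_of_balanced_project:
  assumes H: "balanced_form n b (image_of_last n w z) (image_of_last' n w z) H"
  shows "invariant_form (Suc (Suc n)) b w z (\<lambda>x. H (project n w z x))"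
  unfolding invariant_form_def multipoly_def
proof (intro conjI allI impI)
  have mp: "multipoly n (2 * b) H" using H by (simp add: balanced_form_def)
  show "H (project n w z x) = H (project n w z y)" if "\<forall>i\<le>Suc (Suc n). x i = y i" for x y
    by (rule multipoly_cong[OF mp]) (use that in \<open>auto simp: project_def\<close>)
  have along: "deg_along (2 * b) (\<lambda>x. H (project n w z x)) e"
    if y: "deg_along (2 * b) H y" and e: "\<And>i. i \<le> n \<Longrightarrow> project n w z e i = y i" for e y
    unfolding deg_along_def
  proof
    fix x
    obtain q where q: "degree q \<le> 2 * b" "\<And>s. H (\<lambda>i. project n w z x i + s * y i) = poly q s"
      using y unfolding deg_along_def by metis
    have "H (project n w z (\<lambda>i. x i + s * e i)) = poly q s" for s
      unfolding q(2)[symmetric] project_add by (rule multipoly_cong[OF mp]) (simp add: e)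
    then show "\<exists>q. degree q \<le> 2 * b \<and> (\<forall>s. H (project n w z (\<lambda>i. x i + s * e i)) = poly q s)"
      using q(1) by blast
  qed
  show "deg_along (2 * b) (\<lambda>x. H (project n w z x)) (unit l)" if l: "l \<le> Suc (Suc n)" for l
  proof -
    consider "l \<le> n" | "l = Suc n" | "l = Suc (Suc n)" using l by linarith
    then show ?thesis
    proof cases
      case 1
      then show ?thesis
        by (intro along[OF multipoly_unit[OF mp]]) (auto simp: project_def unit_def)
    next
      case 2
      show ?thesis
        by (rule along[of "image_of_last n w z"])
          (use H 2 in \<open>auto simp: balanced_form_def project_def unit_def\<close>)
    next
      case 3
      show ?thesis
        by (rule along[of "image_of_last' n w z"])
          (use H 3 in \<open>auto simp: balanced_form_def project_def unit_def\<close>)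
    qed
  qed
  show "homogeneous (b * Suc (Suc n)) (\<lambda>x. H (project n w z x))"
    unfolding homogeneous_def
  proof (intro allI impI)
    fix c :: complex and x assume c: "c \<noteq> 0"
    have "project n w z (\<lambda>i. c * x i) = (\<lambda>i. c * project n w z x i)"
      by (auto simp: project_def algebra_simps)
    moreover have "homogeneous (b * Suc (Suc n)) H" using H by (simp add: balanced_form_def)
    ultimately show "H (project n w z (\<lambda>i. c * x i)) = c ^ (b * Suc (Suc n)) * H (project n w z x)"
      using homogeneousD c by metis
  qed
  show "H (project n w z (\<lambda>i. x i + s * w i)) = H (project n w z x)"
    "H (project n w z (\<lambda>i. x i + s * z i)) = H (project n w z x)" for x s
    by (simp_all add: project_add project_kernel)
qed

end

lemma minor_inverse_nz:
  assumes gp: "in_general_position n u v" and ij: "i \<le> n" "j \<le> n" "i \<noteq> j"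
  shows "minor (\<lambda>i. 1 / u i) (\<lambda>i. 1 / v i) i j \<noteq> 0"
proof -
  have "u i \<noteq> 0" "v i \<noteq> 0" "u j \<noteq> 0" "v j \<noteq> 0" "u i * v j \<noteq> u j * v i"
    using gp ij by (auto simp: in_general_position_def)
  then show ?thesis by (auto simp: minor_def divide_simps mult.commute)
qed

text \<open>
  All minors of \<open>1 / u\<close> and \<open>1 / v\<close> are nonzero, and by the Pluecker relation so are the minors of the
  two image vectors, up to the common denominator.
\<close>

lemma in_general_position_project:
  assumes gp: "in_general_position (Suc (Suc n)) u v"
  defines "w \<equiv> \<lambda>i. 1 / u i" and "z \<equiv> \<lambda>i. 1 / v i"
  shows "in_general_position n (image_of_last n w z) (image_of_last' n w z)"
proof -
  have nz: "minor w z i j \<noteq> 0" if "i \<le> Suc (Suc n)" "j \<le> Suc (Suc n)" "i \<noteq> j" for i j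
    unfolding w_def z_def by (rule minor_inverse_nz[OF gp that])
  let ?D = "minor w z (Suc n) (Suc (Suc n))"
  have D: "?D \<noteq> 0" by (rule nz) auto
  have key: "image_of_last n w z i * image_of_last' n w z j - image_of_last n w z j * image_of_last' n w z i
      = minor w z i j / ?D" for i j
  proof -
    have "- minor w z i (Suc (Suc n)) * minor w z j (Suc n) + minor w z j (Suc (Suc n)) * minor w z i (Suc n)
        = minor w z i j * ?D"
      by (simp add: minor_def algebra_simps)
    then show ?thesis using D
      by (simp add: image_of_last_def image_of_last'_def divide_simps power2_eq_square)
  qed
  show ?thesis
    unfolding in_general_position_def
  proof (intro conjI allI impI)
    fix i assume i: "i \<le> n"
    show "image_of_last n w z i \<noteq> 0" "image_of_last' n w z i \<noteq> 0"
      using nz[of i "Suc n"] nz[of i "Suc (Suc n)"] D i by (auto simp: image_of_last_def image_of_last'_def)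
    fix j assume "j \<le> n" "i \<noteq> j"
    then have "minor w z i j / ?D \<noteq> 0" using nz[of i j] D i by simp
    then show "image_of_last n w z i * image_of_last' n w z j \<noteq> image_of_last n w z j * image_of_last' n w z i"
      using key[of i j] by auto
  qed
qed

lemma balanced_form_0:
  assumes F: "balanced_form 0 b u v F"
  shows "F x = F (\<lambda>_. 1) * x 0 ^ (2 * b)"
proof -
  have "b * (0 + 2) = 2 * b" by simp
  then have mp: "multipoly 0 (2 * b) F" and hom: "homogeneous (2 * b) F"
    using F unfolding balanced_form_def by metis+
  have "multipoly 0 (2 * b) (\<lambda>x. x 0 ^ (2 * b))"
    by (rule multipolyI_prods[where A = "{()}" and c = "\<lambda>_. 1" and r = "\<lambda>_ _. monom 1 (2 * b)"])
      (auto simp: poly_monom degree_monom_le)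
  then show ?thesis
  proof (rule multipoly_eqI[OF mp])
    fix x :: vec assume "\<And>i. i \<le> 0 \<Longrightarrow> x i \<noteq> 0"
    then have "F (\<lambda>i. x 0 * 1) = x 0 ^ (2 * b) * F (\<lambda>_. 1)" by (intro homogeneousD[OF hom]) auto
    moreover have "F x = F (\<lambda>i. x 0 * 1)" by (rule multipoly_cong[OF mp]) simp
    ultimately show "F x = F (\<lambda>_. 1) * x 0 ^ (2 * b)" by simp
  qed
qed

lemma balanced_form_0_power: "balanced_form 0 b u v (\<lambda>x. x 0 ^ (2 * b))"
proof -
  have along: "deg_along (2 * b) (\<lambda>x. x 0 ^ (2 * b)) p" for p
    unfolding deg_along_def
  proof
    fix x :: vec
    have "degree ([:x 0, p 0:] ^ (2 * b)) \<le> degree [:x 0, p 0:] * (2 * b)" by (rule degree_power_le)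
    also have "\<dots> \<le> 1 * (2 * b)" by (intro mult_right_mono) auto
    finally show "\<exists>q. degree q \<le> 2 * b \<and> (\<forall>s. (x 0 + s * p 0) ^ (2 * b) = poly q s)"
      by (intro exI[of _ "[:x 0, p 0:] ^ (2 * b)"]) (simp add: poly_power)
  qed
  moreover have "b * (0 + 2) = 2 * b" by simp
  ultimately show ?thesis
    unfolding balanced_form_def multipoly_def homogeneous_def by (simp only:) (simp add: power_mult_distrib)
qed

text \<open>
  In two variables the two translations generate everything, so the Cremona transform is a constant
  that is homogeneous of degree \<open>b\<close>.
\<close>

lemma balanced_form_1_zero:
  assumes F: "balanced_form 1 b u v F" and b: "b \<ge> 1" and gp: "in_general_position 1 u v"
  shows "F x = 0"
proof -
  define w where "w = (\<lambda>i. 1 / u i)"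
  define z where "z = (\<lambda>i. 1 / v i)"
  have mp: "multipoly 1 (2 * b) F" using F by (simp add: balanced_form_def)
  obtain G where FG: "cremona 1 (2 * b) F G" using cremona_exists[OF mp] by blast
  have G: "invariant_form 1 b w z G"
    unfolding w_def z_def by (rule invariant_of_balanced[OF F FG gp])
  have mpG: "multipoly 1 (2 * b) G" and hom: "homogeneous b G"
    using G by (simp_all add: invariant_form_def)
  have inv: "G (\<lambda>i. y i + s * w i) = G y" "G (\<lambda>i. y i + s * z i) = G y" for y s
    using G unfolding invariant_form_def by blast+
  define D where "D = minor w z 0 1"
  have D: "D \<noteq> 0" unfolding D_def w_def z_def by (rule minor_inverse_nz[OF gp]) auto
  have const: "G x = G (\<lambda>_. 0)" for x
  proof -
    let ?a = "(x 0 * z 1 - x 1 * z 0) / D" and ?c = "(x 1 * w 0 - x 0 * w 1) / D"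
    have "G x = G (\<lambda>i. (0 + ?a * w i) + ?c * z i)"
    proof (rule multipoly_cong[OF mpG])
      fix i :: nat assume "i \<le> 1"
      then have "i = 0 \<or> i = 1" by auto
      moreover have "(x 0 * z 1 - x 1 * z 0) * w i + (x 1 * w 0 - x 0 * w 1) * z i = x i * D"
        if "i = 0 \<or> i = 1"
        using that by (auto simp: D_def minor_def algebra_simps)
      ultimately have "?a * w i + ?c * z i = x i * D / D"
        by (metis add_divide_distrib times_divide_eq_left)
      then show "x i = (0 + ?a * w i) + ?c * z i" using D by simp
    qed
    also have "\<dots> = G (\<lambda>_. 0)" by (simp only: inv)
    finally show ?thesis .
  qed
  have "G (\<lambda>i. 2 * 0) = 2 ^ b * G (\<lambda>_. 0)" by (rule homogeneousD[OF hom]) simp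
  moreover have "(2 :: complex) ^ b \<noteq> 1"
  proof
    assume "(2 :: complex) ^ b = 1"
    then have "(2 :: real) ^ b = 1" by (metis norm_numeral norm_one norm_power)
    moreover have "(2 :: real) ^ b > 1" using b by (intro one_less_power) auto
    ultimately show False by simp
  qed
  ultimately have "G (\<lambda>_. 0) = 0" by simp
  then have "G x = 0 * G x" for x using const[of x] by simp
  then have "F x = 0 * F x" by (intro cremona_proportional[OF FG FG])
  then show ?thesis by simp
qed

text \<open>
  From dimension \<open>n\<close> to dimension \<open>n + 2\<close>: pull the form back along the projection with kernel spanned by
  \<open>1 / u\<close> and \<open>1 / v\<close>, then apply the Cremona transformation. Every balanced form in dimension \<open>n + 2\<close>
  arises in this way.
\<close>

lemma balanced_descent:
  assumes gp: "in_general_position (Suc (Suc n)) u v"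
  defines "w \<equiv> \<lambda>i. 1 / u i" and "z \<equiv> \<lambda>i. 1 / v i"
  defines "u' \<equiv> image_of_last n w z" and "v' \<equiv> image_of_last' n w z"
  shows "balanced_form (Suc (Suc n)) b u v F \<Longrightarrow>
      \<exists>H. balanced_form n b u' v' H \<and> cremona (Suc (Suc n)) (2 * b) F (\<lambda>x. H (project n w z x))"
    and "balanced_form n b u' v' H \<Longrightarrow>
      \<exists>F. balanced_form (Suc (Suc n)) b u v F \<and> cremona (Suc (Suc n)) (2 * b) F (\<lambda>x. H (project n w z x))"
proof -
  have D: "minor w z (Suc n) (Suc (Suc n)) \<noteq> 0"
    unfolding w_def z_def by (rule minor_inverse_nz[OF gp]) auto
  {
    assume F: "balanced_form (Suc (Suc n)) b u v F"
    then have mp: "multipoly (Suc (Suc n)) (2 * b) F" by (simp add: balanced_form_def)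
    obtain G where FG: "cremona (Suc (Suc n)) (2 * b) F G" using cremona_exists[OF mp] by blast
    have G: "invariant_form (Suc (Suc n)) b w z G"
      unfolding w_def z_def by (rule invariant_of_balanced[OF F FG gp])
    have "G = (\<lambda>x. G (pad n (project n w z x)))"
      by (rule ext) (rule invariant_eq_project[OF D G])
    then have "cremona (Suc (Suc n)) (2 * b) F (\<lambda>x. G (pad n (project n w z x)))" using FG by simp
    then show "\<exists>H. balanced_form n b u' v' H \<and> cremona (Suc (Suc n)) (2 * b) F (\<lambda>x. H (project n w z x))"
      using balanced_of_invariant_restrict[OF D G] unfolding u'_def v'_def by (intro exI conjI)
  next
    assume H: "balanced_form n b u' v' H"
    have G: "invariant_form (Suc (Suc n)) b w z (\<lambda>x. H (project n w z x))"
      by (rule invariant_of_balanced_project[OF D]) (use H in \<open>simp add: u'_def v'_def\<close>)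
    then have mp: "multipoly (Suc (Suc n)) (2 * b) (\<lambda>x. H (project n w z x))"
      by (simp add: invariant_form_def)
    obtain F where GF: "cremona (Suc (Suc n)) (2 * b) (\<lambda>x. H (project n w z x)) F"
      using cremona_exists[OF mp] by blast
    have "balanced_form (Suc (Suc n)) b u v F"
      by (rule balanced_of_invariant[OF G[unfolded w_def z_def] GF[unfolded w_def z_def] gp])
    then show "\<exists>F. balanced_form (Suc (Suc n)) b u v F \<and> cremona (Suc (Suc n)) (2 * b) F (\<lambda>x. H (project n w z x))"
      using cremona_sym[OF GF] by blast
  }
qed

theorem balanced_form_odd_zero:
  assumes "odd n" "b \<ge> 1" "in_general_position n u v" "balanced_form n b u v F"
  shows "F x = 0"
proof -
  obtain k where n: "n = 2 * k + 1" using \<open>odd n\<close> by (elim oddE)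
  show ?thesis using assms(3,4) unfolding n
  proof (induction k arbitrary: u v F x)
    case 0
    then show ?case using balanced_form_1_zero \<open>b \<ge> 1\<close> by simp
  next
    case (Suc k)
    define m where "m = 2 * k + 1"
    have n: "2 * Suc k + 1 = Suc (Suc m)" by (simp add: m_def)
    define w where "w = (\<lambda>i. 1 / u i)"
    define z where "z = (\<lambda>i. 1 / v i)"
    have gp: "in_general_position (Suc (Suc m)) u v" using Suc.prems n by simp
    obtain H where H: "balanced_form m b (image_of_last m w z) (image_of_last' m w z) H"
      and FH: "cremona (Suc (Suc m)) (2 * b) F (\<lambda>x. H (project m w z x))"
      using balanced_descent(1)[OF gp] Suc.prems(2) n unfolding w_def z_def by metis
    have "H y = 0" for y
      using Suc.IH[of "image_of_last m w z" "image_of_last' m w z" H] H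
        in_general_position_project[OF gp] unfolding m_def w_def z_def by blast
    then have "F x = 0 * F x" by (intro cremona_proportional[OF FH FH]) simp
    then show ?case by simp
  qed
qed

theorem balanced_form_even_unique:
  assumes "even n" "in_general_position n u v"
  shows "\<exists>F0. balanced_form n b u v F0 \<and> (\<exists>x. F0 x \<noteq> 0) \<and>
    (\<forall>F. balanced_form n b u v F \<longrightarrow> (\<exists>c. \<forall>x. F x = c * F0 x))"
proof -
  obtain k where n: "n = 2 * k" using \<open>even n\<close> by (elim evenE)
  show ?thesis using assms(2) unfolding n
  proof (induction k arbitrary: u v)
    case 0
    show ?case
    proof (intro exI[of _ "\<lambda>x. x 0 ^ (2 * b)"] conjI allI impI)
      show "\<exists>x :: nat \<Rightarrow> complex. x 0 ^ (2 * b) \<noteq> 0" by (rule exI[of _ "\<lambda>_. 1"]) simp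
      show "\<exists>c. \<forall>x. F x = c * x 0 ^ (2 * b)" if "balanced_form (2 * 0) b u v F" for F
      proof (intro exI allI)
        have "balanced_form 0 b u v F" using that by simp
        then show "F x = F (\<lambda>_. 1) * x 0 ^ (2 * b)" for x by (rule balanced_form_0)
      qed
    qed (simp add: balanced_form_0_power)
  next
    case (Suc k)
    define m where "m = 2 * k"
    have n: "2 * Suc k = Suc (Suc m)" by (simp add: m_def)
    define w where "w = (\<lambda>i. 1 / u i)"
    define z where "z = (\<lambda>i. 1 / v i)"
    have gp: "in_general_position (Suc (Suc m)) u v" using Suc.prems n by simp
    note descent = balanced_descent[OF gp, folded w_def z_def]
    obtain H0 where H0: "balanced_form m b (image_of_last m w z) (image_of_last' m w z) H0" "\<exists>y. H0 y \<noteq> 0"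
      and uniq: "\<And>H. balanced_form m b (image_of_last m w z) (image_of_last' m w z) H \<Longrightarrow> \<exists>c. \<forall>x. H x = c * H0 x"
      using Suc.IH[of "image_of_last m w z" "image_of_last' m w z"] in_general_position_project[OF gp]
      unfolding m_def w_def z_def by blast
    obtain F0 where F0: "balanced_form (Suc (Suc m)) b u v F0"
      and FH0: "cremona (Suc (Suc m)) (2 * b) F0 (\<lambda>x. H0 (project m w z x))"
      using descent(2)[OF H0(1)] by blast
    have "\<exists>x. F0 x \<noteq> 0"
    proof (rule ccontr)
      assume "\<not> ?thesis"
      then have "H0 (project m w z x) = 0 * H0 (project m w z x)" for x
        using cremona_proportional[OF cremona_sym[OF FH0] cremona_sym[OF FH0], of 0] by auto
      moreover obtain y where y: "H0 y \<noteq> 0" using H0(2) by blast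
      moreover have "H0 (project m w z (pad m y)) = H0 y"
      proof (rule multipoly_cong[of m "2 * b" H0])
        show "multipoly m (2 * b) H0" using H0(1) by (simp add: balanced_form_def)
      qed (simp add: project_def pad_def)
      ultimately show False by (metis mult_zero_left)
    qed
    moreover have "\<exists>c. \<forall>x. F x = c * F0 x" if F: "balanced_form (Suc (Suc m)) b u v F" for F
    proof -
      obtain H where H: "balanced_form m b (image_of_last m w z) (image_of_last' m w z) H"
        and FH: "cremona (Suc (Suc m)) (2 * b) F (\<lambda>x. H (project m w z x))"
        using descent(1)[OF F] by blast
      obtain c where "\<forall>x. H x = c * H0 x" using uniq[OF H] by blast
      then have "F x = c * F0 x" for x by (intro cremona_proportional[OF FH FH0]) simp
      then show ?thesis by blast
    qed
    ultimately show ?case unfolding n using F0 by blast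
  qed
qed

text \<open>
  One more order of vanishing at \<open>p\<close> would make the multiplicity of the Cremona transform exceed its degree.
  With \<open>p = u\<close> and \<open>p = v\<close> this shows that the multiplicity at these two points is exact.
\<close>

lemma balanced_form_zero_of_smaller_degree_along:
  assumes F: "balanced_form n b u v F" and b: "b \<ge> 1"
    and p: "deg_along (2 * b - 1) F p" and nz: "\<And>i. i \<le> n \<Longrightarrow> p i \<noteq> 0"
  shows "F x = 0"
proof -
  have mp: "multipoly n (2 * b) F" and hom: "homogeneous (b * (n + 2)) F"
    using F by (simp_all add: balanced_form_def)
  obtain G where FG: "cremona n (2 * b) F G" using cremona_exists[OF mp] by blast
  have le: "2 * b - 1 \<le> b * (n + 2)" by (simp add: algebra_simps)
  have "G x = 0" for x
  proof -
    obtain Q where Q: "\<And>s. G (\<lambda>i. x i + s * (1 / p i)) = poly Q s"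
      and deg: "Q = 0 \<or> degree Q + (b * (n + 2) + (b * (n + 2) - (2 * b - 1))) \<le> 2 * b * (n + 1)"
      using cremona_degree_along[OF FG hom p le nz, of x] by blast
    have "b * (n + 2) + (b * (n + 2) - (2 * b - 1)) = 2 * b * (n + 1) + 1"
      using b by (simp add: algebra_simps)
    then have "Q = 0" using deg by linarith
    then show ?thesis using Q[of 0] by simp
  qed
  then have "F x = 0 * F x" by (intro cremona_proportional[OF FG FG]) simp
  then show ?thesis by simp
qed

text \<open>
  If the degree in \<open>x\<^sub>l\<close> is less than \<open>2 b\<close>, then the Cremona transform is divisible by \<open>x\<^sub>l\<close>. It vanishes on
  a hyperplane that is not invariant under the translations by \<open>1 / u\<close>, hence everywhere.
\<close>

lemma balanced_form_zero_of_smaller_degree_unit: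
  assumes F: "balanced_form n b u v F" and gp: "in_general_position n u v" and b: "b \<ge> 1"
    and l: "l \<le> n" and p: "deg_along (2 * b - 1) F (unit l)"
  shows "F x = 0"
proof -
  have mp: "multipoly n (2 * b) F" and hom: "homogeneous (b * (n + 2)) F"
    using F by (simp_all add: balanced_form_def)
  obtain G where FG: "cremona n (2 * b) F G" using cremona_exists[OF mp] by blast
  have G: "invariant_form n b (\<lambda>i. 1 / u i) (\<lambda>i. 1 / v i) G"
    by (rule invariant_of_balanced[OF F FG gp])
  have mpG: "multipoly n (2 * b) G" using G by (simp add: invariant_form_def)
  have face: "G (x(l := 0)) = 0" for x
  proof (rule torus_zero[where F = "\<lambda>x. G (x(l := 0))" and I = "{..n} - {l}" and k = "2 * b"])
    show "deg_along (2 * b) (\<lambda>x. G (x(l := 0))) (unit i)" if i: "i \<in> {..n} - {l}" for i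
    proof (rule deg_along_unitI)
      fix x
      obtain q where "degree q \<le> 2 * b" "\<And>s. G ((x(l := 0))(i := s)) = poly q s"
        using deg_along_unitD[OF multipoly_unit[OF mpG], of i "x(l := 0)"] i by auto
      then show "\<exists>q. degree q \<le> 2 * b \<and> (\<forall>s. G ((x(i := s))(l := 0)) = poly q s)"
        using i by (metis Diff_iff fun_upd_twist singletonI)
    qed
    fix x :: vec assume x: "\<forall>i\<in>{..n} - {l}. x i \<noteq> 0"
    obtain Q where Q: "\<And>s. G (x(l := s)) = poly Q s"
      using deg_along_unitD[OF multipoly_unit[OF mpG l], of x] by blast
    obtain q where q: "degree q \<le> 2 * b - 1" "\<And>s. F ((\<lambda>i. 1 / x i)(l := s)) = poly q s"
      using deg_along_unitD[OF p, of "\<lambda>i. 1 / x i"] by blast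
    obtain r where r: "\<And>s. s \<noteq> 0 \<Longrightarrow> poly r s = s ^ (2 * b - 1) * poly q (1 / s)"
      using exists_reversed_poly[OF q(1)] by blast
    define P where "P = (\<Prod>i\<in>{..n} - {l}. x i ^ (2 * b))"
    have eq: "poly Q s = poly (smult P ([:0, 1:] * r)) s" if s: "s \<noteq> 0" for s
    proof -
      have "poly Q s = (\<Prod>i\<le>n. (x(l := s)) i ^ (2 * b)) * F (\<lambda>i. 1 / (x(l := s)) i)"
        unfolding Q[symmetric] by (rule cremonaD[OF FG]) (use x s in auto)
      also have "(\<Prod>i\<le>n. (x(l := s)) i ^ (2 * b)) = s ^ (2 * b) * P"
        unfolding P_def using l by (subst prod.remove[of _ l]) (auto intro!: prod.cong)
      also have "(\<lambda>i. 1 / (x(l := s)) i) = (\<lambda>i. 1 / x i)(l := 1 / s)" by auto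
      also have "s ^ (2 * b) = s * s ^ (2 * b - 1)"
        using b by (metis One_nat_def Suc_pred' mult_pos_pos power_Suc less_le_trans zero_less_one zero_less_numeral)
      finally have "poly Q s = s * s ^ (2 * b - 1) * P * poly q (1 / s)" unfolding q(2) .
      then show ?thesis using s by (simp add: r)
    qed
    have "Q = smult P ([:0, 1:] * r)" by (rule poly_eqI_nonzero) (rule eq)
    then show "G (x(l := 0)) = 0" using Q[of 0] by simp
  qed simp
  have ul: "u l \<noteq> 0" using gp l by (simp add: in_general_position_def)
  have "G x = 0" for x
  proof -
    let ?y = "\<lambda>i. x i + (- x l * u l) * (1 / u i)"
    have "G x = G ?y" using G unfolding invariant_form_def by metis
    also have "?y = ?y(l := 0)" using ul by auto
    finally show ?thesis using face by metis
  qed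
  then have "F x = 0 * F x" by (intro cremona_proportional[OF FG FG]) simp
  then show ?thesis by simp
qed

section \<open>Forms and their multiplicities\<close>

definition monom_at :: "(nat \<Rightarrow>\<^sub>0 nat) \<Rightarrow> vec \<Rightarrow> complex" where
  "monom_at a x = (\<Prod>i\<in>keys a. x i ^ lookup a i)"

text \<open>
  The value of \<open>f\<close> at a plain coordinate function, so that points can be added, scaled and
  moved along lines as functions.
\<close>

definition eval_at :: "cpoly \<Rightarrow> vec \<Rightarrow> complex" where
  "eval_at f x = (\<Sum>a\<in>keys f. lookup f a * monom_at a x)"

definition total_degree :: "(nat \<Rightarrow>\<^sub>0 nat) \<Rightarrow> nat" where
  "total_degree a = (\<Sum>i\<in>keys a. lookup a i)"

definition in_vars :: "nat \<Rightarrow> cpoly \<Rightarrow> bool" where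
  "in_vars n f \<longleftrightarrow> (\<forall>a\<in>keys f. keys a \<subseteq> {..n})"

lemma peval_eq_eval_at: "peval f x = eval_at f (lookup x)"
  by (simp add: peval_def eval_at_def monom_at_def)

lemma is_form_iff: "is_form n d f \<longleftrightarrow> in_vars n f \<and> (\<forall>a\<in>keys f. total_degree a = d)"
  by (auto simp: is_form_def in_vars_def total_degree_def)

lemma monom_at_superset:
  assumes "finite S" "keys a \<subseteq> S"
  shows "monom_at a x = (\<Prod>i\<in>S. x i ^ lookup a i)"
  unfolding monom_at_def
  by (rule prod.mono_neutral_left) (use assms in \<open>auto simp: in_keys_iff\<close>)

lemma total_degree_superset:
  assumes "finite S" "keys a \<subseteq> S"
  shows "total_degree a = (\<Sum>i\<in>S. lookup a i)"
  unfolding total_degree_def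
  by (rule sum.mono_neutral_left) (use assms in \<open>auto simp: in_keys_iff\<close>)

lemma monom_at_add: "monom_at (a + b) x = monom_at a x * monom_at b x"
proof -
  let ?S = "keys a \<union> keys b"
  have "keys (a + b) \<subseteq> ?S" by (rule keys_add)
  then show ?thesis
    by (simp add: monom_at_superset[of ?S] lookup_add power_add prod.distrib)
qed

lemma total_degree_add: "total_degree (a + b) = total_degree a + total_degree b"
proof -
  let ?S = "keys a \<union> keys b"
  have "keys (a + b) \<subseteq> ?S" by (rule keys_add)
  then show ?thesis
    by (simp add: total_degree_superset[of ?S] lookup_add sum.distrib)
qed

lemma total_degree_single [simp]: "total_degree (single i k) = k"
  by (cases "k = 0") (auto simp: total_degree_def)

lemma monom_at_single [simp]: "monom_at (single i k) x = x i ^ k"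
  by (cases "k = 0") (auto simp: monom_at_def)

lemma monom_at_0 [simp]: "monom_at 0 x = 1"
  by (simp add: monom_at_def)

lemma eval_at_superset:
  assumes "finite S" "keys f \<subseteq> S"
  shows "eval_at f x = (\<Sum>a\<in>S. lookup f a * monom_at a x)"
  unfolding eval_at_def
  by (rule sum.mono_neutral_left) (use assms in \<open>auto simp: in_keys_iff\<close>)

lemma eval_at_0 [simp]: "eval_at 0 x = 0"
  by (simp add: eval_at_def)

lemma eval_at_single [simp]: "eval_at (single a c) x = c * monom_at a x"
  by (cases "c = 0") (auto simp: eval_at_def)

lemma eval_at_add: "eval_at (f + g) x = eval_at f x + eval_at g x"
proof -
  let ?S = "keys f \<union> keys g"
  have "keys (f + g) \<subseteq> ?S" by (rule keys_add)
  then show ?thesis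
    by (simp add: eval_at_superset[of ?S] lookup_add sum.distrib distrib_right)
qed

lemma eval_at_sum: "eval_at (\<Sum>i\<in>A. f i) x = (\<Sum>i\<in>A. eval_at (f i) x)"
  by (induction A rule: infinite_finite_induct) (auto simp: eval_at_add)

lemma keys_cscale: "keys (cscale c f) \<subseteq> keys f"
  by (auto simp: in_keys_iff)

lemma eval_at_cscale: "eval_at (cscale c f) x = c * eval_at f x"
  by (subst eval_at_superset[OF finite_keys keys_cscale]) (simp add: eval_at_def sum_distrib_left mult.assoc)

lemma poly_mapping_sum_singles:
  "(\<Sum>a\<in>keys f. single a (lookup f a)) = f"
  by (rule poly_mapping_eqI) (auto simp: lookup_sum lookup_single when_def in_keys_iff)

lemma eval_at_mult: "eval_at (f * g) x = eval_at f x * eval_at g x"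
proof -
  have "f * g = (\<Sum>a\<in>keys f. \<Sum>b\<in>keys g.
      single (a + b) (lookup f a * lookup g b))"
    by (subst (1) poly_mapping_sum_singles[symmetric, of f], subst (1) poly_mapping_sum_singles[symmetric, of g])
      (simp add: sum_product mult_single)
  then show ?thesis
    by (simp only: eval_at_sum eval_at_single monom_at_add eval_at_def[of f] eval_at_def[of g] sum_product mult_ac)
qed

lemma eval_at_cong:
  assumes "in_vars n f" "\<And>i. i \<le> n \<Longrightarrow> x i = y i"
  shows "eval_at f x = eval_at f y"
proof -
  have "monom_at a x = monom_at a y" if "a \<in> keys f" for a
    unfolding monom_at_def
  proof (rule prod.cong[OF refl])
    fix i assume "i \<in> keys a"
    then have "i \<le> n" using assms(1) that by (auto simp: in_vars_def)
    then show "x i ^ lookup a i = y i ^ lookup a i" by (simp add: assms(2))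
  qed
  then show ?thesis by (simp add: eval_at_def)
qed

lemma eval_at_homogeneous:
  assumes "is_form n d f"
  shows "eval_at f (\<lambda>i. c * x i) = c ^ d * eval_at f x"
proof -
  have "monom_at a (\<lambda>i. c * x i) = c ^ d * monom_at a x" if "a \<in> keys f" for a
  proof -
    have "c ^ d = (\<Prod>i\<in>keys a. c ^ lookup a i)"
      using assms that by (auto simp: is_form_iff total_degree_def power_sum)
    then show ?thesis by (simp add: monom_at_def power_mult_distrib prod.distrib)
  qed
  then show ?thesis by (simp add: eval_at_def sum_distrib_left mult_ac)
qed

lemma eval_at_curve:
  shows "eval_at f (\<lambda>i. poly (c i) s) = poly (\<Sum>a\<in>keys f. smult (lookup f a)
    (\<Prod>i\<in>keys a. c i ^ lookup a i)) s"
  by (simp add: eval_at_def poly_sum poly_prod poly_power monom_at_def)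

lemma eval_at_curve_degree:
  assumes f: "is_form n d f" and c: "\<And>i. degree (c i) \<le> N"
  obtains Q where "degree Q \<le> N * d" "\<And>s. eval_at f (\<lambda>i. poly (c i) s) = poly Q s"
proof (rule that[OF _ eval_at_curve], intro degree_sum_le order.trans[OF degree_smult_le])
  fix a assume a: "a \<in> keys f"
  have "degree (\<Prod>i\<in>keys a. c i ^ lookup a i)
    \<le> (\<Sum>i\<in>keys a. N * lookup a i)"
  proof (rule order.trans[OF degree_prod_sum_le[OF finite_keys]], rule sum_mono)
    fix i
    have "degree (c i ^ lookup a i) \<le> degree (c i) * lookup a i"
      by (rule degree_power_le)
    also have "\<dots> \<le> N * lookup a i" by (intro mult_right_mono c) simp
    finally show "(degree \<circ> (\<lambda>i. c i ^ lookup a i)) i \<le> N * lookup a i" by simp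
  qed
  also have "\<dots> = N * d" using f a by (auto simp: is_form_iff total_degree_def simp flip: sum_distrib_left)
  finally show "degree (\<Prod>i\<in>keys a. c i ^ lookup a i) \<le> N * d" .
qed simp

lemma deg_along_form:
  assumes "is_form n d f"
  shows "deg_along d (eval_at f) p"
  unfolding deg_along_def
proof
  fix x
  have "degree [:x i, p i:] \<le> 1" for i by simp
  then obtain Q where "degree Q \<le> 1 * d" "\<And>s. eval_at f (\<lambda>i. poly [:x i, p i:] s) = poly Q s"
    using eval_at_curve_degree[OF assms, of "\<lambda>i. [:x i, p i:]" 1] by blast
  then show "\<exists>q. degree q \<le> d \<and> (\<forall>s. eval_at f (\<lambda>i. x i + s * p i) = poly q s)" by auto
qed

lemma lookup_pdiff:
  "lookup (pdiff i f) a
    = of_nat (lookup a i + 1) * lookup f (a + single i 1)"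
proof -
  let ?e = "single i 1 :: nat \<Rightarrow>\<^sub>0 nat"
  have iff: "b - ?e = a \<longleftrightarrow> b = a + ?e" if "lookup b i \<noteq> 0" for b
    unfolding poly_mapping_eq_iff fun_eq_iff lookup_minus lookup_add
    using that by (auto simp: lookup_single when_def)
  have "lookup (pdiff i f) a
      = (\<Sum>b\<in>keys f. if b = a + ?e then of_nat (lookup b i) * lookup f b else 0)"
    unfolding pdiff_def lookup_sum lookup_single
    by (rule sum.cong[OF refl]) (use iff in \<open>force simp: when_def\<close>)
  also have "\<dots> = of_nat (lookup a i + 1) * lookup f (a + ?e)"
    by (simp add: sum.delta' in_keys_iff lookup_add)
  finally show ?thesis .
qed

lemma keys_pdiff: "a \<in> keys (pdiff i f) \<Longrightarrow> a + single i 1 \<in> keys f"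
  by (auto simp: in_keys_iff lookup_pdiff)

lemma in_vars_pdiff: "in_vars n f \<Longrightarrow> in_vars n (pdiff i f)"
proof -
  assume f: "in_vars n f"
  have "keys a \<subseteq> keys (a + single i 1)" for a :: "nat \<Rightarrow>\<^sub>0 nat"
    by (auto simp: in_keys_iff lookup_add)
  then show ?thesis using f keys_pdiff unfolding in_vars_def by blast
qed

lemma is_form_pdiff: "is_form n d f \<Longrightarrow> is_form n (d - 1) (pdiff i f)"
  using in_vars_pdiff keys_pdiff[of _ i f] by (fastforce simp: is_form_iff total_degree_add)

lemma eval_at_pdiff:
  "eval_at (pdiff i f) x = (\<Sum>a\<in>keys f.
     of_nat (lookup a i) * lookup f a * monom_at (a - single i 1) x)"
  by (simp add: pdiff_def eval_at_sum)

lemma monom_at_derivative: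
  assumes a: "keys a \<subseteq> {..n}"
  shows "((\<lambda>t. monom_at a (\<lambda>i. x i + t * y i)) has_field_derivative
     (\<Sum>i\<le>n. y i * (of_nat (lookup a i) * monom_at (a - single i 1) (\<lambda>i. x i + t * y i)))) (at t)"
proof -
  let ?p = "\<lambda>t i. x i + t * y i"
  have keys: "keys (a - single i 1) \<subseteq> {..n}" for i
    using a by (auto simp: in_keys_iff lookup_minus subset_iff)
  have "((\<lambda>t. \<Prod>i\<le>n. ?p t i ^ lookup a i) has_field_derivative
     (\<Sum>i\<le>n. (of_nat (lookup a i) * ?p t i ^ (lookup a i - 1) * y i) *
        (\<Prod>j\<in>{..n} - {i}. ?p t j ^ lookup a j))) (at t)"
    by (rule has_field_derivative_prod) (auto intro!: derivative_eq_intros)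
  also have "(\<lambda>t. \<Prod>i\<le>n. ?p t i ^ lookup a i) = (\<lambda>t. monom_at a (?p t))"
    by (simp add: monom_at_superset[OF _ a])
  also have "(\<Sum>i\<le>n. (of_nat (lookup a i) * ?p t i ^ (lookup a i - 1) * y i) *
        (\<Prod>j\<in>{..n} - {i}. ?p t j ^ lookup a j))
    = (\<Sum>i\<le>n. y i * (of_nat (lookup a i) * monom_at (a - single i 1) (?p t)))"
  proof (rule sum.cong[OF refl])
    fix i assume i: "i \<in> {..n}"
    have "monom_at (a - single i 1) (?p t)
      = ?p t i ^ (lookup a i - 1) * (\<Prod>j\<in>{..n} - {i}. ?p t j ^ lookup a j)"
      unfolding monom_at_superset[OF finite_atMost keys] lookup_minus
      by (subst prod.remove[OF _ i]) (auto simp: lookup_single intro!: prod.cong)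
    then show "(of_nat (lookup a i) * ?p t i ^ (lookup a i - 1) * y i) *
        (\<Prod>j\<in>{..n} - {i}. ?p t j ^ lookup a j)
      = y i * (of_nat (lookup a i) * monom_at (a - single i 1) (?p t))"
      by (simp only: mult_ac)
  qed
  finally show ?thesis .
qed

lemma eval_at_derivative:
  assumes f: "in_vars n f"
  shows "((\<lambda>t. eval_at f (\<lambda>i. x i + t * y i)) has_field_derivative
     (\<Sum>i\<le>n. y i * eval_at (pdiff i f) (\<lambda>i. x i + t * y i))) (at t)"
proof -
  let ?p = "\<lambda>t i. x i + t * y i"
  have "((\<lambda>t. \<Sum>a\<in>keys f. lookup f a * monom_at a (?p t)) has_field_derivative
     (\<Sum>a\<in>keys f. lookup f a *
       (\<Sum>i\<le>n. y i * (of_nat (lookup a i) * monom_at (a - single i 1) (?p t))))) (at t)"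
    by (intro DERIV_sum DERIV_cmult monom_at_derivative) (use f in \<open>auto simp: in_vars_def\<close>)
  also have "(\<Sum>a\<in>keys f. lookup f a *
       (\<Sum>i\<le>n. y i * (of_nat (lookup a i) * monom_at (a - single i 1) (?p t))))
     = (\<Sum>i\<le>n. y i * eval_at (pdiff i f) (?p t))"
    unfolding eval_at_pdiff sum_distrib_left by (subst sum.swap) (simp add: mult_ac)
  finally show ?thesis unfolding eval_at_def .
qed

lemma eval_at_derivative_unit:
  assumes f: "in_vars n f" and i: "i \<le> n"
  shows "((\<lambda>t. eval_at f (\<lambda>l. x l + t * unit i l)) has_field_derivative eval_at (pdiff i f) x) (at 0)"
proof -
  have "(\<Sum>l\<le>n. unit i l * eval_at (pdiff l f) x) = (\<Sum>l\<le>n. if l = i then eval_at (pdiff l f) x else 0)"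
    by (rule sum.cong) (auto simp: unit_def)
  also have "\<dots> = eval_at (pdiff i f) x" using i by simp
  finally show ?thesis using eval_at_derivative[OF f, of x "unit i" 0] by simp
qed

text \<open>
  By induction on the degree: the partial derivatives vanish identically too, and they determine the
  coefficients of a form of positive degree.
\<close>

lemma form_eq_0:
  assumes "is_form n d f" "\<And>x. eval_at f x = 0"
  shows "f = 0"
  using assms
proof (induction d arbitrary: f)
  case 0
  have z: "a = 0" if "a \<in> keys f" for a
    using 0(1) that by (auto simp: is_form_iff total_degree_def in_keys_iff poly_mapping_eq_iff fun_eq_iff)
  then have "keys f \<subseteq> {0}" by auto
  then have "eval_at f (\<lambda>_. 0) = lookup f 0" by (subst eval_at_superset[of "{0}"]) auto
  then have "0 \<notin> keys f" using 0(2) by (simp add: in_keys_iff)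
  then have "keys f = {}" using z by blast
  then show ?case by simp
next
  case (Suc d)
  have f: "in_vars n f" using Suc.prems(1) by (simp add: is_form_iff)
  have pd: "pdiff i f = 0" if i: "i \<le> n" for i
  proof (rule Suc.IH)
    show "is_form n d (pdiff i f)" using is_form_pdiff[OF Suc.prems(1)] by simp
    fix x
    have "((\<lambda>t. 0) has_field_derivative eval_at (pdiff i f) x) (at (0 :: complex))"
      using eval_at_derivative_unit[OF f i, of x] Suc.prems(2) by simp
    then show "eval_at (pdiff i f) x = 0" by (metis DERIV_const DERIV_unique)
  qed
  have "a \<notin> keys f" for a
  proof
    assume a: "a \<in> keys f"
    then have "total_degree a = Suc d" using Suc.prems(1) by (simp add: is_form_iff)
    then have "keys a \<noteq> {}" by (auto simp: total_degree_def)
    then obtain i where i: "i \<in> keys a" by blast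
    have le: "i \<le> n" using i a f by (auto simp: in_vars_def)
    let ?e = "single i 1 :: nat \<Rightarrow>\<^sub>0 nat"
    have "a - ?e + ?e = a"
      using i by (auto simp: poly_mapping_eq_iff fun_eq_iff lookup_add lookup_minus lookup_single when_def in_keys_iff)
    then have "of_nat (lookup (a - ?e) i + 1) * lookup f a = 0"
      using lookup_pdiff[of i f "a - ?e"] pd[OF le] by simp
    then have "lookup f a = 0" by (metis mult_eq_0_iff of_nat_eq_0_iff add_is_0 one_neq_zero)
    then show False using a by (simp add: in_keys_iff)
  qed
  then show ?case by (metis all_not_in_conv keys_eq_empty)
qed

text \<open>
  The interpolation identity that expresses the degree bound can be differentiated term by term.
\<close>

lemma deg_along_pdiff:
  assumes f: "in_vars n f" and i: "i \<le> n" and p: "deg_along k (eval_at f) p"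
  shows "deg_along k (eval_at (pdiff i f)) p"
  unfolding deg_along_iff
proof (intro allI)
  fix x s
  have eq: "(\<lambda>t. eval_at f (\<lambda>l. (x l + s * p l) + t * unit i l))
      = (\<lambda>t. \<Sum>j\<le>k. poly (lagrange k j) s * eval_at f (\<lambda>l. (x l + of_nat j * p l) + t * unit i l))"
  proof
    fix t
    have "eval_at f (\<lambda>l. (x l + t * unit i l) + s * p l)
      = (\<Sum>j\<le>k. poly (lagrange k j) s * eval_at f (\<lambda>l. (x l + t * unit i l) + of_nat j * p l))"
      using p unfolding deg_along_iff by (rule allE[of _ "\<lambda>l. x l + t * unit i l"]) blast
    then show "eval_at f (\<lambda>l. (x l + s * p l) + t * unit i l)
      = (\<Sum>j\<le>k. poly (lagrange k j) s * eval_at f (\<lambda>l. (x l + of_nat j * p l) + t * unit i l))"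
      by (simp only: add_ac)
  qed
  have D1: "((\<lambda>t. eval_at f (\<lambda>l. (x l + s * p l) + t * unit i l)) has_field_derivative
      eval_at (pdiff i f) (\<lambda>l. x l + s * p l)) (at 0)"
    by (rule eval_at_derivative_unit[OF f i])
  have D2: "((\<lambda>t. \<Sum>j\<le>k. poly (lagrange k j) s * eval_at f (\<lambda>l. (x l + of_nat j * p l) + t * unit i l)) has_field_derivative
      (\<Sum>j\<le>k. poly (lagrange k j) s * eval_at (pdiff i f) (\<lambda>l. x l + of_nat j * p l))) (at 0)"
    by (intro DERIV_sum DERIV_cmult eval_at_derivative_unit[OF f i])
  show "eval_at (pdiff i f) (\<lambda>l. x l + s * p l)
      = (\<Sum>j\<le>k. poly (lagrange k j) s * eval_at (pdiff i f) (\<lambda>l. x l + of_nat j * p l))"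
    by (rule DERIV_unique[OF D1[unfolded eq] D2])
qed

text \<open>
  A derivative of order less than \<open>m\<close> keeps the degree bound \<open>d - m\<close> along \<open>p\<close>, which is below its own
  degree; so it vanishes at \<open>p\<close>, since \<open>g (s p) = s ^ deg g * g p\<close>.
\<close>

lemma mult_ge_of_deg_along:
  assumes f: "is_form n d f" and m: "m \<le> d" and p: "deg_along (d - m) (eval_at f) (lookup p)"
  shows "mult_ge n f p m"
  unfolding mult_ge_def
proof (intro allI impI)
  fix js assume "set js \<subseteq> {..n} \<and> length js < m"
  then have is_n: "set js \<subseteq> {..n}" and len: "length js < m" by auto
  let ?g = "foldr pdiff js f"
  have "is_form n (d - length js) ?g \<and> deg_along (d - m) (eval_at ?g) (lookup p)"
    using is_n
  proof (induction "js")
    case Nil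
    then show ?case using f p by simp
  next
    case (Cons i "js")
    then have IH: "is_form n (d - length js) (foldr pdiff js f)"
      "deg_along (d - m) (eval_at (foldr pdiff js f)) (lookup p)" and i: "i \<le> n" by auto
    have "is_form n (d - length js - 1) (pdiff i (foldr pdiff js f))" by (rule is_form_pdiff[OF IH(1)])
    moreover have "deg_along (d - m) (eval_at (pdiff i (foldr pdiff js f))) (lookup p)"
      by (rule deg_along_pdiff[OF _ i IH(2)]) (use IH(1) in \<open>simp add: is_form_iff\<close>)
    ultimately show ?case by simp
  qed
  then have g: "is_form n (d - length js) ?g"
    and gp: "deg_along (d - m) (eval_at ?g) (lookup p)" by auto
  let ?c = "eval_at ?g (lookup p)"
  obtain q where q: "degree q \<le> d - m" "\<And>s. eval_at ?g (\<lambda>i. 0 + s * lookup p i) = poly q s"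
    using gp[unfolded deg_along_def, rule_format, of "\<lambda>_. 0"] by blast
  have "poly q s = poly (monom ?c (d - length js)) s" for s
    unfolding q(2)[symmetric] using eval_at_homogeneous[OF g, of s] by (simp add: poly_monom)
  then have "q = monom ?c (d - length js)" by (simp add: poly_eq_poly_eq_iff[symmetric] fun_eq_iff)
  then have "?c \<noteq> 0 \<Longrightarrow> d - length js \<le> d - m" using q(1) by (simp add: degree_monom_eq)
  then have "?c = 0" using m len by linarith
  then show "peval ?g p = 0" by (simp add: peval_eq_eval_at)
qed

text \<open>
  Induction on \<open>m\<close>. The partial derivatives satisfy the bound for \<open>(d - 1) - (m - 1)\<close>, which is the same
  number \<open>d - m\<close>. Integrating along \<open>t \<mapsto> t x + s p\<close> transfers it to \<open>f\<close>, because \<open>f\<close> is zero on the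
  ray \<open>t = 0\<close>. Euler's formula would lose one degree here.
\<close>

lemma deg_along_of_mult_ge:
  assumes "is_form n d f" "mult_ge n f p m" "m \<le> d"
  shows "deg_along (d - m) (eval_at f) (lookup p)"
  using assms
proof (induction m arbitrary: d f)
  case 0
  then show ?case using deg_along_form by simp
next
  case (Suc m)
  let ?p = "lookup p"
  let ?k = "d - Suc m"
  have f: "in_vars n f" using Suc.prems(1) by (simp add: is_form_iff)
  have partial: "deg_along ?k (eval_at (pdiff i f)) ?p" if i: "i \<le> n" for i
  proof -
    have "mult_ge n (pdiff i f) p m"
      unfolding mult_ge_def
    proof (intro allI impI)
      fix js assume "set js \<subseteq> {..n} \<and> length js < m"
      then have "set (js @ [i]) \<subseteq> {..n} \<and> length (js @ [i]) < Suc m" using i by simp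
      then have "peval (foldr pdiff (js @ [i]) f) p = 0" using Suc.prems(2) unfolding mult_ge_def by blast
      then show "peval (foldr pdiff js (pdiff i f)) p = 0" by simp
    qed
    then have "deg_along (d - 1 - m) (eval_at (pdiff i f)) ?p"
      using Suc.IH[OF is_form_pdiff[OF Suc.prems(1)]] Suc.prems(3) by simp
    then show ?thesis by simp
  qed
  have fp: "eval_at f ?p = 0"
  proof -
    have "peval (foldr pdiff [] f) p = 0"
      using Suc.prems(2)[unfolded mult_ge_def, rule_format, of "[]"] by simp
    then show ?thesis by (simp add: peval_eq_eval_at)
  qed
  have ray: "eval_at f (\<lambda>i. c * ?p i) = 0" for c using eval_at_homogeneous[OF Suc.prems(1), of c ?p] fp by simp
  show ?case unfolding deg_along_iff
  proof (intro allI)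
    fix x s
    let ?\<phi> = "\<lambda>c t. eval_at f (\<lambda>i. c * ?p i + t * x i)"
    let ?\<psi> = "\<lambda>t. ?\<phi> s t - (\<Sum>j\<le>?k. poly (lagrange ?k j) s * ?\<phi> (of_nat j) t)"
    have "\<exists>Q. \<forall>t. ?\<phi> c t = poly Q t" for c
      using eval_at_curve[of f "\<lambda>i. [:c * ?p i, x i:]"] by auto
    then obtain Q where Q: "\<And>c t. ?\<phi> c t = poly (Q c) t" by metis
    define P where "P = Q s - (\<Sum>j\<le>?k. smult (poly (lagrange ?k j) s) (Q (of_nat j)))"
    have P: "?\<psi> t = poly P t" for t by (simp add: P_def poly_sum Q)
    have "poly (pderiv P) t = 0" for t
    proof -
      let ?d = "\<lambda>c i. eval_at (pdiff i f) (\<lambda>l. c * ?p l + t * x l)"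
      have "(?\<psi> has_field_derivative
         (\<Sum>i\<le>n. x i * ?d s i) - (\<Sum>j\<le>?k. poly (lagrange ?k j) s * (\<Sum>i\<le>n. x i * ?d (of_nat j) i))) (at t)"
        by (intro DERIV_diff DERIV_sum DERIV_cmult eval_at_derivative[OF f])
      moreover have "(\<Sum>j\<le>?k. poly (lagrange ?k j) s * (\<Sum>i\<le>n. x i * ?d (of_nat j) i))
          = (\<Sum>i\<le>n. x i * (\<Sum>j\<le>?k. poly (lagrange ?k j) s * ?d (of_nat j) i))"
        unfolding sum_distrib_left by (subst sum.swap) (simp only: mult.left_commute)
      moreover have "(\<Sum>j\<le>?k. poly (lagrange ?k j) s * ?d (of_nat j) i) = ?d s i" if i: "i \<in> {..n}" for i
      proof -
        have along: "deg_along ?k (eval_at (pdiff i f)) ?p" using partial i by simp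
        have comm: "(\<lambda>l. t * x l + c * ?p l) = (\<lambda>l. c * ?p l + t * x l)" for c
          by (simp add: add.commute)
        show ?thesis
          using along[unfolded deg_along_iff, rule_format, of "\<lambda>l. t * x l" s] unfolding comm by (rule sym)
      qed
      ultimately have "(?\<psi> has_field_derivative 0) (at t)" by simp
      then have "(poly P has_field_derivative 0) (at t)" by (simp only: P[abs_def])
      then show ?thesis by (rule DERIV_unique[OF poly_DERIV])
    qed
    then have "pderiv P = 0" using poly_all_0_iff_0 by blast
    then have "degree P = 0" by (simp add: pderiv_eq_0_iff)
    then obtain c where "P = [:c:]" by (rule degree_eq_zeroE)
    then have "poly P 1 = poly P 0" by simp
    also have "poly P 0 = 0" unfolding P[symmetric] using ray by simp
    finally have "?\<psi> 1 = 0" by (simp only: P)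
    then show "eval_at f (\<lambda>i. x i + s * ?p i) = (\<Sum>j\<le>?k. poly (lagrange ?k j) s * eval_at f (\<lambda>i. x i + of_nat j * ?p i))"
      by (simp add: add.commute)
  qed
qed

text \<open>
  Functions of the coordinates \<open>x\<^sub>0, \<dots>, x\<^sub>n\<close> that are given by a polynomial; this turns the functions
  found by the descent back into forms.
\<close>

definition polyfun :: "nat \<Rightarrow> (vec \<Rightarrow> complex) \<Rightarrow> bool" where
  "polyfun n \<Phi> \<longleftrightarrow> (\<exists>f. in_vars n f \<and> (\<forall>x. eval_at f x = \<Phi> x))"

lemma polyfun_const: "polyfun n (\<lambda>_. c)"
  unfolding polyfun_def by (rule exI[of _ "single 0 c"]) (auto simp: in_vars_def)

lemma polyfun_coord: "i \<le> n \<Longrightarrow> polyfun n (\<lambda>x. x i)"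
  unfolding polyfun_def
  by (rule exI[of _ "single (single i 1) 1"]) (auto simp: in_vars_def)

lemma polyfun_add:
  assumes "polyfun n \<Phi>" "polyfun n \<Psi>"
  shows "polyfun n (\<lambda>x. \<Phi> x + \<Psi> x)"
proof -
  obtain f g where fg: "in_vars n f" "\<And>x. eval_at f x = \<Phi> x" "in_vars n g" "\<And>x. eval_at g x = \<Psi> x"
    using assms unfolding polyfun_def by blast
  have "in_vars n (f + g)" using keys_add[of f g] fg(1,3) unfolding in_vars_def by blast
  then show ?thesis unfolding polyfun_def using fg by (auto simp: eval_at_add)
qed

lemma polyfun_mult:
  assumes "polyfun n \<Phi>" "polyfun n \<Psi>"
  shows "polyfun n (\<lambda>x. \<Phi> x * \<Psi> x)"
proof -
  obtain f g where fg: "in_vars n f" "\<And>x. eval_at f x = \<Phi> x" "in_vars n g" "\<And>x. eval_at g x = \<Psi> x"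
    using assms unfolding polyfun_def by blast
  have "in_vars n (f * g)"
    unfolding in_vars_def
  proof
    fix a assume "a \<in> keys (f * g)"
    then obtain b c where "a = b + c" "b \<in> keys f" "c \<in> keys g"
      using keys_mult[of f g] by blast
    then show "keys a \<subseteq> {..n}"
      using keys_add[of b c] fg(1,3) unfolding in_vars_def by blast
  qed
  then show ?thesis unfolding polyfun_def using fg by (auto simp: eval_at_mult)
qed

lemma polyfun_sum: "(\<And>i. i \<in> A \<Longrightarrow> polyfun n (\<Phi> i)) \<Longrightarrow> polyfun n (\<lambda>x. \<Sum>i\<in>A. \<Phi> i x)"
  by (induction A rule: infinite_finite_induct) (simp_all add: polyfun_const polyfun_add)

lemma polyfun_prod: "(\<And>i. i \<in> A \<Longrightarrow> polyfun n (\<Phi> i)) \<Longrightarrow> polyfun n (\<lambda>x. \<Prod>i\<in>A. \<Phi> i x)"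
  by (induction A rule: infinite_finite_induct) (simp_all add: polyfun_const polyfun_mult)

lemma polyfun_poly: "polyfun n \<Phi> \<Longrightarrow> polyfun n (\<lambda>x. poly q (\<Phi> x))"
  by (induction q) (simp_all add: polyfun_const polyfun_mult polyfun_add)

text \<open>
  The component of degree \<open>d\<close> of any polynomial that represents \<open>\<Phi>\<close> does the job: on the ray through \<open>x\<close> both
  sides are polynomials in the factor, and coefficients can be compared.
\<close>

lemma homogeneous_polyfun_form:
  assumes "polyfun n \<Phi>" and hom: "homogeneous d \<Phi>"
  obtains g where "is_form n d g" "\<And>x. eval_at g x = \<Phi> x"
proof -
  obtain f where f: "in_vars n f" "\<And>x. eval_at f x = \<Phi> x" using assms unfolding polyfun_def by blast
  define A where "A = {a \<in> keys f. total_degree a = d}"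
  define g where "g = (\<Sum>a\<in>A. single a (lookup f a))"
  have finA: "finite A" by (simp add: A_def)
  have look: "lookup g a = (if a \<in> A then lookup f a else 0)" for a
    using finA by (simp add: g_def lookup_sum lookup_single when_def)
  then have "a \<in> A" if "a \<in> keys g" for a
    using that by (metis in_keys_iff)
  then have "is_form n d g" using f(1) by (auto simp: is_form_iff in_vars_def A_def)
  moreover have "eval_at g x = \<Phi> x" for x
  proof -
    define Q where "Q = (\<Sum>a\<in>keys f. monom (lookup f a * monom_at a x) (total_degree a))"
    have "poly Q c = poly (monom (\<Phi> x) d) c" if c: "c \<noteq> 0" for c
    proof -
      have "monom_at a (\<lambda>i. c * x i) = c ^ total_degree a * monom_at a x" for a
        by (simp add: monom_at_def total_degree_def power_sum power_mult_distrib prod.distrib)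
      then have "poly Q c = eval_at f (\<lambda>i. c * x i)"
        by (simp add: Q_def eval_at_def poly_sum poly_monom mult_ac)
      then show ?thesis using homogeneousD[OF hom c] by (simp add: f(2) poly_monom mult.commute)
    qed
    then have "Q = monom (\<Phi> x) d" by (rule poly_eqI_nonzero)
    then have "\<Phi> x = coeff Q d" by simp
    also have "\<dots> = (\<Sum>a\<in>keys f. if total_degree a = d then lookup f a * monom_at a x else 0)"
      by (simp add: Q_def coeff_sum)
    also have "\<dots> = (\<Sum>a\<in>A. lookup f a * monom_at a x)"
      unfolding A_def by (rule sum.inter_filter[symmetric]) simp
    also have "\<dots> = eval_at g x" by (simp add: g_def eval_at_sum)
    finally show ?thesis by simp
  qed
  ultimately show thesis using that by blast
qed

section \<open>The secant linear virtual dimension\<close>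

text \<open>
  Functions on the integers stand for Laurent series in \<open>z\<close>: \<open>window e\<close> is multiplication with
  \<open>1 + z + \<dots> + z\<^sup>e\<close>, the character of the \<open>sl\<^sub>2\<close>-representation of highest weight \<open>e\<close> up to a shift,
  and \<open>diff1\<close> is multiplication with \<open>1 - z\<close>.
\<close>

definition window :: "int \<Rightarrow> (int \<Rightarrow> int) \<Rightarrow> int \<Rightarrow> int" where
  "window e \<phi> x = (\<Sum>j\<in>{0..e}. \<phi> (x - j))"

fun windows :: "(nat \<Rightarrow> int) \<Rightarrow> nat \<Rightarrow> (int \<Rightarrow> int) \<Rightarrow> int \<Rightarrow> int" where
  "windows e 0 \<phi> = \<phi>"
| "windows e (Suc N) \<phi> = window (e (Suc N)) (windows e N \<phi>)"

definition diff1 :: "(int \<Rightarrow> int) \<Rightarrow> int \<Rightarrow> int" where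
  "diff1 \<phi> x = \<phi> x - \<phi> (x - 1)"

lemma window_conv_sum: "window e \<phi> x = sum \<phi> {x - e..x}"
  unfolding window_def
  by (rule sum.reindex_bij_witness[of _ "\<lambda>y. x - y" "\<lambda>j. x - j"]) auto

lemma window_diff1: "window e (diff1 \<phi>) x = diff1 (window e \<phi>) x"
  by (simp add: window_def diff1_def sum_subtractf algebra_simps)

lemma windows_diff1: "windows e N (diff1 \<phi>) = diff1 (windows e N \<phi>)"
proof (induction N)
  case (Suc N)
  show ?case by (rule ext) (simp add: Suc window_diff1)
qed simp

lemma window_diff1_telescope:
  assumes "e \<ge> 0"
  shows "window e (diff1 \<phi>) x = \<phi> x - \<phi> (x - (e + 1))"
proof -
  have "sum (diff1 \<phi>) {x - int k..x} = \<phi> x - \<phi> (x - (int k + 1))" for k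
  proof (induction k)
    case 0 then show ?case by (simp add: diff1_def)
  next
    case (Suc k)
    have "{x - int (Suc k)..x} = insert (x - int (Suc k)) {x - int k..x}" by auto
    then show ?case using Suc by (simp add: diff1_def algebra_simps)
  qed
  from this[of "nat e"] assms show ?thesis by (simp add: window_conv_sum)
qed

lemma windows_local:
  assumes "\<And>y. y \<le> x \<Longrightarrow> \<phi> y = \<psi> y" "y \<le> x"
  shows "windows e N \<phi> y = windows e N \<psi> y"
  using assms(2)
proof (induction N arbitrary: y)
  case (Suc N)
  then show ?case by (simp add: window_conv_sum)
qed (use assms in auto)

lemma windows_mirror:
  assumes "\<And>x. \<phi> x = \<psi> (K - x)"
  shows "windows e N \<phi> x = windows e N \<psi> (K + (\<Sum>i\<in>{1..N}. e i) - x)"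
proof (induction N arbitrary: x)
  case 0 then show ?case using assms by simp
next
  case (Suc N)
  let ?f = "e (Suc N)"
  have "windows e (Suc N) \<phi> x = (\<Sum>y\<in>{x - ?f..x}. windows e N \<psi> (K + (\<Sum>i\<in>{1..N}. e i) - y))"
    by (simp add: window_conv_sum Suc)
  also have "\<dots> = sum (windows e N \<psi>) {K + (\<Sum>i\<in>{1..N}. e i) - x .. K + (\<Sum>i\<in>{1..N}. e i) - x + ?f}"
    by (rule sum.reindex_bij_witness[of _ "\<lambda>y. K + (\<Sum>i\<in>{1..N}. e i) - y" "\<lambda>y. K + (\<Sum>i\<in>{1..N}. e i) - y"]) auto
  also have "\<dots> = windows e (Suc N) \<psi> (K + (\<Sum>i\<in>{1..Suc N}. e i) - x)"
    by (simp add: window_conv_sum algebra_simps)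
  finally show ?case .
qed

lemma windows_periodic:
  assumes "\<And>x. \<phi> (x + T) = \<phi> x"
  shows "windows e N \<phi> (x + T) = windows e N \<phi> x"
proof (induction N arbitrary: x)
  case (Suc N)
  have "windows e N \<phi> (x + T - j) = windows e N \<phi> (x - j)" for j
    using Suc[of "x - j"] by (simp add: algebra_simps)
  then show ?case by (simp add: window_def)
qed (use assms in auto)

lemma sum_antisymmetric:
  fixes \<theta> :: "int \<Rightarrow> int"
  assumes "\<And>y. \<theta> (A + B - y) = - \<theta> y"
  shows "sum \<theta> {A..B} = 0"
proof -
  have "sum \<theta> {A..B} = (\<Sum>y\<in>{A..B}. \<theta> (A + B - y))"
    by (rule sum.reindex_bij_witness[of _ "\<lambda>y. A + B - y" "\<lambda>y. A + B - y"]) auto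
  also have "\<dots> = - sum \<theta> {A..B}" by (simp add: assms sum_negf)
  finally show ?thesis by simp
qed

text \<open>
  Positivity of fusion coefficients. The function \<open>\<theta>\<close> is antisymmetric under the affine Weyl group generated by
  the reflections at \<open>(E + 1) / 2\<close> and \<open>(E + 1 - T) / 2\<close>, and nonnegative on the alcove between these two
  points. The part of the window \<open>x - e, \<dots>, x\<close> beyond a wall cancels against its mirror image, and
  what remains (\<open>lo, \<dots>, hi\<close>) lies in the alcove.
\<close>

lemma fusion_nonneg:
  fixes \<theta> :: "int \<Rightarrow> int"
  assumes anti: "\<And>y. \<theta> (E + 1 - y) = - \<theta> y"
    and per: "\<And>y. \<theta> (y + T) = \<theta> y"
    and pos: "\<And>y. E + 1 - T \<le> 2 * y \<Longrightarrow> 2 * y \<le> E + 1 \<Longrightarrow> \<theta> y \<ge> 0"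
    and e: "0 \<le> e" "e + 2 \<le> T"
    and x: "E + e + 1 - T \<le> 2 * x" "2 * x \<le> E + e + 1"
  shows "window e \<theta> x \<ge> 0"
proof -
  have anti2: "\<theta> (E + 1 - T - y) = - \<theta> y" for y
    using anti[of "y + T"] per[of y] by (simp add: algebra_simps)
  define hi where "hi = (if 2 * x \<le> E + 1 then x else E - x)"
  define lo where "lo = (if E + 1 - T \<le> 2 * (x - e) then x - e else E + 2 - T - x + e)"
  have "sum \<theta> {x - e..x} = sum \<theta> {x - e..hi}"
  proof (cases "2 * x \<le> E + 1")
    case False
    have "{x - e..x} = {x - e..E - x} \<union> {E + 1 - x..x}" using False x by auto
    then have "sum \<theta> {x - e..x} = sum \<theta> {x - e..E - x} + sum \<theta> {E + 1 - x..x}"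
      by (simp add: sum.union_disjoint)
    moreover have "sum \<theta> {E + 1 - x..x} = 0" by (rule sum_antisymmetric) (simp add: anti)
    ultimately show ?thesis using False by (simp add: hi_def)
  qed (simp add: hi_def)
  also have "\<dots> = sum \<theta> {lo..hi}"
  proof (cases "E + 1 - T \<le> 2 * (x - e)")
    case False
    have "E + 1 - T - x + e \<le> hi" using x e by (auto simp: hi_def)
    then have "{x - e..hi} = {x - e..E + 1 - T - x + e} \<union> {E + 2 - T - x + e..hi}"
      using False x by auto
    then have "sum \<theta> {x - e..hi} = sum \<theta> {x - e..E + 1 - T - x + e} + sum \<theta> {E + 2 - T - x + e..hi}"
      by (simp add: sum.union_disjoint)
    moreover have "sum \<theta> {x - e..E + 1 - T - x + e} = 0"
      by (rule sum_antisymmetric) (use anti2 in \<open>simp add: algebra_simps\<close>)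
    ultimately show ?thesis using False by (simp add: lo_def)
  qed (simp add: lo_def)
  also have "\<dots> \<ge> 0"
  proof (rule sum_nonneg)
    fix y assume "y \<in> {lo..hi}"
    then show "\<theta> y \<ge> 0" using x e by (intro pos) (auto simp: lo_def hi_def split: if_splits)
  qed
  finally show ?thesis by (simp add: window_conv_sum)
qed

text \<open>
  The function \<open>diff1 (comb T)\<close> is the alternating sum over the affine Weyl group that represents the
  trivial representation: the value \<open>1\<close> at the multiples of \<open>T\<close> and \<open>- 1\<close> right after them.
\<close>

definition comb :: "int \<Rightarrow> int \<Rightarrow> int" where
  "comb T x = (if T dvd x then 1 else 0)"

lemma comb_periodic: "comb T (x + T) = comb T x"
  by (simp add: comb_def)

lemma windows_comb_nonneg:
  assumes e: "\<And>i. i \<in> {1..N} \<Longrightarrow> 0 \<le> e i \<and> e i + 2 \<le> T" and T: "T \<ge> 2"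
    and x: "(\<Sum>i\<in>{1..N}. e i) + 1 - T \<le> 2 * x" "2 * x \<le> (\<Sum>i\<in>{1..N}. e i) + 1"
  shows "windows e N (diff1 (comb T)) x \<ge> 0"
  using e x
proof (induction N arbitrary: x)
  case 0
  show ?case
  proof (cases "T dvd x - 1")
    case True
    then obtain k where k: "x - 1 = T * k" by (auto elim: dvdE)
    have "k < 0"
    proof (rule ccontr)
      assume "\<not> k < 0"
      then have "T * k \<ge> 0" using T by simp
      then show False using k 0 by simp
    qed
    then have "T * k \<le> T * (-1)" using T by (intro mult_left_mono) auto
    then show ?thesis using k 0 T by (auto simp: diff1_def comb_def)
  qed (simp add: diff1_def comb_def)
next
  case (Suc N)
  let ?E = "\<Sum>i\<in>{1..N}. e i"
  have per1: "diff1 (comb T) (y + T) = diff1 (comb T) y" for y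
    using comb_periodic[of T y] comb_periodic[of T "y - 1"] by (simp add: diff1_def algebra_simps)
  have mir: "diff1 (comb T) y = - diff1 (comb T) (1 - y)" for y
  proof -
    have "T dvd 1 - y \<longleftrightarrow> T dvd y - 1" by (metis dvd_minus_iff minus_diff_eq)
    then show ?thesis by (auto simp: diff1_def comb_def)
  qed
  have neg: "windows e N (\<lambda>y. - \<phi> y) y = - windows e N \<phi> y" for \<phi> y
    by (induction N arbitrary: y) (auto simp: window_def sum_negf)
  have anti: "windows e N (diff1 (comb T)) (?E + 1 - y) = - windows e N (diff1 (comb T)) y" for y
  proof -
    have "windows e N (diff1 (comb T)) y = windows e N (\<lambda>y. - diff1 (comb T) y) (1 + ?E - y)"
      by (rule windows_mirror) (rule mir)
    also have "\<dots> = - windows e N (diff1 (comb T)) (1 + ?E - y)"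
      by (rule neg)
    finally show ?thesis by (simp add: algebra_simps)
  qed
  show ?case unfolding windows.simps
  proof (rule fusion_nonneg[where E = ?E and T = T])
    show "windows e N (diff1 (comb T)) (?E + 1 - y) = - windows e N (diff1 (comb T)) y" for y
      by (rule anti)
    show "windows e N (diff1 (comb T)) (y + T) = windows e N (diff1 (comb T)) y" for y
      by (rule windows_periodic) (rule per1)
    show "0 \<le> windows e N (diff1 (comb T)) y" if "?E + 1 - T \<le> 2 * y" "2 * y \<le> ?E + 1" for y
      using Suc.IH[of y] Suc.prems(1) that by simp
  qed (use Suc.prems in auto)
qed

text \<open>
  The window of length \<open>T - 1\<close> is a full period minus one term, and the sum over a period is zero. So each
  factor acts as a shift with a change of sign.
\<close>

lemma windows_comb_simple_current:
  assumes T: "T \<ge> 2" and e: "\<And>i. i \<in> {1..N} \<Longrightarrow> e i = T - 2"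
  shows "windows e N (diff1 (comb T)) x = (- 1) ^ N * diff1 (comb T) (x + int N)"
  using e
proof (induction N arbitrary: x)
  case (Suc N)
  let ?s = "(- 1) ^ N :: int"
  have "windows e (Suc N) (diff1 (comb T)) x = window (T - 2) (\<lambda>y. ?s * diff1 (comb T) (y + int N)) x"
    using Suc by (simp add: window_def)
  also have "\<dots> = window (T - 2) (diff1 (\<lambda>y. ?s * comb T (y + int N))) x"
    by (simp add: window_def diff1_def algebra_simps)
  also have "\<dots> = ?s * comb T (x + int N) - ?s * comb T (x - (T - 1) + int N)"
    using T by (subst window_diff1_telescope) (auto simp: algebra_simps)
  also have "comb T (x - (T - 1) + int N) = comb T (x + int N + 1)"
    using comb_periodic[of T "x - (T - 1) + int N"] by (simp add: algebra_simps)
  finally show ?case by (simp add: diff1_def algebra_simps)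
qed auto

text \<open>
  The alternating sum over subsets expands \<open>(\<Prod>i. 1 - z ^ (e\<^sub>i + 1))\<close>, and each factor is
  \<open>1 - z\<close> times a window.
\<close>

lemma sum_signed_subsets_shift:
  fixes \<phi> :: "int \<Rightarrow> int"
  assumes "\<And>i. i \<in> {1..N} \<Longrightarrow> e i \<ge> 0"
  shows "(\<Sum>I\<in>Pow {1..N}. (- 1) ^ card I * \<phi> (x - (\<Sum>i\<in>I. e i + 1)))
    = windows e N ((diff1 ^^ N) \<phi>) x"
  using assms
proof (induction N arbitrary: \<phi> x)
  case (Suc N)
  have ins: "{1..Suc N} = insert (Suc N) {1..N}" by auto
  let ?P = "\<lambda>\<phi> x. \<Sum>I\<in>Pow {1..N}. (- 1) ^ card I * \<phi> (x - (\<Sum>i\<in>I. e i + 1))"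
  have fin: "finite I" "Suc N \<notin> I" if "I \<in> Pow {1..N}" for I
    using that finite_subset[of I "{1..N}"] by auto
  have "(\<Sum>I\<in>Pow {1..Suc N}. (- 1) ^ card I * \<phi> (x - (\<Sum>i\<in>I. e i + 1)))
      = ?P \<phi> x + (\<Sum>I\<in>insert (Suc N) ` Pow {1..N}. (- 1) ^ card I * \<phi> (x - (\<Sum>i\<in>I. e i + 1)))"
    unfolding ins Pow_insert by (subst sum.union_disjoint) auto
  also have "(\<Sum>I\<in>insert (Suc N) ` Pow {1..N}. (- 1) ^ card I * \<phi> (x - (\<Sum>i\<in>I. e i + 1)))
      = (\<Sum>I\<in>Pow {1..N}. (- 1) ^ card (insert (Suc N) I) * \<phi> (x - (\<Sum>i\<in>insert (Suc N) I. e i + 1)))"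
  proof (subst sum.reindex)
    show "inj_on (insert (Suc N)) (Pow {1..N})"
      using fin(2) by (auto simp: inj_on_def insert_ident)
  qed auto
  also have "\<dots> = (\<Sum>I\<in>Pow {1..N}. - ((- 1) ^ card I * \<phi> (x - (e (Suc N) + 1) - (\<Sum>i\<in>I. e i + 1))))"
    by (rule sum.cong) (auto simp: fin algebra_simps)
  also have "\<dots> = - ?P \<phi> (x - (e (Suc N) + 1))"
    by (simp add: sum_negf)
  also have "?P \<phi> x + - ?P \<phi> (x - (e (Suc N) + 1))
      = windows e N ((diff1 ^^ N) \<phi>) x - windows e N ((diff1 ^^ N) \<phi>) (x - (e (Suc N) + 1))"
    using Suc by simp
  also have "\<dots> = window (e (Suc N)) (diff1 (windows e N ((diff1 ^^ N) \<phi>))) x"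
    using Suc.prems by (subst window_diff1_telescope) auto
  also have "\<dots> = windows e (Suc N) ((diff1 ^^ Suc N) \<phi>) x"
    by (simp add: windows_diff1 window_diff1)
  finally show ?case .
qed auto

text \<open>
  The binomial coefficients are the coefficients of \<open>1 / (1 - z) ^ (n + 1)\<close>.
\<close>

lemma zbinom_diff:
  "(diff1 ^^ Suc n) (\<lambda>x. zbinom (int n + x) n) = (\<lambda>x. if x = 0 then 1 else 0)"
proof (induction n)
  case 0
  show ?case by (auto simp: fun_eq_iff diff1_def zbinom_def)
next
  case (Suc n)
  have "diff1 (\<lambda>x. zbinom (int (Suc n) + x) (Suc n)) = (\<lambda>x. zbinom (int n + x) n)"
  proof
    fix x :: int
    show "diff1 (\<lambda>x. zbinom (int (Suc n) + x) (Suc n)) x = zbinom (int n + x) n"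
    proof (cases "x < 0")
      case False
      then obtain k where "x = int k" using nonneg_int_cases by (metis not_less)
      then show ?thesis
        by (auto simp: diff1_def zbinom_def nat_add_distrib nat_int_add)
    qed (auto simp: diff1_def zbinom_def)
  qed
  then show ?case using Suc by (simp only: funpow_Suc_right o_apply)
qed

lemma funpow_diff1_sum:
  "(diff1 ^^ k) (\<lambda>x. \<Sum>t\<in>A. f t x) = (\<lambda>x. \<Sum>t\<in>A. (diff1 ^^ k) (f t) x)"
  by (induction k) (auto simp: fun_eq_iff diff1_def sum_subtractf)

lemma funpow_diff1_shift:
  "(diff1 ^^ k) (\<lambda>x. f (x - c)) = (\<lambda>x. (diff1 ^^ k) f (x - c))"
  by (induction k) (auto simp: fun_eq_iff diff1_def algebra_simps)

lemma windows_add: "windows e N (\<lambda>x. f x + g x) x = windows e N f x + windows e N g x"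
  by (induction N arbitrary: x) (auto simp: window_def sum.distrib)

lemma sum_eq_comb_nonneg:
  fixes T x :: int
  assumes T: "T > 0" and x: "x \<le> int M"
  shows "(\<Sum>t\<le>M. if x - int t * T = 0 then 1 else 0) = (if x \<ge> 0 then comb T x else 0)"
proof (cases "x \<ge> 0 \<and> T dvd x")
  case True
  then obtain q where q: "x = T * q" by (auto elim: dvdE)
  have "q \<ge> 0" using True T q by (simp add: zero_le_mult_iff)
  moreover have "q \<le> x"
  proof -
    have "1 * q \<le> T * q" using T \<open>q \<ge> 0\<close> by (intro mult_right_mono) auto
    then show ?thesis using q by simp
  qed
  ultimately have nq: "nat q \<in> {..M}" using x by auto
  have "x - int t * T = 0 \<longleftrightarrow> t = nat q" for t
    using T q \<open>q \<ge> 0\<close> by (auto simp: mult.commute)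
  then show ?thesis using True nq by (simp add: comb_def)
next
  case False
  have "x - int t * T \<noteq> 0" for t
    using False T by auto
  then show ?thesis using False by (auto simp: comb_def)
qed

text \<open>
  The left-hand side involves only the nonnegative multiples of \<open>T\<close>, but carries one more factor \<open>1 - z\<close>.
  The negative multiples supply the missing half of that factor: the product of the windows is a palindrome,
  and by the choice of \<open>T\<close> its reflection sends the negative multiples, evaluated at \<open>d\<close>, to the nonnegative
  ones, evaluated at \<open>d - 2\<close>.
\<close>

lemma truncated_comb_eq_windows_comb:
  fixes e :: "nat \<Rightarrow> int" and d N :: nat
  defines "E \<equiv> \<Sum>i\<in>{1..N}. e i"
  defines "T \<equiv> E - 2 * int d + 2"
  assumes T: "T > 0"
  shows "windows e N (diff1 (diff1 (\<lambda>x. \<Sum>t\<le>d. if x - int t * T = 0 then 1 else 0))) (int d)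
    = windows e N (diff1 (comb T)) (int d)"
proof -
  define p where "p = (\<lambda>x. if x \<ge> 0 then comb T x else 0)"
  define q where "q = (\<lambda>x. if x < 0 then comb T x else 0)"
  let ?W = "windows e N"
  have "?W (diff1 (diff1 (\<lambda>x. \<Sum>t\<le>d. if x - int t * T = 0 then 1 else 0))) (int d)
      = ?W (diff1 (diff1 p)) (int d)"
  proof (rule windows_local[where x = "int d"])
    fix y :: int assume y: "y \<le> int d"
    have "(\<Sum>t\<le>d. if z - int t * T = 0 then 1 else 0) = p z" if "z \<le> int d" for z
      unfolding p_def using sum_eq_comb_nonneg[OF T that] by simp
    then show "diff1 (diff1 (\<lambda>x. \<Sum>t\<le>d. if x - int t * T = 0 then 1 else 0)) y = diff1 (diff1 p) y"
      using y by (simp add: diff1_def)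
  qed simp
  also have "\<dots> = ?W p (int d) - 2 * ?W p (int d - 1) + ?W p (int d - 2)"
    by (simp add: windows_diff1 diff1_def)
  finally have 1: "?W (diff1 (diff1 (\<lambda>x. \<Sum>t\<le>d. if x - int t * T = 0 then 1 else 0))) (int d)
      = ?W p (int d) - 2 * ?W p (int d - 1) + ?W p (int d - 2)" .
  have "comb T = (\<lambda>x. p x + q x)" by (auto simp: p_def q_def)
  then have split: "?W (comb T) x = ?W p x + ?W q x" for x
    using windows_add[of e N p q x] by simp
  have mir: "q x = p (- T - x)" for x
  proof -
    have dv: "T dvd - T - x \<longleftrightarrow> T dvd x"
      by (metis dvd_minus_iff dvd_refl dvd_diff_right_iff)
    show ?thesis
    proof (cases "T dvd x")
      case True
      then obtain k where k: "x = T * k" by (auto elim: dvdE)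
      have "x < 0 \<longleftrightarrow> - T - x \<ge> 0"
      proof
        assume "x < 0"
        then have "k \<le> - 1" using T k by (simp add: mult_less_0_iff)
        then have "T * k \<le> T * (- 1)" using T by (intro mult_left_mono) auto
        then show "- T - x \<ge> 0" using k by simp
      qed (use T in simp)
      then show ?thesis using dv by (auto simp: p_def q_def comb_def)
    qed (use dv in \<open>auto simp: p_def q_def comb_def\<close>)
  qed
  have ref: "?W q x = ?W p (2 * int d - 2 - x)" for x
  proof -
    have "?W q x = ?W p (- T + E - x)"
      unfolding E_def by (rule windows_mirror) (rule mir)
    then show ?thesis by (simp add: T_def)
  qed
  have "?W (diff1 (comb T)) (int d)
      = ?W p (int d) + ?W q (int d) - ?W p (int d - 1) - ?W q (int d - 1)"
    by (simp add: windows_diff1 diff1_def split)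
  also have "\<dots> = ?W p (int d) + ?W p (int d - 2) - 2 * ?W p (int d - 1)"
    by (simp add: ref algebra_simps)
  finally show ?thesis using 1 by simp
qed

lemma sec_vdim_expand:
  fixes n d :: nat and m :: "nat \<Rightarrow> nat"
  defines "e \<equiv> \<lambda>i. int d - int (m i)"
  defines "T \<equiv> (\<Sum>i\<in>{1..n+3}. e i) - 2 * int d + 2"
  shows "sec_vdim n d m = (\<Sum>(I, t)\<in>sec_indices n.
    (- 1) ^ card I * zbinom (int n + (int d - (\<Sum>i\<in>I. e i + 1) - int t * T)) n)"
proof -
  have T: "T = int d + 2 - k_C n d m"
    by (simp add: k_C_def T_def e_def sum_subtractf algebra_simps)
  have arg: "int n + k_sec n d m I t - r_sec I t - 1 = int n + (int d - (\<Sum>i\<in>I. e i + 1) - int t * T)"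
    if "I \<subseteq> {1..n+3}" for I t
  proof -
    have "finite I" using that finite_subset by blast
    then have "(\<Sum>i\<in>I. e i + 1) = int (card I) * int d - (\<Sum>i\<in>I. int (m i)) + int (card I)"
      by (simp add: e_def sum.distrib sum_subtractf)
    moreover have "int t * T = - int t * k_C n d m + int t * int d + 2 * int t"
      unfolding T by (simp add: algebra_simps)
    ultimately show ?thesis by (simp add: k_sec_def r_sec_def algebra_simps)
  qed
  show ?thesis
    unfolding sec_vdim_def by (rule sum.cong) (auto simp: sec_indices_def arg)
qed

text \<open>
  Summed over all pairs, the alternating binomial coefficients are the coefficient of \<open>z\<^sup>d\<close> in the full product
  \<open>(\<Prod>i. 1 - z ^ (e\<^sub>i + 1)) / ((1 - z ^ T) (1 - z) ^ (n + 1))\<close>; powers \<open>z ^ (t T)\<close> with \<open>t > d\<close> do not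
  contribute, as \<open>T \<ge> 1\<close>.
\<close>

lemma sum_all_pairs_eq_windows:
  fixes e :: "nat \<Rightarrow> int" and d n :: nat
  defines "T \<equiv> (\<Sum>i\<in>{1..n+3}. e i) - 2 * int d + 2"
  assumes e: "\<And>i. i \<in> {1..n+3} \<Longrightarrow> e i \<ge> 0" and T: "T > 0"
  shows "(\<Sum>(I, t)\<in>Pow {1..n+3} \<times> {..d}.
      (- 1) ^ card I * zbinom (int n + (int d - (\<Sum>i\<in>I. e i + 1) - int t * T)) n)
    = windows e (n + 3) (diff1 (comb T)) (int d)"
proof -
  let ?h = "\<lambda>x. \<Sum>t\<le>d. zbinom (int n + (x - int t * T)) n"
  have "(\<Sum>(I, t)\<in>Pow {1..n+3} \<times> {..d}.
      (- 1) ^ card I * zbinom (int n + (int d - (\<Sum>i\<in>I. e i + 1) - int t * T)) n)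
    = (\<Sum>I\<in>Pow {1..n+3}. (- 1) ^ card I * ?h (int d - (\<Sum>i\<in>I. e i + 1)))"
    by (simp add: sum.cartesian_product sum_distrib_left)
  also have "\<dots> = windows e (n + 3) ((diff1 ^^ (n + 3)) ?h) (int d)"
    by (rule sum_signed_subsets_shift) (rule e)
  also have "(diff1 ^^ (n + 3)) ?h = diff1 (diff1 ((diff1 ^^ Suc n) ?h))"
    by (simp add: numeral_3_eq_3)
  also have "(diff1 ^^ Suc n) ?h = (\<lambda>x. \<Sum>t\<le>d. if x - int t * T = 0 then 1 else 0)"
    by (simp only: funpow_diff1_sum funpow_diff1_shift[of _ "\<lambda>x. zbinom (int n + x) n"] zbinom_diff)
  also have "windows e (n + 3) (diff1 (diff1 (\<lambda>x. \<Sum>t\<le>d. if x - int t * T = 0 then 1 else 0))) (int d)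
      = windows e (n + 3) (diff1 (comb T)) (int d)"
    unfolding T_def by (rule truncated_comb_eq_windows_comb) (use T T_def in simp)
  finally show ?thesis .
qed

text \<open>
  With all multiplicities at most \<open>b n\<close>, the terms with \<open>2 (|I| + t) \<ge> n + 2\<close> are zero. So the pairs that are
  left out of the secant linear virtual dimension contribute nothing, except possibly
  \<open>I = \<emptyset>\<close> and \<open>2 t = n + 1\<close> for odd \<open>n\<close>, where the term is nonnegative.
\<close>

lemma sec_vdim_windows:
  fixes n b d :: nat and m :: "nat \<Rightarrow> nat"
  assumes d: "d = b * (n + 2)" and b: "b \<ge> 1"
    and m: "\<And>i. i \<in> {1..n+3} \<Longrightarrow> m i \<le> b * n"
  defines "e \<equiv> \<lambda>i. int d - int (m i)"
  defines "T \<equiv> (\<Sum>i\<in>{1..n+3}. e i) - 2 * int d + 2"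
  shows "sec_vdim n d m \<le> windows e (n + 3) (diff1 (comb T)) (int d)"
    and "even n \<Longrightarrow> sec_vdim n d m = windows e (n + 3) (diff1 (comb T)) (int d)"
proof -
  have e_ge: "e i \<ge> 2 * int b" if "i \<in> {1..n+3}" for i
  proof -
    have "int (m i) \<le> int (b * n)" using m[OF that] by linarith
    then show ?thesis by (simp add: e_def d algebra_simps)
  qed
  have "(\<Sum>i\<in>{1..n+3}. e i) \<ge> (\<Sum>i\<in>{1..n+3}. 2 * int b)"
    by (intro sum_mono e_ge)
  then have T_ge: "T \<ge> 2 * int b + 2"
    by (simp add: T_def d algebra_simps)
  define c where "c = (\<lambda>(I, t). (- 1) ^ card I * zbinom (int n + (int d - (\<Sum>i\<in>I. e i + 1) - int t * T)) n)"
  define A where "A = Pow {1..n+3} \<times> {..d}"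
  have zero: "c (I, t) = 0" if I: "I \<subseteq> {1..n+3}" and big: "2 * (card I + t) \<ge> n + 2" for I t
  proof -
    have "(\<Sum>i\<in>I. e i + 1) \<ge> (\<Sum>i\<in>I. 2 * int b + 1)"
      using e_ge I by (intro sum_mono) (simp add: subset_iff)
    moreover have "int t * T \<ge> int t * (2 * int b + 1)"
      using T_ge by (intro mult_left_mono) auto
    moreover have "int (2 * (card I + t)) * (2 * int b + 1) \<ge> int (n + 2) * (2 * int b + 1)"
      using big by (intro mult_right_mono) auto
    ultimately have "int d - (\<Sum>i\<in>I. e i + 1) - int t * T < 0"
      by (simp add: d algebra_simps)
    then show ?thesis by (simp add: c_def zbinom_def)
  qed
  have outside: "I = {} \<or> 2 * (card I + t) \<ge> n + 2" "even n \<Longrightarrow> 2 * (card I + t) \<ge> n + 2"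
    if I: "I \<subseteq> {1..n+3}" and nin: "(I, t) \<notin> sec_indices n" for I t
  proof -
    have many: "card I + 2 * t \<ge> n + 1" using I nin by (auto simp: sec_indices_def)
    have nonempty: "card I \<ge> 1" if "I \<noteq> {}"
      using I finite_subset[of I "{1..n+3}"] that by (simp add: Suc_leI card_gt_0_iff)
    show "I = {} \<or> 2 * (card I + t) \<ge> n + 2"
      using many nonempty by (cases "I = {}") auto
    assume "even n"
    then obtain l where l: "n = 2 * l" by (elim evenE)
    show "2 * (card I + t) \<ge> n + 2"
    proof (cases "I = {}")
      case True
      then have "2 * t \<ge> 2 * l + 1" using many l by simp
      then have "t \<ge> l + 1" by presburger
      then show ?thesis using l by simp
    qed (use many nonempty in simp)
  qed
  have sub: "sec_indices n \<subseteq> A"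
  proof -
    have "1 * (n + 2) \<le> d" unfolding d using b by (intro mult_right_mono) auto
    then show ?thesis by (auto simp: sec_indices_def A_def)
  qed
  have "sum c A = windows e (n + 3) (diff1 (comb T)) (int d)"
    unfolding c_def A_def T_def
    by (rule sum_all_pairs_eq_windows) (use e_ge T_ge T_def in \<open>force+\<close>)
  moreover have "sum c A = sum c (A - sec_indices n) + sum c (sec_indices n)"
    using sub by (intro sum.subset_diff) (simp_all add: A_def)
  moreover have "sec_vdim n d m = sum c (sec_indices n)"
    unfolding sec_vdim_expand c_def T_def e_def ..
  moreover have "sum c (A - sec_indices n) \<ge> 0"
  proof (rule sum_nonneg)
    fix q assume "q \<in> A - sec_indices n"
    then obtain I t where q: "q = (I, t)" "I \<subseteq> {1..n+3}" "(I, t) \<notin> sec_indices n" by (auto simp: A_def)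
    have "c ({}, t) \<ge> 0" by (simp add: c_def zbinom_def)
    then show "c q \<ge> 0" using outside(1)[OF q(2,3)] zero[OF q(2)] q(1) by force
  qed
  moreover have "sum c (A - sec_indices n) = 0" if "even n"
    by (rule sum.neutral) (use outside(2) zero that in \<open>auto simp: A_def\<close>)
  ultimately show "sec_vdim n d m \<le> windows e (n + 3) (diff1 (comb T)) (int d)"
    and "even n \<Longrightarrow> sec_vdim n d m = windows e (n + 3) (diff1 (comb T)) (int d)" by auto
qed

lemma sec_vdim_nonneg:
  fixes n b :: nat and m :: "nat \<Rightarrow> nat"
  assumes "even n" and b: "b \<ge> 1"
    and m: "\<And>i. i \<in> {1..n+3} \<Longrightarrow> m i \<le> b * n"
  shows "sec_vdim n (b * (n + 2)) m \<ge> 0"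
proof -
  define d where "d = b * (n + 2)"
  define e where "e = (\<lambda>i. int d - int (m i))"
  define E where "E = (\<Sum>i\<in>{1..n+3}. e i)"
  define T where "T = E - 2 * int d + 2"
  have e_ge: "e i \<ge> 2 * int b" if "i \<in> {1..n+3}" for i
  proof -
    have "int (m i) \<le> int (b * n)" using m[OF that] by linarith
    then show ?thesis by (simp add: e_def d_def algebra_simps)
  qed
  have eT: "0 \<le> e i \<and> e i + 2 \<le> T" if i: "i \<in> {1..n+3}" for i
  proof -
    have "E = e i + (\<Sum>j\<in>{1..n+3} - {i}. e j)"
      unfolding E_def using i by (simp add: sum.remove)
    moreover have "(\<Sum>j\<in>{1..n+3} - {i}. e j) \<ge> (\<Sum>j\<in>{1..n+3} - {i}. 2 * int b)"
      by (intro sum_mono e_ge) auto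
    moreover have "(\<Sum>j\<in>{1..n+3} - {i}. 2 * int b) = 2 * int d"
      using i by (simp add: d_def algebra_simps)
    ultimately show ?thesis using e_ge[OF i] by (simp add: T_def)
  qed
  have "windows e (n + 3) (diff1 (comb T)) (int d) \<ge> 0"
  proof (rule windows_comb_nonneg)
    show "2 \<le> T" using eT[of 1] by simp
    show "(\<Sum>i\<in>{1..n+3}. e i) + 1 - T \<le> 2 * int d" "2 * int d \<le> (\<Sum>i\<in>{1..n+3}. e i) + 1"
      using \<open>2 \<le> T\<close> by (simp_all only: T_def flip: E_def)
  qed (use eT in auto)
  then show ?thesis
    using sec_vdim_windows(2)[OF d_def b m \<open>even n\<close>] by (simp add: T_def E_def e_def d_def)
qed

text \<open>
  Fusion with the weight \<open>2 b = T - 2\<close> exchanges the trivial representation and the one of weight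
  \<open>T - 2\<close>. So \<open>n + 3\<close> such factors give the weight \<open>T - 2\<close> once if \<open>n\<close> is even, and the trivial
  representation if \<open>n\<close> is odd.
\<close>

lemma windows_balanced:
  fixes n b d :: nat
  assumes d: "d = b * (n + 2)" and b: "b \<ge> 1"
  defines "e \<equiv> \<lambda>i :: nat. int d - int (b * n)"
  defines "T \<equiv> (\<Sum>i\<in>{1..n+3}. e i) - 2 * int d + 2"
  shows "windows e (n + 3) (diff1 (comb T)) (int d) = (if even n then 1 else 0)"
proof -
  have T: "T = 2 * (int b + 1)" by (simp add: T_def e_def d algebra_simps)
  have last: "int d + int (n + 3) - 1 = (int b + 1) * int (n + 2)"
    by (simp add: d algebra_simps)
  have "windows e (n + 3) (diff1 (comb T)) (int d) = (- 1) ^ (n + 3) * diff1 (comb T) (int d + int (n + 3))"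
    by (rule windows_comb_simple_current) (simp_all add: T e_def d algebra_simps)
  moreover have "T dvd int d + int (n + 3) - 1 \<longleftrightarrow> even n"
  proof -
    have "T = (int b + 1) * 2" by (simp add: T)
    then show ?thesis unfolding last by (simp only: dvd_mult_cancel_left) simp
  qed
  moreover have "\<not> T dvd int d + int (n + 3)"
  proof
    assume "T dvd int d + int (n + 3)"
    then have "int b + 1 dvd int d + int (n + 3)" unfolding T by (rule dvd_mult_right)
    moreover have "int b + 1 dvd int d + int (n + 3) - 1" unfolding last by simp
    ultimately have "int b + 1 dvd (int d + int (n + 3)) - (int d + int (n + 3) - 1)" by (rule dvd_diff)
    then show False using b by simp
  qed
  ultimately show ?thesis by (auto simp: diff1_def comb_def)
qed

lemma sec_vdim_balanced:
  fixes n b :: nat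
  assumes b: "b \<ge> 1"
  shows "sec_vdim n (b * (n + 2)) (\<lambda>_. b * n) \<le> (if even n then 1 else 0)"
    and "even n \<Longrightarrow> sec_vdim n (b * (n + 2)) (\<lambda>_. b * n) = 1"
  using sec_vdim_windows[OF refl b, of n "\<lambda>_. b * n"] windows_balanced[OF refl b, of n] by simp_all

section \<open>Points in general position\<close>

text \<open>
  The linear map that sends the coordinate vectors to the first \<open>n + 1\<close> points.
\<close>

definition frame :: "nat \<Rightarrow> (nat \<Rightarrow> nat \<Rightarrow>\<^sub>0 complex) \<Rightarrow> vec \<Rightarrow> nat \<Rightarrow> complex" where
  "frame n p y l = (\<Sum>i\<le>n. y i * lookup (p (Suc i)) l)"

lemma frame_add: "frame n p (\<lambda>i. y i + s * z i) = (\<lambda>l. frame n p y l + s * frame n p z l)"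
  by (rule ext) (simp add: frame_def sum.distrib sum_distrib_left distrib_right mult.assoc)

lemma frame_unit: "i \<le> n \<Longrightarrow> frame n p (unit i) = lookup (p (Suc i))"
  by (rule ext) (simp add: frame_def unit_def if_distrib[of "\<lambda>x. x * _"] cong: if_cong)

lemma sum_frame:
  "(\<Sum>k\<in>{1..n+3}. r k * lookup (p k) j) =
     frame n p (\<lambda>i. r (Suc i)) j + r (n + 2) * lookup (p (n + 2)) j + r (n + 3) * lookup (p (n + 3)) j"
proof -
  have "{1..n+3} = {1..n+1} \<union> {n+2, n+3}" by auto
  then have "(\<Sum>k\<in>{1..n+3}. r k * lookup (p k) j) =
     (\<Sum>k\<in>{1..n+1}. r k * lookup (p k) j) + (\<Sum>k\<in>{n+2, n+3}. r k * lookup (p k) j)"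
    by (simp only:) (rule sum.union_disjoint, auto)
  also have "(\<Sum>k\<in>{1..n+1}. r k * lookup (p k) j) = frame n p (\<lambda>i. r (Suc i)) j"
    unfolding frame_def by (rule sum.reindex_bij_witness[of _ Suc "\<lambda>k. k - 1"]) auto
  finally show ?thesis by simp
qed

context
  fixes n :: nat and p :: "nat \<Rightarrow> nat \<Rightarrow>\<^sub>0 complex"
  assumes gp: "general_position n p"
begin

lemma lookup_point_outside: "k \<in> {1..n+3} \<Longrightarrow> \<not> j \<le> n \<Longrightarrow> lookup (p k) j = 0"
proof -
  assume "k \<in> {1..n+3}" and j: "\<not> j \<le> n"
  then have "p k \<in> proj_points n" using gp by (simp add: general_position_def)
  then show ?thesis using j by (auto simp: proj_points_def in_keys_iff subset_iff)
qed

text \<open>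
  A linear relation among the points that avoids two of them is a relation among \<open>n + 1\<close> points, hence
  trivial. The position of the points relative to each other enters the proof in this form.
\<close>

lemma relation_zero:
  assumes rel: "\<And>j. (\<Sum>k\<in>{1..n+3}. r k * lookup (p k) j) = 0"
    and ab: "a \<in> {1..n+3}" "b \<in> {1..n+3}" "a \<noteq> b" "r a = 0" "r b = 0" and k: "k \<in> {1..n+3}"
  shows "r k = 0"
proof (cases "k \<in> {a, b}")
  case False
  define J where "J = {1..n+3} - {a, b}"
  have "card J = n + 1" using ab by (simp add: J_def card_Diff_subset)
  then have inj: "inj_on p J" and ind: "cvs.independent (p ` J)"
    using gp by (auto simp: general_position_def J_def)
  have kJ: "k \<in> J" using k False by (simp add: J_def)
  define u where "u = (\<lambda>x. r (the_inv_into J p x))"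
  have u: "u (p i) = r i" if "i \<in> J" for i
    by (simp add: u_def the_inv_into_f_f[OF inj that])
  have "(\<Sum>x\<in>p ` J. cscale (u x) x) = (\<Sum>i\<in>J. cscale (r i) (p i))"
    by (simp add: sum.reindex[OF inj] u)
  also have "\<dots> = 0"
  proof (rule poly_mapping_eqI)
    fix j
    have "(\<Sum>i\<in>J. r i * lookup (p i) j) = (\<Sum>k\<in>{1..n+3}. r k * lookup (p k) j)"
      by (rule sum.mono_neutral_left) (use ab in \<open>auto simp: J_def\<close>)
    then show "lookup (\<Sum>i\<in>J. cscale (r i) (p i)) j = lookup 0 j"
      using rel[of j] by (simp add: lookup_sum)
  qed
  finally have "u (p k) = 0"
    using cvs.independentD[OF ind, of "p ` J" u "p k"] kJ by (simp add: J_def)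
  then show ?thesis using u[OF kJ] by simp
qed (use ab in auto)

lemma point_coordinates:
  assumes x: "keys x \<subseteq> {..n}"
  shows "\<exists>y. \<forall>j. lookup x j = (\<Sum>i\<le>n. y i * lookup (p (Suc i)) j)"
proof -
  define J where "J = {1..n+1}"
  have "J \<subseteq> {1..n+3}" "card J = n + 1" by (auto simp: J_def)
  then have inj: "inj_on p J" and ind: "cvs.independent (p ` J)" and pts: "\<And>k. k \<in> J \<Longrightarrow> p k \<in> proj_points n"
    using gp by (auto simp: general_position_def)
  define T where "T = (\<lambda>j. single j (1 :: complex)) ` {..n}"
  have sp: "y \<in> cvs.span T" if y: "keys y \<subseteq> {..n}" for y
  proof -
    have "y = (\<Sum>j\<le>n. cscale (lookup y j) (single j 1))"
    proof (rule poly_mapping_eqI)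
      fix l
      have "lookup (\<Sum>j\<le>n. cscale (lookup y j) (single j 1)) l
          = (\<Sum>j\<le>n. if j = l then lookup y j else 0)"
        unfolding lookup_sum by (rule sum.cong) (auto simp: lookup_single when_def)
      also have "\<dots> = lookup y l" using y by (auto simp: in_keys_iff)
      finally show "lookup y l
          = lookup (\<Sum>j\<le>n. cscale (lookup y j) (single j 1)) l" by simp
    qed
    also have "\<dots> \<in> cvs.span T"
      by (intro cvs.span_sum cvs.span_scale cvs.span_base) (auto simp: T_def)
    finally show ?thesis .
  qed
  have "x \<in> cvs.span (p ` J)"
  proof (rule ccontr)
    assume nx: "x \<notin> cvs.span (p ` J)"
    then have "cvs.independent (insert x (p ` J))" using ind by (rule cvs.independent_insertI)
    moreover have "insert x (p ` J) \<subseteq> cvs.span T" using sp x pts by (auto simp: proj_points_def)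
    ultimately have "card (insert x (p ` J)) \<le> card T"
      using cvs.independent_span_bound[of T "insert x (p ` J)"] by (simp add: T_def)
    also have "\<dots> \<le> n + 1" unfolding T_def using card_image_le[of "{..n}"] by simp
    finally have "card (insert x (p ` J)) \<le> n + 1" .
    moreover have "x \<notin> p ` J" using nx cvs.span_base by blast
    moreover have "card (p ` J) = n + 1" using card_image[OF inj] by (simp add: J_def)
    ultimately show False by (simp add: J_def)
  qed
  then obtain w where w: "x = (\<Sum>v\<in>p ` J. cscale (w v) v)"
    by (subst (asm) cvs.span_finite) (auto simp: J_def)
  have "lookup x j = (\<Sum>i\<le>n. w (p (Suc i)) * lookup (p (Suc i)) j)" for j
  proof -
    have "lookup x j = (\<Sum>k\<in>J. w (p k) * lookup (p k) j)"
      by (simp add: w sum.reindex[OF inj] lookup_sum)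
    also have "\<dots> = (\<Sum>i\<le>n. w (p (Suc i)) * lookup (p (Suc i)) j)"
      by (rule sum.reindex_bij_witness[of _ Suc "\<lambda>k. k - 1"]) (auto simp: J_def)
    finally show ?thesis .
  qed
  then show ?thesis by (intro exI[of _ "\<lambda>i. w (p (Suc i))"] allI)
qed

lemma frame_outside: "\<not> j \<le> n \<Longrightarrow> frame n p y j = 0"
  using lookup_point_outside by (simp add: frame_def)

lemma frame_eq_0:
  assumes "\<And>j. j \<le> n \<Longrightarrow> frame n p y j = 0" "i \<le> n"
  shows "y i = 0"
proof -
  define r where "r = (\<lambda>k. if k \<le> n + 1 then y (k - 1) else 0)"
  have "(\<lambda>i. r (Suc i)) = (\<lambda>i. if i \<le> n then y i else 0)" by (auto simp: r_def)
  then have fr: "frame n p (\<lambda>i. r (Suc i)) j = frame n p y j" for j by (simp add: frame_def)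
  have "r (Suc i) = 0"
  proof (rule relation_zero[of r "n + 2" "n + 3"])
    show "(\<Sum>k\<in>{1..n+3}. r k * lookup (p k) j) = 0" for j
      unfolding sum_frame fr using assms(1)[of j] frame_outside[of j y] by (cases "j \<le> n") (auto simp: r_def)
  qed (use assms(2) in \<open>auto simp: r_def\<close>)
  then show ?thesis using assms(2) by (simp add: r_def)
qed

lemma exists_coords:
  "\<exists>Y. (\<forall>x j. j \<le> n \<longrightarrow> frame n p (\<lambda>i. \<Sum>l\<le>n. x l * Y i l) j = x j) \<and>
       (\<forall>y i. i \<le> n \<longrightarrow> (\<Sum>l\<le>n. frame n p y l * Y i l) = y i)"
proof -
  have "\<forall>l. \<exists>y. l \<le> n \<longrightarrow> (\<forall>j. frame n p y j = (if j = l then 1 else 0))"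
  proof
    fix l
    show "\<exists>y. l \<le> n \<longrightarrow> (\<forall>j. frame n p y j = (if j = l then 1 else 0))"
    proof (cases "l \<le> n")
      case True
      then obtain y where "\<forall>j. lookup (single l 1) j = frame n p y j"
        using point_coordinates[of "single l 1"] True unfolding frame_def by auto
      then have "\<forall>j. frame n p y j = (if j = l then 1 else 0)"
        by (metis lookup_single_eq lookup_single_not_eq)
      then show ?thesis by blast
    qed simp
  qed
  then obtain Y' where Y': "\<And>l j. l \<le> n \<Longrightarrow> frame n p (Y' l) j = (if j = l then 1 else 0)" by metis
  define Y where "Y = (\<lambda>i l. Y' l i)"
  have 1: "frame n p (\<lambda>i. \<Sum>l\<le>n. x l * Y i l) j = x j" if j: "j \<le> n" for x j
  proof -
    have "frame n p (\<lambda>i. \<Sum>l\<le>n. x l * Y i l) j = (\<Sum>l\<le>n. x l * frame n p (Y' l) j)"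
      unfolding frame_def Y_def sum_distrib_left sum_distrib_right by (subst sum.swap) (simp add: mult_ac)
    also have "\<dots> = (\<Sum>l\<le>n. if l = j then x l else 0)"
      by (rule sum.cong) (auto simp: Y')
    finally show ?thesis using j by simp
  qed
  have 2: "(\<Sum>l\<le>n. frame n p y l * Y i l) = y i" if i: "i \<le> n" for y i
  proof -
    have "(\<lambda>i. (\<Sum>l\<le>n. frame n p y l * Y i l) + (- 1) * y i) i = 0"
    proof (rule frame_eq_0[OF _ i])
      fix j assume "j \<le> n"
      then show "frame n p (\<lambda>i. (\<Sum>l\<le>n. frame n p y l * Y i l) + (- 1) * y i) j = 0"
        unfolding frame_add by (simp add: 1)
    qed
    then show ?thesis by simp
  qed
  show ?thesis using 1 2 by blast
qed

text \<open>
  A zero coordinate of \<open>u\<close> or \<open>v\<close>, or a zero minor, would give a linear relation among the \<open>n + 3\<close>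
  points with two zero coefficients.
\<close>

lemma exists_last_coords:
  "\<exists>u v. in_general_position n u v \<and> frame n p u = lookup (p (n + 2)) \<and>
     frame n p v = lookup (p (n + 3))"
proof -
  have "keys (p k) \<subseteq> {..n}" if "k \<in> {1..n+3}" for k
    using gp that by (auto simp: general_position_def proj_points_def)
  note keys = this
  have ex: "\<exists>y. frame n p y = lookup (p k)" if k: "k \<in> {1..n+3}" for k
  proof -
    obtain y where "\<forall>j. lookup (p k) j = (\<Sum>i\<le>n. y i * lookup (p (Suc i)) j)"
      using point_coordinates[OF keys[OF k]] by blast
    then have "frame n p y = lookup (p k)" by (intro ext) (simp add: frame_def)
    then show ?thesis by blast
  qed
  obtain u where u: "frame n p u = lookup (p (n + 2))" using ex[of "n + 2"] by auto
  obtain v where v: "frame n p v = lookup (p (n + 3))" using ex[of "n + 3"] by auto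
  have rel: "frame n p (\<lambda>i. r (Suc i)) j + r (n + 2) * frame n p u j + r (n + 3) * frame n p v j = 0 \<Longrightarrow>
      (\<Sum>k\<in>{1..n+3}. r k * lookup (p k) j) = 0" for r j
    unfolding sum_frame u v .
  have comb: "\<alpha> = 0 \<and> \<beta> = 0"
    if ij: "i \<in> {1..n+3}" "j \<in> {1..n+3}" "i \<noteq> j"
      and r: "r = (\<lambda>k. if k \<le> n + 1 then - (\<alpha> * u (k - 1) + \<beta> * v (k - 1)) else if k = n + 2 then \<alpha> else \<beta>)"
      and rij: "r i = 0" "r j = 0" for i j r \<alpha> \<beta>
  proof -
    have "frame n p (\<lambda>i. r (Suc i)) l = frame n p (\<lambda>i. (0 + (- \<alpha>) * u i) + (- \<beta>) * v i) l" for l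
      unfolding frame_def r by (rule sum.cong) auto
    then have fr: "frame n p (\<lambda>i. r (Suc i)) l = - \<alpha> * frame n p u l - \<beta> * frame n p v l" for l
      unfolding frame_add by (simp add: frame_def)
    have "(\<Sum>k\<in>{1..n+3}. r k * lookup (p k) l) = 0" for l
      by (rule rel) (simp add: fr, simp add: r)
    then have "r (n + 2) = 0" "r (n + 3) = 0"
      using relation_zero[of r i j] ij rij by auto
    then show ?thesis by (simp add: r)
  qed
  have "in_general_position n u v"
    unfolding in_general_position_def
  proof (intro conjI allI impI)
    fix i assume i: "i \<le> n"
    show "u i \<noteq> 0"
      using comb[of "Suc i" "n + 3" _ 1 0] i by auto
    show "v i \<noteq> 0"
      using comb[of "Suc i" "n + 2" _ 0 1] i by auto
  next
    fix i j assume i: "i \<le> n" and j: "j \<le> n" and ne: "i \<noteq> j"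
    show "u i * v j \<noteq> u j * v i"
    proof
      assume eq: "u i * v j = u j * v i"
      have "v i = 0 \<and> - u i = 0"
        using comb[of "Suc i" "Suc j" _ "v i" "- u i"] i j ne eq by (auto simp: mult.commute)
      then show False using comb[of "Suc i" "n + 3" _ 1 0] i by auto
    qed
  qed
  then show ?thesis using u v by blast
qed

lemma points_not_proportional:
  assumes n: "n \<ge> 1" and k: "k \<in> {1..n+3}" and l: "l \<in> {1..n+3}"
    and eq: "\<And>j. lookup (p k) j = c * lookup (p l) j"
  shows "k = l"
proof (rule ccontr)
  assume ne: "k \<noteq> l"
  define r where "r = (\<lambda>i. if i = k then 1 else if i = l then - c else 0)"
  have "card ({1..n+3} - {k, l}) = n + 1" using k l ne by (simp add: card_Diff_subset)
  then have "\<not> card ({1..n+3} - {k, l}) \<le> 1" using n by simp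
  then obtain a b where ab: "a \<in> {1..n+3} - {k, l}" "b \<in> {1..n+3} - {k, l}" "a \<noteq> b"
    by (metis card_le_Suc0_iff_eq One_nat_def finite_Diff finite_atLeastAtMost)
  have "(\<Sum>i\<in>{1..n+3}. r i * lookup (p i) j) = 0" for j
  proof -
    have "(\<Sum>i\<in>{1..n+3}. r i * lookup (p i) j) = (\<Sum>i\<in>{k, l}. r i * lookup (p i) j)"
      by (rule sum.mono_neutral_right) (use k l in \<open>auto simp: r_def\<close>)
    then show ?thesis using ne by (simp add: r_def eq)
  qed
  then have "r k = 0" by (rule relation_zero[of r a b]) (use ab k in \<open>auto simp: r_def\<close>)
  then show False by (simp add: r_def)
qed

lemma deg_along_frame:
  assumes f: "in_vars n f"
  shows "deg_along k (\<lambda>y. eval_at f (frame n p y)) z \<longleftrightarrow> deg_along k (eval_at f) (frame n p z)"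
proof
  assume L: "deg_along k (\<lambda>y. eval_at f (frame n p y)) z"
  obtain Y where Y: "\<And>x j. j \<le> n \<Longrightarrow> frame n p (\<lambda>i. \<Sum>l\<le>n. x l * Y i l) j = x j"
    using exists_coords by blast
  show "deg_along k (eval_at f) (frame n p z)"
    unfolding deg_along_def
  proof
    fix x
    let ?y = "\<lambda>i. \<Sum>l\<le>n. x l * Y i l"
    obtain q where q: "degree q \<le> k" "\<And>s. eval_at f (frame n p (\<lambda>i. ?y i + s * z i)) = poly q s"
      using L[unfolded deg_along_def, rule_format, of ?y] by blast
    have "eval_at f (\<lambda>i. x i + s * frame n p z i) = poly q s" for s
      unfolding q(2)[symmetric] frame_add by (rule eval_at_cong[OF f]) (simp add: Y)
    then show "\<exists>q. degree q \<le> k \<and> (\<forall>s. eval_at f (\<lambda>i. x i + s * frame n p z i) = poly q s)"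
      using q(1) by blast
  qed
next
  assume R: "deg_along k (eval_at f) (frame n p z)"
  show "deg_along k (\<lambda>y. eval_at f (frame n p y)) z"
    unfolding deg_along_def frame_add
    using R[unfolded deg_along_def] by blast
qed

end

lemma mult_ge_iff_deg_along:
  "is_form n d f \<Longrightarrow> m \<le> d \<Longrightarrow> mult_ge n f p m \<longleftrightarrow> deg_along (d - m) (eval_at f) (lookup p)"
  using mult_ge_of_deg_along deg_along_of_mult_ge by blast

lemma mult_ge_mono: "mult_ge n f x m \<Longrightarrow> m' \<le> m \<Longrightarrow> mult_ge n f x m'"
  unfolding mult_ge_def by simp

lemma index_cases:
  assumes "k \<in> {1..n+3 :: nat}"
  obtains i where "i \<le> n" "k = Suc i" | "k = n + 2" | "k = n + 3"
proof (cases "k \<le> n + 1")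
  case True
  then show thesis using assms that(1)[of "k - 1"] by auto
qed (use assms that in force)

lemma system_forms_iff_balanced:
  assumes gp: "general_position n p"
    and u: "frame n p u = lookup (p (n + 2))" and v: "frame n p v = lookup (p (n + 3))"
  shows "f \<in> system_forms n (b * (n + 2)) p (\<lambda>_. b * n) \<longleftrightarrow>
    is_form n (b * (n + 2)) f \<and> balanced_form n b u v (\<lambda>y. eval_at f (frame n p y))"
proof (cases "is_form n (b * (n + 2)) f")
  case f: True
  then have fv: "in_vars n f" by (simp add: is_form_iff)
  have diff: "b * (n + 2) - b * n = 2 * b" by (simp add: algebra_simps)
  have mult: "mult_ge n f (p k) (b * n) \<longleftrightarrow> deg_along (2 * b) (eval_at f) (lookup (p k))" for k
    by (rule mult_ge_iff_deg_along[OF f, of "b * n", unfolded diff]) simp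
  let ?F = "\<lambda>y. eval_at f (frame n p y)"
  have hom: "homogeneous (b * (n + 2)) ?F"
    unfolding homogeneous_def
  proof (intro allI impI)
    fix c x
    have "frame n p (\<lambda>i. c * x i) = (\<lambda>i. c * frame n p x i)"
      by (auto simp: frame_def sum_distrib_left mult.assoc)
    then show "eval_at f (frame n p (\<lambda>i. c * x i)) = c ^ (b * (n + 2)) * eval_at f (frame n p x)"
      by (simp only: eval_at_homogeneous[OF f])
  qed
  have cong: "?F x = ?F y" if "\<forall>i\<le>n. x i = y i" for x y
  proof -
    have "frame n p x = frame n p y" using that by (auto simp: frame_def)
    then show ?thesis by simp
  qed
  have "(\<forall>k\<in>{1..n+3}. deg_along (2 * b) (eval_at f) (lookup (p k))) \<longleftrightarrow>
    (\<forall>i\<le>n. deg_along (2 * b) (eval_at f) (lookup (p (Suc i)))) \<and>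
     deg_along (2 * b) (eval_at f) (lookup (p (n + 2))) \<and>
     deg_along (2 * b) (eval_at f) (lookup (p (n + 3)))" (is "?L \<longleftrightarrow> ?R")
  proof
    assume ?R
    show ?L
    proof
      fix k assume "k \<in> {1..n+3}"
      then show "deg_along (2 * b) (eval_at f) (lookup (p k))"
        by (rule index_cases) (use \<open>?R\<close> in auto)
    qed
  qed auto
  also have "\<dots> \<longleftrightarrow> (\<forall>i\<le>n. deg_along (2 * b) ?F (unit i)) \<and> deg_along (2 * b) ?F u \<and> deg_along (2 * b) ?F v"
    unfolding deg_along_frame[OF gp fv] u v using frame_unit by simp
  also have "\<dots> \<longleftrightarrow> balanced_form n b u v ?F"
    using hom cong by (auto simp: balanced_form_def multipoly_def)
  finally show ?thesis using f by (simp add: system_forms_def mult)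
qed (simp add: system_forms_def)

lemma exists_form_of_balanced:
  assumes gp: "general_position n p" and F: "balanced_form n b u v F"
  obtains f where "is_form n (b * (n + 2)) f" "\<And>y. eval_at f (frame n p y) = F y"
proof -
  obtain Y where Y: "\<And>y i. i \<le> n \<Longrightarrow> (\<Sum>l\<le>n. frame n p y l * Y i l) = y i"
    using exists_coords[OF gp] by blast
  let ?N = "\<lambda>x i. \<Sum>l\<le>n. x l * Y i l"
  have mp: "multipoly n (2 * b) F" and hom: "homogeneous (b * (n + 2)) F"
    using F by (simp_all add: balanced_form_def)
  obtain c where c: "\<And>x. F x = (\<Sum>a\<in>PiE {..n} (\<lambda>_. {..2 * b}). c a * (\<Prod>i\<le>n. poly (lagrange (2 * b) (a i)) (x i)))"
    using multipoly_interp[OF mp] by blast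
  have "polyfun n (\<lambda>x. F (?N x))"
    unfolding c
    by (intro polyfun_sum polyfun_mult polyfun_prod polyfun_poly polyfun_const polyfun_coord) simp
  moreover have "homogeneous (b * (n + 2)) (\<lambda>x. F (?N x))"
    unfolding homogeneous_def
  proof (intro allI impI)
    fix s :: complex and x assume s: "s \<noteq> 0"
    have "?N (\<lambda>i. s * x i) = (\<lambda>i. s * ?N x i)" by (simp add: sum_distrib_left mult.assoc)
    then show "F (?N (\<lambda>i. s * x i)) = s ^ (b * (n + 2)) * F (?N x)"
      by (simp only: homogeneousD[OF hom s])
  qed
  ultimately obtain f where f: "is_form n (b * (n + 2)) f" "\<And>x. eval_at f x = F (?N x)"
    by (rule homogeneous_polyfun_form) blast
  have "eval_at f (frame n p y) = F y" for y
    unfolding f(2) by (rule multipoly_cong[OF mp]) (rule Y)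
  then show thesis using that f(1) by blast
qed

lemma form_proportional:
  assumes gp: "general_position n p" and f: "is_form n d f" and g: "is_form n d g"
    and eq: "\<And>y. eval_at f (frame n p y) = c * eval_at g (frame n p y)"
  shows "f = cscale c g"
proof -
  obtain Y where Y: "\<And>x j. j \<le> n \<Longrightarrow> frame n p (\<lambda>i. \<Sum>l\<le>n. x l * Y i l) j = x j"
    using exists_coords[OF gp] by blast
  define h where "h = f + cscale (- c) g"
  have keys: "keys h \<subseteq> keys f \<union> keys g"
    unfolding h_def using keys_add[of f "cscale (- c) g"] keys_cscale[of "- c" g] by blast
  then have h: "is_form n d h" using f g unfolding is_form_def by blast
  have "eval_at h x = 0" for x
  proof -
    have "eval_at h x = eval_at h (frame n p (\<lambda>i. \<Sum>l\<le>n. x l * Y i l))"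
      by (rule eval_at_cong[of n]) (use h in \<open>simp_all add: is_form_iff Y\<close>)
    then show ?thesis unfolding h_def eval_at_add eval_at_cscale eq by simp
  qed
  then have "h = 0" using form_eq_0[OF h] by blast
  show ?thesis
  proof (rule poly_mapping_eqI)
    fix a
    have "lookup h a = 0" using \<open>h = 0\<close> by simp
    then show "lookup f a = lookup (cscale c g) a"
      unfolding h_def lookup_add lookup_cscale by simp
  qed
qed

lemma system_forms_odd:
  assumes gp: "general_position n p" and b: "b \<ge> 1" and "odd n"
  shows "system_forms n (b * (n + 2)) p (\<lambda>_. b * n) = {0}"
proof -
  obtain u v where uv: "in_general_position n u v"
    and u: "frame n p u = lookup (p (n + 2))" and v: "frame n p v = lookup (p (n + 3))"
    using exists_last_coords[OF gp] by blast
  have zero: "is_form n (b * (n + 2)) 0" by (simp add: is_form_def)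
  have "f = 0" if "f \<in> system_forms n (b * (n + 2)) p (\<lambda>_. b * n)" for f
  proof -
    have f: "is_form n (b * (n + 2)) f" "balanced_form n b u v (\<lambda>y. eval_at f (frame n p y))"
      using that system_forms_iff_balanced[OF gp u v] by auto
    then have "eval_at f (frame n p y) = 0" for y
      using balanced_form_odd_zero[OF \<open>odd n\<close> b uv f(2)] by blast
    then have "f = cscale 1 0" by (intro form_proportional[OF gp f(1) zero]) simp
    then show ?thesis by (simp only: cvs.scale_zero_right)
  qed
  moreover have "0 \<in> system_forms n (b * (n + 2)) p (\<lambda>_. b * n)"
  proof -
    have "foldr pdiff js 0 = 0" for js by (induction js) (auto simp: pdiff_def)
    then show ?thesis using zero by (simp add: system_forms_def mult_ge_def peval_eq_eval_at)
  qed
  ultimately show ?thesis by blast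
qed

text \<open>
  The last property says that the multiplicity of \<open>f0\<close> at each point is exactly \<open>b n\<close>. It controls the
  systems that contain the given one.
\<close>

lemma system_forms_even:
  assumes gp: "general_position n p" and b: "b \<ge> 1" and "even n"
  obtains f0 where "f0 \<noteq> 0" "f0 \<in> system_forms n (b * (n + 2)) p (\<lambda>_. b * n)"
    and "\<And>f. f \<in> system_forms n (b * (n + 2)) p (\<lambda>_. b * n) \<Longrightarrow> \<exists>c. f = cscale c f0"
    and "\<And>k m. k \<in> {1..n+3} \<Longrightarrow> mult_ge n f0 (p k) m \<Longrightarrow> m \<le> b * n"
proof -
  obtain u v where uv: "in_general_position n u v"
    and u: "frame n p u = lookup (p (n + 2))" and v: "frame n p v = lookup (p (n + 3))"
    using exists_last_coords[OF gp] by blast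
  note sys = system_forms_iff_balanced[OF gp u v]
  obtain F0 where F0: "balanced_form n b u v F0" and nz: "\<exists>x. F0 x \<noteq> 0"
    and uniq: "\<And>F. balanced_form n b u v F \<Longrightarrow> \<exists>c. \<forall>x. F x = c * F0 x"
    using balanced_form_even_unique[OF \<open>even n\<close> uv, of b] by blast
  obtain f0 where f0: "is_form n (b * (n + 2)) f0" and ev: "\<And>y. eval_at f0 (frame n p y) = F0 y"
    using exists_form_of_balanced[OF gp F0] by blast
  have f0v: "in_vars n f0" using f0 by (simp add: is_form_iff)
  show thesis
  proof
    show "f0 \<noteq> 0" using nz ev by auto
    show "f0 \<in> system_forms n (b * (n + 2)) p (\<lambda>_. b * n)" unfolding sys ev using f0 F0 by simp
    show "\<exists>c. f = cscale c f0" if "f \<in> system_forms n (b * (n + 2)) p (\<lambda>_. b * n)" for f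
    proof -
      have f: "is_form n (b * (n + 2)) f" "balanced_form n b u v (\<lambda>y. eval_at f (frame n p y))"
        using that sys by auto
      obtain c where "\<And>y. eval_at f (frame n p y) = c * F0 y" using uniq[OF f(2)] by blast
      then have "f = cscale c f0" by (intro form_proportional[OF gp f(1) f0]) (simp add: ev)
      then show ?thesis by blast
    qed
    show "m \<le> b * n" if k: "k \<in> {1..n+3}" and m: "mult_ge n f0 (p k) m" for k m
    proof (rule ccontr)
      assume "\<not> m \<le> b * n"
      then have "mult_ge n f0 (p k) (b * n + 1)" using mult_ge_mono[OF m] by simp
      moreover have "b * n + 1 \<le> b * (n + 2)" "b * (n + 2) - (b * n + 1) = 2 * b - 1"
        using b by (simp_all add: algebra_simps)
      ultimately have along: "deg_along (2 * b - 1) (eval_at f0) (lookup (p k))"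
        using mult_ge_iff_deg_along[OF f0, of "b * n + 1"] by simp
      have uvnz: "\<And>i. i \<le> n \<Longrightarrow> u i \<noteq> 0" "\<And>i. i \<le> n \<Longrightarrow> v i \<noteq> 0"
        using uv by (auto simp: in_general_position_def)
      have fr: "deg_along (2 * b - 1) F0 z" if "frame n p z = lookup (p k)" for z
        using deg_along_frame[OF gp f0v, of "2 * b - 1" z] along that by (simp add: ev)
      have "F0 x = 0" for x
        using k
      proof (rule index_cases)
        fix i assume i: "i \<le> n" "k = Suc i"
        then show ?thesis
          using balanced_form_zero_of_smaller_degree_unit[OF F0 uv b i(1) fr] frame_unit by simp
      next
        assume "k = n + 2"
        then show ?thesis
          using balanced_form_zero_of_smaller_degree_along[OF F0 b fr uvnz(1)] u by simp
      next
        assume "k = n + 3"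
        then show ?thesis
          using balanced_form_zero_of_smaller_degree_along[OF F0 b fr uvnz(2)] v by simp
      qed
      then show False using nz by blast
    qed
  qed
qed

section \<open>The rational normal curve in the base locus\<close>

lemma order_ge_of_small:
  fixes q :: "complex poly"
  assumes small: "\<And>s. s \<noteq> 0 \<Longrightarrow> norm s \<le> 1 \<Longrightarrow> norm (poly q (a + s)) \<le> C * norm s ^ m"
    and q: "q \<noteq> 0"
  shows "m \<le> order a q"
proof (rule ccontr)
  assume "\<not> m \<le> order a q"
  define r where "r = order a q"
  have r: "Suc r \<le> m" using \<open>\<not> m \<le> order a q\<close> by (simp add: r_def)
  obtain h where h: "q = [:- a, 1:] ^ r * h" "\<not> [:- a, 1:] dvd h"
    using order_decomp[OF q, of a] unfolding r_def by blast
  have h0: "poly h a \<noteq> 0" using h(2) by (simp add: poly_eq_0_iff_dvd)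
  have bound: "norm (poly h (a + s)) \<le> norm s * \<bar>C\<bar>" if s: "s \<noteq> 0" "norm s \<le> 1" for s
  proof -
    have "poly q (a + s) = s ^ r * poly h (a + s)" by (simp add: h(1) poly_power)
    then have "norm s ^ r * norm (poly h (a + s)) \<le> C * norm s ^ m"
      using small[OF s] by (simp add: norm_mult norm_power)
    also have "\<dots> \<le> \<bar>C\<bar> * norm s ^ Suc r"
      using s r by (intro mult_mono power_decreasing) auto
    finally have "norm s ^ r * norm (poly h (a + s)) \<le> norm s ^ r * (norm s * \<bar>C\<bar>)" by (simp add: mult_ac)
    then show ?thesis using s by (simp add: mult_le_cancel_left)
  qed
  have "((\<lambda>s. poly h (a + s)) \<longlongrightarrow> 0) (at 0)"
  proof (rule tendsto_0_le[OF tendsto_ident_at])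
    show "eventually (\<lambda>s. norm (poly h (a + s)) \<le> norm s * \<bar>C\<bar>) (at 0)"
      unfolding eventually_at by (rule exI[of _ 1]) (auto intro!: bound)
  qed
  moreover have "((\<lambda>s. poly h (a + s)) \<longlongrightarrow> poly h (a + 0)) (at 0)"
    by (intro tendsto_intros)
  ultimately show False using h0 LIM_unique by force
qed

text \<open>
  On a curve \<open>c\<close> that passes through the point at parameter \<open>a\<close>, a form of multiplicity \<open>m\<close> at that point has a
  zero of order \<open>m\<close>: write \<open>c (a + s) = c a + s y\<close> with \<open>y\<close> bounded and apply \<open>vanishing_order\<close>.
\<close>

lemma order_ge_of_deg_along:
  assumes f: "is_form n d f" and m: "m \<le> d"
    and along: "deg_along (d - m) (eval_at f) (\<lambda>i. poly (c i) a)"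
    and Q: "\<And>s. eval_at f (\<lambda>i. poly (c i) s) = poly Q s" and nz: "Q \<noteq> 0"
  shows "m \<le> order a Q"
proof -
  have fv: "in_vars n f" using f by (simp add: is_form_iff)
  have mp: "multipoly n d (eval_at f)"
    unfolding multipoly_def using eval_at_cong[OF fv] deg_along_form[OF f] by blast
  have hom: "homogeneous d (eval_at f)" unfolding homogeneous_def using eval_at_homogeneous[OF f] by blast
  have "\<exists>e. c i = [:poly (c i) a:] + [:- a, 1:] * e" for i
  proof -
    have "poly (c i - [:poly (c i) a:]) a = 0" by simp
    then have "[:- a, 1:] dvd c i - [:poly (c i) a:]" unfolding poly_eq_0_iff_dvd .
    then obtain e where "c i - [:poly (c i) a:] = [:- a, 1:] * e" by (elim dvdE)
    then have "c i = [:poly (c i) a:] + [:- a, 1:] * e" by (simp add: diff_eq_eq add.commute)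
    then show ?thesis by blast
  qed
  then obtain e where e: "\<And>i. c i = [:poly (c i) a:] + [:- a, 1:] * e i" by metis
  have expand: "poly (c i) (a + s) = poly (c i) a + s * poly (e i) (a + s)" for i s
  proof -
    have "poly (c i) (a + s) = poly ([:poly (c i) a:] + [:- a, 1:] * e i) (a + s)" using e[of i] by metis
    then show ?thesis by (simp add: algebra_simps)
  qed
  have "\<exists>C\<ge>0. \<forall>s. norm s \<le> norm a + 1 \<longrightarrow> norm (poly (e i) s) \<le> C" for i
    by (rule poly_bounded_on_disc)
  then obtain D where D: "\<And>i. D i \<ge> 0" "\<And>i s. norm s \<le> norm a + 1 \<Longrightarrow> norm (poly (e i) s) \<le> D i" by metis
  obtain C where C: "\<And>y s. (\<forall>i\<le>n. norm (y i) \<le> (\<Sum>i\<le>n. D i)) \<Longrightarrow> s \<noteq> 0 \<Longrightarrow> norm s \<le> 1 \<Longrightarrow>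
      norm (eval_at f (\<lambda>i. poly (c i) a + s * y i)) \<le> C * norm s ^ (d - (d - m))"
    using vanishing_order[OF mp hom along, of "\<Sum>i\<le>n. D i"] by auto
  show ?thesis
  proof (rule order_ge_of_small[OF _ nz])
    fix s :: complex assume s: "s \<noteq> 0" "norm s \<le> 1"
    have "norm (a + s) \<le> norm a + 1" using norm_triangle_ineq[of a s] s by simp
    then have "norm (poly (e i) (a + s)) \<le> (\<Sum>i\<le>n. D i)" if "i \<le> n" for i
      using D that member_le_sum[of i "{..n}" D] by (meson order.trans atMost_iff finite_atMost)
    then have "norm (eval_at f (\<lambda>i. poly (c i) a + s * poly (e i) (a + s))) \<le> C * norm s ^ (d - (d - m))"
      using C[of "\<lambda>i. poly (e i) (a + s)"] s by blast
    then show "norm (poly Q (a + s)) \<le> C * norm s ^ m"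
      using m unfolding Q[symmetric] expand by simp
  qed
qed

text \<open>
  The restriction to the curve is a polynomial of degree at most \<open>n b (n + 2)\<close> in the parameter with \<open>n + 3\<close> zeros of order at
  least \<open>b n\<close>.
\<close>

lemma system_vanishes_on_rational_normal_curve:
  assumes gp: "general_position n p" and n: "n \<ge> 1" and b: "b \<ge> 1"
    and C: "rational_normal_curve n C" and pC: "\<And>k. k \<in> {1..n+3} \<Longrightarrow> p k \<in> C"
    and fs: "f \<in> system_forms n (b * (n + 2)) p (\<lambda>_. b * n)" and x: "x \<in> C"
  shows "peval f x = 0"
proof -
  let ?d = "b * (n + 2)"
  have f: "is_form n ?d f" and mult: "\<And>k. k \<in> {1..n+3} \<Longrightarrow> mult_ge n f (p k) (b * n)"
    using fs by (auto simp: system_forms_def)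
  obtain v :: "nat \<Rightarrow> nat \<Rightarrow>\<^sub>0 complex" where
    Ceq: "C = {(\<Sum>j\<le>n. cscale (s ^ (n - j) * t ^ j) (v j)) | s t. (s, t) \<noteq> (0, 0)}"
    using C unfolding rational_normal_curve_def by blast
  define \<gamma> where "\<gamma> = (\<lambda>s t l. \<Sum>j\<le>n. (s ^ (n - j) * t ^ j) * lookup (v j) l)"
  have inC: "\<exists>s t. (s, t) \<noteq> (0, 0) \<and> lookup y = \<gamma> s t" if "y \<in> C" for y
    using that unfolding Ceq by (fastforce simp: \<gamma>_def lookup_sum)
  have \<gamma>_scale: "\<gamma> (c * s) (c * t) = (\<lambda>l. c ^ n * \<gamma> s t l)" for c s t
  proof
    fix l
    show "\<gamma> (c * s) (c * t) l = c ^ n * \<gamma> s t l"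
      unfolding \<gamma>_def sum_distrib_left
    proof (rule sum.cong[OF refl])
      fix j assume "j \<in> {..n}"
      then have "c ^ n = c ^ (n - j) * c ^ j" by (simp flip: power_add)
      then show "(c * s) ^ (n - j) * (c * t) ^ j * lookup (v j) l
          = c ^ n * (s ^ (n - j) * t ^ j * lookup (v j) l)"
        by (simp only: power_mult_distrib mult_ac)
    qed
  qed
  have "\<forall>k. \<exists>s t. k \<in> {1..n+3} \<longrightarrow> (s, t) \<noteq> (0, 0) \<and> lookup (p k) = \<gamma> s t"
    using inC pC by blast
  then obtain S U where SU: "\<And>k. k \<in> {1..n+3} \<Longrightarrow> (S k, U k) \<noteq> (0, 0)"
    "\<And>k. k \<in> {1..n+3} \<Longrightarrow> lookup (p k) = \<gamma> (S k) (U k)" by metis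
  obtain s1 t1 where st1: "(s1, t1) \<noteq> (0, 0)" "lookup x = \<gamma> s1 t1" using inC[OF x] by blast
  \<comment> \<open>The chart z \<mapsto> (z : 1 + \<tau> z) of the parameter line misses only (1 : \<tau>), and \<tau> is chosen so that
     this is not the parameter of x or of one of the points.\<close>
  obtain \<tau> where \<tau>: "\<tau> \<notin> insert (t1 / s1) ((\<lambda>k. U k / S k) ` {1..n+3})"
    using ex_new_if_finite[OF infinite_UNIV_char_0] by (metis finite_atLeastAtMost finite_imageI finite_insert)
  have chart: "\<exists>c z. c \<noteq> 0 \<and> s = c * z \<and> t = c * (1 + \<tau> * z)"
    if "(s, t) \<noteq> (0, 0)" "\<tau> \<noteq> t / s" for s t
  proof (intro exI conjI)
    show c: "t - s * \<tau> \<noteq> 0" using that by (cases "s = 0") (auto simp: field_simps)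
    then show "s = (t - s * \<tau>) * (s / (t - s * \<tau>))" by simp
    have "(t - s * \<tau>) * (1 + \<tau> * (s / (t - s * \<tau>))) = (t - s * \<tau>) + \<tau> * s"
      using c by (simp add: distrib_left)
    then show "t = (t - s * \<tau>) * (1 + \<tau> * (s / (t - s * \<tau>)))" by (simp add: mult.commute)
  qed
  define c where "c = (\<lambda>l. \<Sum>j\<le>n. smult (lookup (v j) l) ([:0, 1:] ^ (n - j) * [:1, \<tau>:] ^ j))"
  have c: "(\<lambda>l. poly (c l) z) = \<gamma> z (1 + \<tau> * z)" for z
    by (rule ext) (simp add: c_def \<gamma>_def poly_sum poly_power poly_mult mult_ac)
  have deg: "degree (c l) \<le> n" for l
    unfolding c_def
  proof (intro degree_sum_le order.trans[OF degree_smult_le])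
    fix j assume j: "j \<in> {..n}"
    have "degree ([:0, 1:] ^ (n - j) * [:1, \<tau>:] ^ j) \<le> degree ([:0, 1 :: complex:] ^ (n - j)) + degree ([:1, \<tau>:] ^ j)"
      by (rule degree_mult_le)
    also have "\<dots> \<le> degree [:0, 1 :: complex:] * (n - j) + degree [:1, \<tau>:] * j"
      by (intro add_mono degree_power_le)
    also have "\<dots> \<le> 1 * (n - j) + 1 * j" by (intro add_mono mult_right_mono) auto
    finally show "degree ([:0, 1:] ^ (n - j) * [:1, \<tau>:] ^ j) \<le> n" using j by simp
  qed simp
  have "\<forall>k. \<exists>e z. k \<in> {1..n+3} \<longrightarrow> e \<noteq> 0 \<and> S k = e * z \<and> U k = e * (1 + \<tau> * z)"
    using chart SU(1) \<tau> by blast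
  then obtain e z where ez: "\<And>k. k \<in> {1..n+3} \<Longrightarrow> e k \<noteq> 0 \<and> S k = e k * z k \<and> U k = e k * (1 + \<tau> * z k)"
    by metis
  have pk: "lookup (p k) = (\<lambda>l. e k ^ n * poly (c l) (z k))" if k: "k \<in> {1..n+3}" for k
  proof -
    have "lookup (p k) = \<gamma> (e k * z k) (e k * (1 + \<tau> * z k))" using SU(2)[OF k] ez[OF k] by simp
    then show ?thesis unfolding \<gamma>_scale c[symmetric] .
  qed
  have inj: "inj_on z {1..n+3}"
  proof (rule inj_onI)
    fix k l assume kl: "k \<in> {1..n+3}" "l \<in> {1..n+3}" "z k = z l"
    show "k = l"
    proof (rule points_not_proportional[OF gp n kl(1,2)])
      show "lookup (p k) j = (e k ^ n / e l ^ n) * lookup (p l) j" for j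
        using ez kl by (simp add: pk)
    qed
  qed
  obtain Q where Q: "degree Q \<le> n * ?d" "\<And>s. eval_at f (\<lambda>i. poly (c i) s) = poly Q s"
  proof -
    have "\<exists>Q. degree Q \<le> n * ?d \<and> (\<forall>s. eval_at f (\<lambda>i. poly (c i) s) = poly Q s)"
      by (rule eval_at_curve_degree[OF f deg]) (intro exI conjI allI)
    then show ?thesis using that by blast
  qed
  have "Q = 0"
  proof (rule ccontr)
    assume nz: "Q \<noteq> 0"
    have ord: "b * n \<le> order (z k) Q" if k: "k \<in> {1..n+3}" for k
    proof (rule order_ge_of_deg_along[OF f _ _ Q(2) nz])
      show "b * n \<le> ?d" by simp
      have "deg_along (?d - b * n) (eval_at f) (lookup (p k))"
        using deg_along_of_mult_ge[OF f mult[OF k]] by simp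
      then have "deg_along (?d - b * n) (eval_at f) (\<lambda>l. (1 / e k ^ n) * lookup (p k) l)"
        by (rule deg_along_scale)
      then show "deg_along (?d - b * n) (eval_at f) (\<lambda>i. poly (c i) (z k))"
        unfolding pk[OF k] using ez[OF k] by simp
    qed
    have pos: "b * n \<ge> 1" using n b by simp
    have "(n + 3) * (b * n) = (\<Sum>k\<in>{1..n+3}. b * n)" by simp
    also have "\<dots> \<le> (\<Sum>k\<in>{1..n+3}. order (z k) Q)" by (intro sum_mono ord)
    also have "\<dots> = (\<Sum>a\<in>z ` {1..n+3}. order a Q)" by (simp only: sum.reindex[OF inj] o_def)
    also have "\<dots> \<le> (\<Sum>a\<in>{a. poly Q a = 0}. order a Q)"
    proof (rule sum_mono2)
      show "finite {a. poly Q a = 0}" using nz by (rule poly_roots_finite)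
      show "z ` {1..n+3} \<subseteq> {a. poly Q a = 0}"
      proof
        fix a assume "a \<in> z ` {1..n+3}"
        then obtain k where k: "k \<in> {1..n+3}" "a = z k" by blast
        then have "1 \<le> order a Q" unfolding k(2) using ord[OF k(1)] pos by linarith
        then show "a \<in> {a. poly Q a = 0}" by (simp add: order_root)
      qed
    qed simp
    also have "\<dots> \<le> degree Q" by (rule sum_order_le_degree[OF nz])
    also have "\<dots> \<le> n * ?d" by (rule Q(1))
    finally have "(n + 3) * (b * n) \<le> n * ?d" .
    then show False using pos by (simp add: algebra_simps)
  qed
  obtain e1 z1 where "s1 = e1 * z1" "t1 = e1 * (1 + \<tau> * z1)" using chart[OF st1(1)] \<tau> by blast
  then have "lookup x = \<gamma> (e1 * z1) (e1 * (1 + \<tau> * z1))" using st1(2) by simp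
  then have "lookup x = (\<lambda>l. e1 ^ n * poly (c l) z1)" unfolding \<gamma>_scale c[symmetric] .
  then have "peval f x = (e1 ^ n) ^ ?d * eval_at f (\<lambda>l. poly (c l) z1)"
    unfolding peval_eq_eval_at by (simp only: eval_at_homogeneous[OF f])
  then show ?thesis by (simp add: Q(2) \<open>Q = 0\<close>)
qed

text \<open>
  The index \<open>(\<emptyset>, 1)\<close>: the join is then the closure of the curve itself.
\<close>

lemma rational_normal_curve_in_base_locus:
  assumes gp: "general_position n p" and n: "n \<ge> 1" and b: "b \<ge> 1"
    and C: "rational_normal_curve n C" and pC: "\<And>k. k \<in> {1..n+3} \<Longrightarrow> p k \<in> C"
  shows "proj_join n (proj_span (p ` {})) (secant_variety n 1 C) \<subseteq> base_locus n (b * (n + 2)) p (\<lambda>_. b * n)"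
proof -
  have "proj_span (p ` {}) = {}" by (simp add: proj_span_def)
  then have "proj_join n (proj_span (p ` {})) (secant_variety n 1 C) = secant_variety n 1 C"
    by (simp add: proj_join_def)
  also have "\<dots> \<subseteq> base_locus n (b * (n + 2)) p (\<lambda>_. b * n)"
  proof
    fix x assume x: "x \<in> secant_variety n 1 C"
    have "peval f x = 0" if f: "f \<in> system_forms n (b * (n + 2)) p (\<lambda>_. b * n)" for f
    proof -
      have form: "is_form n (b * (n + 2)) f" using f by (simp add: system_forms_def)
      have "peval f y = 0" if y: "y \<in> proj_span S" and S: "S \<subseteq> C" "card S = 1" for y S
      proof -
        obtain q where q: "S = {q}" using S(2) by (auto simp: card_1_singleton_iff)
        then obtain c where "y = cscale c q" using y by (auto simp: proj_span_def cvs.span_singleton)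
        then have "peval f y = c ^ (b * (n + 2)) * peval f q"
          unfolding peval_eq_eval_at by (simp only: lookup_cscale[abs_def] eval_at_homogeneous[OF form])
        then show ?thesis
          using system_vanishes_on_rational_normal_curve[OF gp n b C pC f, of q] q S(1) by simp
      qed
      then have "\<forall>y\<in>\<Union>{proj_span S | S. S \<subseteq> C \<and> finite S \<and> card S = 1 \<and> cvs.independent S}. peval f y = 0"
        by blast
      then show ?thesis using x form unfolding secant_variety_def zariski_closure_def by blast
    qed
    moreover have "x \<in> proj_points n" using x unfolding secant_variety_def zariski_closure_def by blast
    ultimately show "x \<in> base_locus n (b * (n + 2)) p (\<lambda>_. b * n)" by (simp add: base_locus_def)
  qed
  finally show ?thesis .
qed

section \<open>The theorem\<close>

lemma mult_ge_cscale:
  assumes "mult_ge n f x m"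
  shows "mult_ge n (cscale c f) x m"
proof -
  have "pdiff i (cscale c f) = cscale c (pdiff i f)" for i f
    by (rule poly_mapping_eqI) (simp add: lookup_pdiff)
  then have "foldr pdiff js (cscale c f) = cscale c (foldr pdiff js f)" for js
    by (induction js) simp_all
  then show ?thesis using assms by (simp add: mult_ge_def peval_eq_eval_at eval_at_cscale)
qed

lemma hypersurface_cscale:
  assumes "c \<noteq> 0"
  shows "hypersurface (cscale c f) = hypersurface f"
proof (intro set_eqI iffI)
  fix h assume "h \<in> hypersurface (cscale c f)"
  then obtain a where a: "a \<noteq> 0" "h = cscale a (cscale c f)" unfolding hypersurface_def by blast
  then have "h = cscale (a * c) f" "a * c \<noteq> 0" using assms cvs.scale_scale by auto
  then show "h \<in> hypersurface f" unfolding hypersurface_def by blast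
next
  fix h assume "h \<in> hypersurface f"
  then obtain a where a: "a \<noteq> 0" "h = cscale a f" unfolding hypersurface_def by blast
  then have "h = cscale (a / c) (cscale c f)" "a / c \<noteq> 0" using assms by simp_all
  then show "h \<in> hypersurface (cscale c f)" unfolding hypersurface_def by blast
qed

theorem proposition6p13:
  fixes n b d :: nat and p :: "nat \<Rightarrow> nat \<Rightarrow>\<^sub>0 complex" and m :: "nat \<Rightarrow> nat"
  assumes "n \<ge> 2" and "b \<ge> 1"
    and "general_position n p"
  defines "d \<equiv> b * (n + 2)" and "m \<equiv> (\<lambda>_. b * n)"
  shows "(even n \<longrightarrow> (\<exists>!H. H \<in> linear_system n d p m)) \<and>
    (odd n \<longrightarrow> linear_system n d p m = {}) \<and>
    (\<forall>C. rational_normal_curve n C \<and> (\<forall>i\<in>{1..n+3}. p i \<in> C) \<longrightarrow>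
       linear_system n d p m \<noteq> {} \<longrightarrow> special n d p m \<longrightarrow>
         (\<exists>I. (I, 0) \<in> sec_indices n \<and> card I \<ge> 2 \<and>
            proj_span (p ` I) \<subseteq> base_locus n d p m) \<or>
         (\<exists>I t. (I, t) \<in> sec_indices n \<and> t \<ge> 1 \<and>
            proj_join n (proj_span (p ` I)) (secant_variety n t C) \<subseteq> base_locus n d p m)) \<and>
    system_dim n d p m = sec_ldim n d p m"
proof -
  note gp = \<open>general_position n p\<close> and n = \<open>n \<ge> 2\<close> and b = \<open>b \<ge> 1\<close>
  have base: "\<exists>I t. (I, t) \<in> sec_indices n \<and> t \<ge> 1 \<and>
      proj_join n (proj_span (p ` I)) (secant_variety n t C) \<subseteq> base_locus n d p m"
    if C: "rational_normal_curve n C" "\<forall>i\<in>{1..n+3}. p i \<in> C" for C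
  proof (intro exI conjI)
    show "({}, 1) \<in> sec_indices n" using n by (auto simp: sec_indices_def)
    show "proj_join n (proj_span (p ` {})) (secant_variety n 1 C) \<subseteq> base_locus n d p m"
      unfolding d_def m_def
      by (rule rational_normal_curve_in_base_locus[OF gp _ b C(1)]) (use n C(2) in auto)
  qed simp
  show ?thesis
  proof (cases "even n")
    case True
    obtain f0 where f0: "f0 \<noteq> 0" "f0 \<in> system_forms n d p m"
      and uniq: "\<And>f. f \<in> system_forms n d p m \<Longrightarrow> \<exists>c. f = cscale c f0"
      and exact: "\<And>k m'. k \<in> {1..n+3} \<Longrightarrow> mult_ge n f0 (p k) m' \<Longrightarrow> m' \<le> b * n"
      using system_forms_even[OF gp b True] unfolding d_def m_def by blast
    have system: "linear_system n d p m = {hypersurface f0}"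
    proof
      show "linear_system n d p m \<subseteq> {hypersurface f0}"
      proof
        fix H assume "H \<in> linear_system n d p m"
        then obtain f where f: "f \<in> system_forms n d p m" "f \<noteq> 0" "H = hypersurface f"
          by (auto simp: linear_system_def)
        then obtain c where c: "f = cscale c f0" using uniq by blast
        then have "c \<noteq> 0" using f(2) by auto
        then show "H \<in> {hypersurface f0}" using f(3) c hypersurface_cscale by simp
      qed
    qed (use f0 in \<open>auto simp: linear_system_def\<close>)
    have "cvs.dim (system_forms n d p m) = 1"
    proof (rule cvs.dim_unique[of "{f0}"])
      show "system_forms n d p m \<subseteq> cvs.span {f0}" using uniq by (force simp: cvs.span_singleton)
    qed (use f0 in auto)
    then have dim: "system_dim n d p m = 1" by (simp add: system_dim_def)
    have bounded: "m' k \<le> b * n"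
      if sub: "linear_system n d p m \<subseteq> linear_system n d p m'" and k: "k \<in> {1..n+3}" for m' k
    proof -
      have "hypersurface f0 \<in> linear_system n d p m'" using sub system by simp
      then obtain f where f: "f \<in> system_forms n d p m'" "hypersurface f0 = hypersurface f"
        unfolding linear_system_def by blast
      have "f0 \<in> hypersurface f0"
        unfolding hypersurface_def by (intro CollectI exI[of _ 1] conjI) simp_all
      then have "f0 \<in> hypersurface f" using f(2) by simp
      then obtain c where c: "f0 = cscale c f" unfolding hypersurface_def by blast
      have "mult_ge n f0 (p k) (m' k)"
        unfolding c using f(1) k by (intro mult_ge_cscale) (simp add: system_forms_def)
      then show ?thesis using exact[OF k] by blast
    qed
    have "\<not> (\<exists>m'. linear_system n d p m \<subseteq> linear_system n d p m' \<and> sec_vdim n d m' < 0)"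
      using sec_vdim_nonneg[OF True b] bounded unfolding d_def by (metis not_less)
    then have "sec_ldim n d p m = 1"
      using sec_vdim_balanced(2)[OF b True] by (simp add: sec_ldim_def d_def m_def)
    then show ?thesis using True system dim base by auto
  next
    case False
    have sys: "system_forms n d p m = {0}"
      unfolding d_def m_def by (rule system_forms_odd[OF gp b False])
    then have empty: "linear_system n d p m = {}" by (simp add: linear_system_def)
    have "sec_ldim n d p m = 0"
      using sec_vdim_balanced(1)[OF b, of n] False by (simp add: sec_ldim_def d_def m_def)
    moreover have "system_dim n d p m = 0"
      using cvs.dim_unique[of "{}" "{0}" 0] cvs.independent_empty by (simp add: system_dim_def sys)
    ultimately show ?thesis using False empty by simp
  qed
qed

end
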